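(* For each $\varepsilon>0$ there exists $c>0$ such that the following holds. If $M<\log n$ is a (positive) integer and $f\in L^2(A_n)$ is $r$-biglobal with $\|f\|_1=1$ and $\|f\|_2\le e^{cr^{-2}n^{1-1/M}}$, then $\|f^{*M}-1\|_2<\varepsilon$.
   Context: $A_n$ is the alternating group on $[n]=\{1,\dots,n\}$; $L^2(A_n)$ is the space of real-valued functions on $A_n$ with the uniform probability measure, and $\|f\|_p=(\mathbb{E}_{\sigma\in A_n}|f(\sigma)|^p)^{1/p}$. Here $r>0$ is real. Convolution: $(f*g)(\sigma)=\mathbb{E}_{\tau\sim A_n}[f(\tau)g(\tau^{-1}\sigma)]$; $f^{*M}=f*\cdots*f$ is the $M$-fold convolution (with $M$ factors), and $1$ is the function identically equal to $1$. Biglobalness: let $[n]_t$ be the set of $t$-tuples of distinct elements of $[n]$. For $I,J\in[n]_t$ let $U_{I\to J}=\{\sigma\in A_n:\sigma(I_s)=J_s\text{ for all }s\}$ and, if this set is non-empty, let $f_{I\to J}$ be the restriction of $f$ to $U_{I\to J}$, with norms taken with respect to the uniform probability measure on $U_{I\to J}$. The function $f$ is $r$-biglobal if $\|f_{I\to J}\|_1\le r^t\|f\|_1$ and $\|f_{I\to J}\|_2\le r^t\|f\|_2$ for all $t\le n$ and all such $I,J\in[n]_t$.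
   Formalization: The function f is additionally assumed nonnegative on A_n (equivalently, given ‖f‖₁ = 1, that f has mean 1); for signed f the claim is false, e.g. f = −1, M = 1, r = 1, n ≥ 3 gives ‖f − 1‖₂ = 2. *)

theory Defs
  imports "HOL-Algebra.Sym_Groups" "HOL-Analysis.Analysis"
begin

text \<open>
  The group A_n is \<^term>\<open>alt_group n\<close>, the even permutations of {1..n}. A function on A_n is
  a total function on \<^typ>\<open>nat \<Rightarrow> nat\<close> of which only the values on the carrier are ever used.
\<close>

definition avg :: "'a set \<Rightarrow> ('a \<Rightarrow> real) \<Rightarrow> real" where
  "avg S f = (\<Sum>x\<in>S. f x) / real (card S)"

definition Lp_norm :: "real \<Rightarrow> 'a set \<Rightarrow> ('a \<Rightarrow> real) \<Rightarrow> real" where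
  "Lp_norm p S f = avg S (\<lambda>x. \<bar>f x\<bar> powr p) powr (1 / p)"

definition conv ::
  "nat \<Rightarrow> ((nat \<Rightarrow> nat) \<Rightarrow> real) \<Rightarrow> ((nat \<Rightarrow> nat) \<Rightarrow> real) \<Rightarrow> (nat \<Rightarrow> nat) \<Rightarrow> real" where
  "conv n f g \<sigma> =
     avg (carrier (alt_group n))
       (\<lambda>\<tau>. f \<tau> * g (inv\<^bsub>alt_group n\<^esub> \<tau> \<otimes>\<^bsub>alt_group n\<^esub> \<sigma>))"

text \<open>Convolution of M factors f; the value at M = 0 is a junk value.\<close>

definition conv_power ::
  "nat \<Rightarrow> ((nat \<Rightarrow> nat) \<Rightarrow> real) \<Rightarrow> nat \<Rightarrow> (nat \<Rightarrow> nat) \<Rightarrow> real" where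
  "conv_power n f M = (conv n f ^^ (M - 1)) f"

definition tuples :: "nat \<Rightarrow> nat \<Rightarrow> nat list set" where
  "tuples n t = {I. length I = t \<and> distinct I \<and> set I \<subseteq> {1..n}}"

definition U :: "nat \<Rightarrow> nat list \<Rightarrow> nat list \<Rightarrow> (nat \<Rightarrow> nat) set" where
  "U n I J = {\<sigma> \<in> carrier (alt_group n). \<forall>s < length I. \<sigma> (I ! s) = J ! s}"

definition biglobal :: "nat \<Rightarrow> real \<Rightarrow> ((nat \<Rightarrow> nat) \<Rightarrow> real) \<Rightarrow> bool" where
  "biglobal n r f \<longleftrightarrow>
     (\<forall>t\<le>n. \<forall>I\<in>tuples n t. \<forall>J\<in>tuples n t. U n I J \<noteq> {} \<longrightarrow>
        Lp_norm 1 (U n I J) f \<le> r ^ t * Lp_norm 1 (carrier (alt_group n)) f \<and>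
        Lp_norm 2 (U n I J) f \<le> r ^ t * Lp_norm 2 (carrier (alt_group n)) f)"

lemma finite_alt_carrier: "finite (carrier (alt_group n))"
proof -
  have "carrier (alt_group n) \<subseteq> {p. p permutes {1..n}}"
    by (auto simp: alt_group_def)
  then show ?thesis
    by (rule finite_subset) (simp add: finite_permutations)
qed

lemma alt_carrier_nonempty: "carrier (alt_group n) \<noteq> {}"
  using group.is_monoid[OF alt_group_is_group, THEN monoid.one_closed] by blast

lemma Lp_norm_const:
  assumes "finite S" "S \<noteq> {}" "p > 0"
  shows "Lp_norm p S (\<lambda>_. a) = \<bar>a\<bar>"
  using assms by (simp add: Lp_norm_def avg_def powr_powr)

text \<open>
  The mixing theorem is about densities: a function f with 1-norm equal to 1 is nonnegative iff its
  mean is 1. The following shows that it fails for signed real functions with 1-norm equal to 1,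
  because the 1-norm hypothesis does not see the sign of f.
\<close>

lemma mixing_fails_for_signed_functions:
  fixes c :: real
  assumes "c > 0" "n \<ge> 3"
  defines "G \<equiv> carrier (alt_group n)"
  defines "f \<equiv> (\<lambda>_. - 1) :: (nat \<Rightarrow> nat) \<Rightarrow> real"
  shows "real 1 < ln (real n)" "biglobal n 1 f" "Lp_norm 1 G f = 1"
    "Lp_norm 2 G f \<le> exp (c * (1 powr -2) * real n powr (1 - 1 / real 1))"
    "Lp_norm 2 G (\<lambda>\<sigma>. conv_power n f 1 \<sigma> - 1) = 2"
proof -
  have fin: "finite G" "G \<noteq> {}"
    unfolding G_def by (rule finite_alt_carrier alt_carrier_nonempty)+
  have "ln (3::real) \<le> ln (real n)" using assms(2) by simp
  with ln3_gt_1 show "real 1 < ln (real n)" by simp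
  show "biglobal n 1 f"
    unfolding biglobal_def
  proof (intro allI impI ballI)
    fix t I J assume "U n I J \<noteq> {}"
    moreover have "finite (U n I J)"
      using fin(1) by (auto simp: U_def G_def)
    ultimately show "Lp_norm 1 (U n I J) f \<le> 1 ^ t * Lp_norm 1 (carrier (alt_group n)) f \<and>
        Lp_norm 2 (U n I J) f \<le> 1 ^ t * Lp_norm 2 (carrier (alt_group n)) f"
      using fin by (simp add: f_def Lp_norm_const flip: G_def)
  qed
  show "Lp_norm 1 G f = 1" using fin by (simp add: f_def Lp_norm_const)
  show "Lp_norm 2 G f \<le> exp (c * (1 powr -2) * real n powr (1 - 1 / real 1))"
    using fin assms by (simp add: f_def Lp_norm_const)
  show "Lp_norm 2 G (\<lambda>\<sigma>. conv_power n f 1 \<sigma> - 1) = 2"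
    using fin by (simp add: f_def conv_power_def Lp_norm_const)
qed

end

theory Submission
  imports Defs
begin

text \<open>
  Call a function of \<open>d\<close> points of a permutation pure of level \<open>d\<close> if it averages to zero in every one of the
  points. A density \<open>f\<close> acts on these functions by \<open>e \<mapsto> (\<iota> \<mapsto> E f(\<tau>) e(\<tau> \<iota>))\<close>, convolution becomes composition,
  and the part of \<open>f\<close> that is correlated with functions of few points is controlled by the
  Hilbert-Schmidt norms of this action. To bound them, one antisymmetrizes over disjoint transpositions of
  positions; this turns pure functions into homogeneous polynomials on the discrete cube, where Bonami's
  inequality applies. Since \<open>f\<close> is nonnegative, globalness in the 1-norm at \<open>2 * d\<close> points is all that is needed
  afterwards. With \<open>L\<close> the logarithm of the 2-norm of \<open>f\<close>, the squared Hilbert-Schmidt norm at level \<open>d\<close> is at most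
  \<open>(C r\<^sup>2 (L + d) / n) ^ d\<close>, and its \<open>M\<close>-th power beats the factor \<open>n ^ d\<close> with which it enters the 2-norm of the
  convolution power.

  On the functions orthogonal to all functions of \<open>D\<close> points, the top eigenspace of convolution with \<open>f\<close> is
  right invariant, hence of dimension at least \<open>2 ^ (D / 4)\<close>, and comparing with the Hilbert-Schmidt norm of
  the convolution operator shows that each convolution is a strong contraction. The choice
  \<open>D = 24 * L + O(1)\<close> makes both contributions small.
\<close>

section \<open>Averages, orthonormal families and eigenspaces\<close>

text \<open>The group has no product structure, so Bonami's inequality is applied on cosets of the
  elementary abelian 2-group of the swaps \<open>sw N Y\<close>, and there only to the part that is
  odd in exactly d coordinates. What makes this efficient is that a pure function pairs with its
  antisymmetrization to at least half of its square norm. Functions of at most n - 2 points do not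
  see parity. The levels are therefore treated on the symmetric group, where single transpositions
  are available, although f lives on even permutations. In place of irreducible representations, an
  extremal quotient of two quadratic forms is attained, and the functions attaining it form a
  subspace that inherits all symmetries of the forms. Norm comparisons and dimension bounds need
  only be made on this subspace. The estimates contain additive constants beside L, which are
  absorbed only if L is bounded below. For L below a threshold depending on \<epsilon>, f is already
  close to 1 in the 2-norm, and convolution with a density does not increase the distance. The case
  M = 1 always falls under this threshold.\<close>

lemma avg_cong: "(\<And>x. x \<in> S \<Longrightarrow> f x = g x) \<Longrightarrow> avg S f = avg S g"
  by (simp add: avg_def)

lemma avg_add: "avg S (\<lambda>x. f x + g x) = avg S f + avg S g"
  by (simp add: avg_def sum.distrib add_divide_distrib)

lemma avg_diff: "avg S (\<lambda>x. f x - g x) = avg S f - avg S g"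
  by (simp add: avg_def sum_subtractf diff_divide_distrib)

lemma avg_minus: "avg S (\<lambda>x. - f x) = - avg S f"
  by (simp add: avg_def sum_negf)

lemma avg_cmult: "avg S (\<lambda>x. c * f x) = c * avg S f"
  by (simp add: avg_def sum_distrib_left)

lemma avg_cmult_right: "avg S (\<lambda>x. f x * c) = avg S f * c"
  by (simp add: avg_def sum_distrib_right)

lemma avg_sum: "avg S (\<lambda>x. \<Sum>i\<in>I. f i x) = (\<Sum>i\<in>I. avg S (f i))"
  unfolding avg_def by (subst sum.swap) (simp add: sum_divide_distrib)

lemma avg_swap: "avg S (\<lambda>x. avg T (f x)) = avg T (\<lambda>y. avg S (\<lambda>x. f x y))"
  unfolding avg_def by (simp add: sum_divide_distrib[symmetric] mult.commute) (subst sum.swap, simp)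

lemma avg_mono: "(\<And>x. x \<in> S \<Longrightarrow> f x \<le> g x) \<Longrightarrow> avg S f \<le> avg S g"
  unfolding avg_def by (intro divide_right_mono sum_mono) auto

lemma avg_nonneg: "(\<And>x. x \<in> S \<Longrightarrow> 0 \<le> f x) \<Longrightarrow> 0 \<le> avg S f"
  unfolding avg_def by (intro divide_nonneg_nonneg sum_nonneg) auto

lemma avg_const: "finite S \<Longrightarrow> S \<noteq> {} \<Longrightarrow> avg S (\<lambda>_. c) = c"
  by (simp add: avg_def)

lemma avg_eq_0_iff:
  assumes "finite S" "\<And>x. x \<in> S \<Longrightarrow> 0 \<le> f x" "avg S f = 0" "x \<in> S"
  shows "f x = 0"
proof -
  have "sum f S = 0" using assms by (auto simp: avg_def)
  then show ?thesis using assms sum_nonneg_eq_0_iff by blast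
qed

lemma avg_reindex:
  assumes "bij_betw h S T"
  shows "avg S (\<lambda>x. f (h x)) = avg T f"
  unfolding avg_def sum.reindex_bij_betw[OF assms, of f] bij_betw_same_card[OF assms] ..

lemma avg_Cauchy_Schwarz: "(avg S (\<lambda>x. f x * g x))\<^sup>2 \<le> avg S (\<lambda>x. (f x)\<^sup>2) * avg S (\<lambda>x. (g x)\<^sup>2)"
proof -
  have "(\<Sum>x\<in>S. f x * g x)\<^sup>2 \<le> (\<Sum>x\<in>S. (f x)\<^sup>2) * (\<Sum>x\<in>S. (g x)\<^sup>2)"
    by (rule Cauchy_Schwarz_ineq_sum)
  then show ?thesis
    by (simp add: avg_def power_divide power2_eq_square divide_right_mono)
qed

lemma avg_square_le:
  assumes "finite S" "S \<noteq> {}"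
  shows "(avg S f)\<^sup>2 \<le> avg S (\<lambda>x. (f x)\<^sup>2)"
  using avg_Cauchy_Schwarz[of S f "\<lambda>_. 1"] assms by (simp add: avg_const)

text \<open>By convexity the tangent of z^k at m lies below the curve. In the induction, z times the
  tangent for k exceeds the tangent for k + 1 by a nonnegative multiple of (z - m)^2.\<close>

lemma power_tangent:
  fixes z m :: real
  assumes "0 \<le> z" "0 \<le> m"
  shows "m ^ k + real k * m ^ (k - 1) * (z - m) \<le> z ^ k"
proof (induction k)
  case (Suc k)
  show ?case
  proof (cases k)
    case (Suc j)
    have "(m ^ k + real k * m ^ (k - 1) * (z - m)) * z \<le> z ^ k * z"
      using Suc.IH assms by (intro mult_right_mono) auto
    moreover have "(m ^ k + real k * m ^ (k - 1) * (z - m)) * z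
        = m ^ Suc k + real (Suc k) * m ^ k * (z - m) + real k * m ^ j * (z - m)\<^sup>2"
      by (simp add: Suc algebra_simps power2_eq_square)
    moreover have "0 \<le> real k * m ^ j * (z - m)\<^sup>2"
      using assms by simp
    ultimately show ?thesis by (simp add: mult.commute)
  qed simp
qed simp

text \<open>At the weighted mean m the linear term of \<open>power_tangent\<close> averages to zero,
  because w has mean 1. The weight will be the density f.\<close>

lemma avg_power_Jensen:
  assumes "finite S" "\<And>x. x \<in> S \<Longrightarrow> 0 \<le> w x" "avg S w = 1" "\<And>x. x \<in> S \<Longrightarrow> 0 \<le> z x"
  shows "(avg S (\<lambda>x. w x * z x)) ^ k \<le> avg S (\<lambda>x. w x * z x ^ k)"
proof -
  define m where "m = avg S (\<lambda>x. w x * z x)"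
  have m: "0 \<le> m" unfolding m_def using assms by (intro avg_nonneg) auto
  have "avg S (\<lambda>x. w x * (m ^ k + real k * m ^ (k - 1) * (z x - m))) \<le> avg S (\<lambda>x. w x * z x ^ k)"
    using assms m by (intro avg_mono mult_left_mono power_tangent) auto
  moreover have "(\<lambda>x. w x * (m ^ k + real k * m ^ (k - 1) * (z x - m)))
     = (\<lambda>x. (m ^ k - real k * m ^ (k - 1) * m) * w x + (real k * m ^ (k - 1)) * (w x * z x))"
    by (auto simp: algebra_simps)
  ultimately show ?thesis
    by (simp add: avg_add avg_cmult assms flip: m_def)
qed

section \<open>Inner products and subspaces of functions\<close>

abbreviation sqnorm :: "'a set \<Rightarrow> ('a \<Rightarrow> real) \<Rightarrow> real" where
  "sqnorm S u \<equiv> avg S (\<lambda>x. (u x)\<^sup>2)"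

definition ip :: "'a set \<Rightarrow> ('a \<Rightarrow> real) \<Rightarrow> ('a \<Rightarrow> real) \<Rightarrow> real" where
  "ip S f g = avg S (\<lambda>x. f x * g x)"

lemma ip_commute: "ip S f g = ip S g f"
  by (simp add: ip_def mult.commute)

lemma ip_lin: "ip S (\<lambda>x. a * f x + b * g x) h = a * ip S f h + b * ip S g h"
  by (simp add: ip_def algebra_simps avg_add avg_cmult)

lemma ip_diff: "ip S (\<lambda>x. f x - g x) h = ip S f h - ip S g h"
  by (simp add: ip_def algebra_simps avg_diff)

lemma ip_sum: "ip S (\<lambda>x. \<Sum>i\<in>I. c i * e i x) h = (\<Sum>i\<in>I. c i * ip S (e i) h)"
  by (simp add: ip_def sum_distrib_right avg_sum mult.assoc avg_cmult)

lemma ip_diff_right: "ip S h (\<lambda>x. f x - g x) = ip S h f - ip S h g"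
  by (metis ip_commute ip_diff)

lemma ip_sum_right: "ip S h (\<lambda>x. \<Sum>i\<in>I. c i * e i x) = (\<Sum>i\<in>I. c i * ip S h (e i))"
  by (simp add: ip_commute[of S h] ip_sum)

lemma ip_self: "ip S f f = avg S (\<lambda>x. (f x)\<^sup>2)"
  by (simp add: ip_def power2_eq_square)

lemma ip_nonneg: "0 \<le> ip S f f"
  by (simp add: ip_self avg_nonneg)

lemma ip_cong: "(\<And>x. x \<in> S \<Longrightarrow> f x = f' x) \<Longrightarrow> (\<And>x. x \<in> S \<Longrightarrow> g x = g' x) \<Longrightarrow> ip S f g = ip S f' g'"
  by (auto simp: ip_def intro!: avg_cong)

lemma ip_self_eq_0D: "finite S \<Longrightarrow> ip S f f = 0 \<Longrightarrow> x \<in> S \<Longrightarrow> f x = 0"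
  using avg_eq_0_iff[of S "\<lambda>x. f x * f x" x] by (simp add: ip_def)

text \<open>Functions are total while \<open>ip S\<close> sees only their values on S, so the form
  is merely semidefinite on such a set; basis expansions below hold at the points of S only.\<close>

definition fsubspace :: "('a \<Rightarrow> real) set \<Rightarrow> bool" where
  "fsubspace P \<longleftrightarrow> (\<lambda>_. 0) \<in> P \<and> (\<forall>f\<in>P. \<forall>g\<in>P. \<forall>a b. (\<lambda>x. a * f x + b * g x) \<in> P)"

lemma fsubspace_lin: "fsubspace P \<Longrightarrow> f \<in> P \<Longrightarrow> g \<in> P \<Longrightarrow> (\<lambda>x. a * f x + b * g x) \<in> P"
  by (auto simp: fsubspace_def)

lemma fsubspace_diff: "fsubspace P \<Longrightarrow> f \<in> P \<Longrightarrow> g \<in> P \<Longrightarrow> (\<lambda>x. f x - g x) \<in> P"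
  using fsubspace_lin[of P f g 1 "-1"] by simp

lemma fsubspace_cmult: "fsubspace P \<Longrightarrow> f \<in> P \<Longrightarrow> (\<lambda>x. a * f x) \<in> P"
  using fsubspace_lin[of P f f a 0] by simp

lemma fsubspace_sum:
  assumes "fsubspace P" "\<And>i. i \<in> I \<Longrightarrow> e i \<in> P"
  shows "(\<lambda>x. \<Sum>i\<in>I. c i * e i x) \<in> P"
proof (cases "finite I")
  case True
  then show ?thesis using assms(2)
  proof (induction I)
    case (insert i I)
    then have "(\<lambda>x. c i * e i x + 1 * (\<Sum>i\<in>I. c i * e i x)) \<in> P"
      by (intro fsubspace_lin[OF assms(1)]) auto
    then show ?case using insert by simp
  qed (use assms in \<open>auto simp: fsubspace_def\<close>)
qed (use assms in \<open>auto simp: fsubspace_def\<close>)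

lemma fsubspace_avg:
  assumes "fsubspace P" "\<And>i. i \<in> I \<Longrightarrow> e i \<in> P"
  shows "(\<lambda>x. avg I (\<lambda>i. e i x)) \<in> P"
  using fsubspace_sum[OF assms(1), of I e "\<lambda>_. 1 / real (card I)"] assms(2)
  by (simp add: avg_def sum_divide_distrib)

section \<open>Orthonormal families and bases\<close>

definition orthonormal :: "'a set \<Rightarrow> nat \<Rightarrow> (nat \<Rightarrow> 'a \<Rightarrow> real) \<Rightarrow> bool" where
  "orthonormal S k e \<longleftrightarrow> (\<forall>i<k. \<forall>j<k. ip S (e i) (e j) = (if i = j then 1 else 0))"

lemma orthonormal_coeff:
  assumes "orthonormal S k e" "j < k"
  shows "ip S (\<lambda>x. \<Sum>i<k. c i * e i x) (e j) = c j"
proof -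
  have "ip S (\<lambda>x. \<Sum>i<k. c i * e i x) (e j) = (\<Sum>i<k. c i * (if i = j then 1 else 0))"
    unfolding ip_sum using assms by (intro sum.cong) (auto simp: orthonormal_def)
  then show ?thesis using assms by (simp add: if_distrib cong: if_cong)
qed

lemma orthonormal_Parseval:
  assumes "orthonormal S k e"
  shows "ip S (\<lambda>x. \<Sum>i<k. c i * e i x) (\<lambda>x. \<Sum>i<k. d i * e i x) = (\<Sum>i<k. c i * d i)"
  unfolding ip_sum_right using orthonormal_coeff[OF assms]
  by (auto intro!: sum.cong)

lemma Bessel:
  assumes "orthonormal S k e"
  shows "(\<Sum>i<k. (ip S h (e i))\<^sup>2) \<le> ip S h h"
proof -
  define p where "p = (\<lambda>x. \<Sum>i<k. ip S h (e i) * e i x)"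
  have hp: "ip S h p = (\<Sum>i<k. (ip S h (e i))\<^sup>2)"
    unfolding p_def ip_sum_right by (simp add: power2_eq_square)
  have pp: "ip S p p = (\<Sum>i<k. (ip S h (e i))\<^sup>2)"
    unfolding p_def orthonormal_Parseval[OF assms] by (simp add: power2_eq_square)
  have "0 \<le> ip S (\<lambda>x. h x - p x) (\<lambda>x. h x - p x)" by (rule ip_nonneg)
  then show ?thesis
    using hp pp by (simp add: ip_diff ip_diff_right ip_commute[of S p h])
qed

text \<open>Bessel's inequality for the function that represents evaluation at x bounds the sum of
  the squares of the e i x by card S; the average of this sum over x is k.\<close>

lemma orthonormal_card_le:
  assumes "finite S" "S \<noteq> {}" "orthonormal S k e"
  shows "k \<le> card S"
proof -
  have "(\<Sum>i<k. (e i x)\<^sup>2) \<le> real (card S)" if x: "x \<in> S" for x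
  proof -
    define \<delta> where "\<delta> = (\<lambda>y. if y = x then real (card S) else 0)"
    have ip: "ip S \<delta> g = g x" for g
      using assms x by (simp add: \<delta>_def ip_def avg_def if_distrib[of "\<lambda>t. t * _"] cong: if_cong)
    show ?thesis using Bessel[OF assms(3), of \<delta>] unfolding ip by (simp add: \<delta>_def)
  qed
  then have "avg S (\<lambda>x. \<Sum>i<k. (e i x)\<^sup>2) \<le> avg S (\<lambda>x. real (card S))"
    by (rule avg_mono)
  moreover have "avg S (\<lambda>x. \<Sum>i<k. (e i x)\<^sup>2) = (\<Sum>i<k. 1)"
    unfolding avg_sum using assms(3) by (intro sum.cong) (auto simp: orthonormal_def ip_self[symmetric])
  ultimately show ?thesis using assms by (simp add: avg_const)
qed

lemma orthonormal_extend:
  assumes "orthonormal S k e" "ip S v v \<noteq> 0" "\<And>i. i < k \<Longrightarrow> ip S v (e i) = 0"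
  shows "orthonormal S (Suc k) (e(k := (\<lambda>x. v x / sqrt (ip S v v))))"
proof -
  have s: "ip S (\<lambda>x. v x / sqrt (ip S v v)) h = ip S v h / sqrt (ip S v v)" for h
    using ip_lin[of S "1 / sqrt (ip S v v)" v 0 v h] by simp
  then have s': "ip S h (\<lambda>x. v x / sqrt (ip S v v)) = ip S v h / sqrt (ip S v v)" for h
    by (metis ip_commute)
  have "ip S v v > 0" using assms(2) ip_nonneg[of S v] by simp
  then show ?thesis
    using assms unfolding orthonormal_def by (auto simp: less_Suc_eq s s')
qed

text \<open>Take a family in P of maximal length, which exists by
  \<open>orthonormal_card_le\<close>. A residual of positive norm could be normalized and appended,
  so every residual vanishes on S.\<close>

lemma orthonormal_basis_exists:
  assumes "finite S" "S \<noteq> {}" "fsubspace P"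
  obtains k e where "orthonormal S k e" "\<And>i. i < k \<Longrightarrow> e i \<in> P"
    "\<And>v x. v \<in> P \<Longrightarrow> x \<in> S \<Longrightarrow> v x = (\<Sum>i<k. ip S v (e i) * e i x)"
proof -
  let ?Q = "\<lambda>k. \<exists>e. orthonormal S k e \<and> (\<forall>i<k. e i \<in> P)"
  have "?Q 0" by (auto simp: orthonormal_def)
  moreover have "\<forall>k. ?Q k \<longrightarrow> k \<le> card S" using orthonormal_card_le assms by blast
  ultimately obtain k where k: "?Q k" "\<And>j. ?Q j \<Longrightarrow> j \<le> k"
    using ex_has_greatest_nat[of ?Q 0 id "Suc (card S)"] by (auto simp: less_Suc_eq_le)
  then obtain e where e: "orthonormal S k e" "\<forall>i<k. e i \<in> P" by blast
  have "v x = (\<Sum>i<k. ip S v (e i) * e i x)" if v: "v \<in> P" and x: "x \<in> S" for v x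
  proof -
    define w where "w = (\<lambda>x. v x - (\<Sum>i<k. ip S v (e i) * e i x))"
    have wP: "w \<in> P" unfolding w_def
      using v e by (intro fsubspace_diff[OF assms(3)] fsubspace_sum[OF assms(3)]) auto
    have "ip S w (e i) = 0" if "i < k" for i
      unfolding w_def ip_diff using orthonormal_coeff[OF e(1) that, of "\<lambda>i. ip S v (e i)"] by simp
    then have ext: "orthonormal S (Suc k) (e(k := (\<lambda>x. w x / sqrt (ip S w w))))" if "ip S w w \<noteq> 0"
      by (rule orthonormal_extend[OF e(1) that])
    have "(\<lambda>x. w x / sqrt (ip S w w)) \<in> P"
      using fsubspace_cmult[OF assms(3) wP, of "1 / sqrt (ip S w w)"] by simp
    then have "\<forall>i<Suc k. (e(k := (\<lambda>x. w x / sqrt (ip S w w)))) i \<in> P"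
      using e(2) by (auto simp: less_Suc_eq)
    then have "ip S w w = 0"
      using ext k(2)[of "Suc k"] by (meson not_less_eq_eq order_refl)
    then show ?thesis using ip_self_eq_0D[OF assms(1) _ x, of w] by (simp add: w_def)
  qed
  then show ?thesis using that e by blast
qed

section \<open>Maxima of quadratic forms\<close>

text \<open>The dimension k is a term and not a type, so coefficient vectors are sequences that
  vanish from k on; compactness comes from Tychonoff's theorem for a product of intervals and
  singletons.\<close>

lemma compact_unit_sphere_nat:
  "compact {c :: nat \<Rightarrow> real. (\<forall>i\<ge>k. c i = 0) \<and> (\<Sum>i<k. (c i)\<^sup>2) = 1}" (is "compact ?A")
proof -
  have "compactin (product_topology (\<lambda>_::nat. euclidean :: real topology) UNIV)
     (PiE UNIV (\<lambda>i. if i < k then {-1..1} else {0}))"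
    unfolding compactin_PiE by simp
  then have K: "compact (PiE UNIV (\<lambda>i::nat. if i < k then {-1..1::real} else {0}))"
    unfolding euclidean_product_topology by simp
  have cont: "continuous_on UNIV (\<lambda>c :: nat \<Rightarrow> real. \<Sum>i<k. (c i)\<^sup>2)"
    by (intro continuous_on_sum continuous_on_power continuous_on_product_coordinates)
  have A: "?A = PiE UNIV (\<lambda>i. if i < k then {-1..1} else {0}) \<inter> {c. (\<Sum>i<k. (c i)\<^sup>2) = 1}"
  proof (intro equalityI subsetI)
    fix c assume c: "c \<in> ?A"
    have "c i \<in> (if i < k then {-1..1} else {0})" for i
    proof (cases "i < k")
      case True
      then have "(c i)\<^sup>2 \<le> (\<Sum>i<k. (c i)\<^sup>2)" by (intro member_le_sum) auto
      then have "\<bar>c i\<bar> \<le> 1" using c by (simp add: abs_square_le_1)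
      then show ?thesis using True by (simp add: abs_le_iff)
    qed (use c in simp)
    then show "c \<in> PiE UNIV (\<lambda>i. if i < k then {-1..1} else {0}) \<inter> {c. (\<Sum>i<k. (c i)\<^sup>2) = 1}"
      using c by (simp add: PiE_UNIV_domain Pi_iff)
  next
    fix c :: "nat \<Rightarrow> real"
    assume c: "c \<in> PiE UNIV (\<lambda>i. if i < k then {-1..1} else {0}) \<inter> {c. (\<Sum>i<k. (c i)\<^sup>2) = 1}"
    then have "c i \<in> (if i < k then {-1..1} else {0})" for i
      by (simp add: PiE_UNIV_domain Pi_iff)
    from this[of "_ :: nat"] have "\<forall>i\<ge>k. c i = 0" by (metis not_le singletonD)
    then show "c \<in> ?A" using c by simp
  qed
  have "closed {c :: nat \<Rightarrow> real. (\<Sum>i<k. (c i)\<^sup>2) = 1}"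
    by (rule closed_Collect_eq[OF cont continuous_on_const])
  then show ?thesis unfolding A by (rule compact_Int_closed[OF K])
qed

lemma quadratic_form_attains_max:
  fixes q :: "nat \<Rightarrow> nat \<Rightarrow> real"
  assumes "k > 0"
  obtains c where "(\<Sum>i<k. (c i)\<^sup>2) = 1"
    "\<And>c'. (\<Sum>i<k. (c' i)\<^sup>2) = 1 \<Longrightarrow> (\<Sum>i<k. \<Sum>j<k. c' i * c' j * q i j) \<le> (\<Sum>i<k. \<Sum>j<k. c i * c j * q i j)"
proof -
  let ?A = "{c :: nat \<Rightarrow> real. (\<forall>i\<ge>k. c i = 0) \<and> (\<Sum>i<k. (c i)\<^sup>2) = 1}"
  let ?q = "\<lambda>c. \<Sum>i<k. \<Sum>j<k. c i * c j * q i j"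
  have "(\<Sum>i<k. (if i = 0 then 1 else 0 :: real)\<^sup>2) = (\<Sum>i<k. if i = 0 then 1 else 0)"
    by (intro sum.cong) auto
  also have "\<dots> = 1" using assms by (simp add: sum.delta)
  finally have "(\<lambda>i. if i = 0 then 1 else 0) \<in> ?A" using assms by simp
  then have ne: "?A \<noteq> {}" by (metis empty_iff)
  have "continuous_on UNIV ?q"
    by (intro continuous_on_sum continuous_on_mult continuous_on_const continuous_on_product_coordinates)
  then have "continuous_on ?A ?q"
    by (rule continuous_on_subset) simp
  then have "\<exists>c\<in>?A. \<forall>c'\<in>?A. ?q c' \<le> ?q c"
    by (rule continuous_attains_sup[OF compact_unit_sphere_nat ne])
  then obtain c where c: "c \<in> ?A" "\<forall>c'\<in>?A. ?q c' \<le> ?q c" ..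
  have "?q c' \<le> ?q c" if c': "(\<Sum>i<k. (c' i)\<^sup>2) = 1" for c'
  proof -
    define c'' where "c'' = (\<lambda>i. if i < k then c' i else 0)"
    have c'': "c'' i = c' i" if "i < k" for i using that by (simp add: c''_def)
    have "(\<Sum>i<k. (c'' i)\<^sup>2) = (\<Sum>i<k. (c' i)\<^sup>2)" by (rule sum.cong) (simp_all add: c'')
    then have "(\<Sum>i<k. (c'' i)\<^sup>2) = 1" using c' by (rule trans)
    then have "c'' \<in> ?A" by (simp add: c''_def)
    then have "?q c'' \<le> ?q c" using c(2) by (rule bspec[rotated])
    moreover have "?q c'' = ?q c'" by (intro sum.cong) (simp_all add: c'')
    ultimately show ?thesis by (simp only:)
  qed
  moreover have "(\<Sum>i<k. (c i)\<^sup>2) = 1" using c(1) by simp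
  ultimately show ?thesis by (intro that[of c])
qed

text \<open>The last clause lets a function be replaced by a basis expansion that is valid on S
  only. Signs are left open: \<open>max_eigenspace\<close> is applied to a positive and to a
  negative semidefinite form.\<close>

definition bilinear_form :: "'a set \<Rightarrow> (('a \<Rightarrow> real) \<Rightarrow> ('a \<Rightarrow> real) \<Rightarrow> real) \<Rightarrow> bool" where
  "bilinear_form S Q \<longleftrightarrow>
     (\<forall>f g h a b. Q (\<lambda>x. a * f x + b * g x) h = a * Q f h + b * Q g h) \<and>
     (\<forall>f g. Q f g = Q g f) \<and>
     (\<forall>f f' h. (\<forall>x\<in>S. f x = f' x) \<longrightarrow> Q f h = Q f' h)"

lemma bilinear_form_lin:
  "bilinear_form S Q \<Longrightarrow> Q (\<lambda>x. a * f x + b * g x) h = a * Q f h + b * Q g h"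
  unfolding bilinear_form_def by (elim conjE allE)

lemma bilinear_form_sym: "bilinear_form S Q \<Longrightarrow> Q f g = Q g f"
  unfolding bilinear_form_def by (elim conjE allE)

lemma bilinear_form_cong:
  "bilinear_form S Q \<Longrightarrow> (\<And>x. x \<in> S \<Longrightarrow> f x = f' x) \<Longrightarrow> Q f h = Q f' h"
  unfolding bilinear_form_def by (elim conjE) blast

lemma bilinear_form_sum:
  assumes "bilinear_form S Q" "finite I"
  shows "Q (\<lambda>x. \<Sum>i\<in>I. c i * e i x) h = (\<Sum>i\<in>I. c i * Q (e i) h)"
  using assms(2)
proof (induction I)
  case empty
  have "Q (\<lambda>x. 0 * h x + 0 * h x) h = 0"
    by (simp only: bilinear_form_lin[OF assms(1)])
  then show ?case by simp
next
  case (insert i I)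
  have "Q (\<lambda>x. c i * e i x + 1 * (\<Sum>i\<in>I. c i * e i x)) h
      = c i * Q (e i) h + 1 * Q (\<lambda>x. \<Sum>i\<in>I. c i * e i x) h"
    by (rule bilinear_form_lin[OF assms(1)])
  then show ?case using insert by simp
qed

lemma bilinear_form_sum2:
  assumes "bilinear_form S Q" "finite I"
  shows "Q (\<lambda>x. \<Sum>i\<in>I. c i * e i x) (\<lambda>x. \<Sum>i\<in>I. c i * e i x) = (\<Sum>i\<in>I. \<Sum>j\<in>I. c i * c j * Q (e i) (e j))"
proof -
  have "Q (e i) (\<lambda>x. \<Sum>i\<in>I. c i * e i x) = (\<Sum>j\<in>I. c j * Q (e j) (e i))" for i
    using bilinear_form_sum[OF assms, of c e "e i"] bilinear_form_sym[OF assms(1)] by simp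
  moreover have "Q (e j) (e i) = Q (e i) (e j)" for i j
    by (rule bilinear_form_sym[OF assms(1)])
  ultimately show ?thesis
    unfolding bilinear_form_sum[OF assms] by (simp add: sum_distrib_left mult.assoc)
qed

text \<open>The maximum \<mu> of Q on the unit sphere of P makes \<mu> * ip - Q positive
  semidefinite on P, and the null vectors of a semidefinite form are a subspace. Being cut out by an
  equation between quadratic forms, it is preserved by every symmetry of P, Q and
  \<open>ip\<close>.\<close>

lemma max_eigenspace:
  assumes "finite S" "S \<noteq> {}" "fsubspace P" "bilinear_form S Q" "\<exists>g\<in>P. ip S g g \<noteq> 0"
  obtains \<mu> where "\<And>g. g \<in> P \<Longrightarrow> Q g g \<le> \<mu> * ip S g g"
    "fsubspace {g\<in>P. Q g g = \<mu> * ip S g g}" "\<exists>g\<in>P. Q g g = \<mu> * ip S g g \<and> ip S g g \<noteq> 0"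
proof -
  obtain k e where e: "orthonormal S k e" "\<And>i. i < k \<Longrightarrow> e i \<in> P"
    "\<And>v x. v \<in> P \<Longrightarrow> x \<in> S \<Longrightarrow> v x = (\<Sum>i<k. ip S v (e i) * e i x)"
    using orthonormal_basis_exists[OF assms(1-3)] by blast
  note lin = bilinear_form_lin[OF assms(4)] and sym = bilinear_form_sym[OF assms(4)]
  have cong: "Q f f = Q f' f'" if "\<And>x. x \<in> S \<Longrightarrow> f x = f' x" for f f'
    using bilinear_form_cong[OF assms(4), of f f'] that sym[of f f'] by simp
  have lin2: "Q (\<lambda>x. a * f x + b * g x) (\<lambda>x. a * f x + b * g x) = a\<^sup>2 * Q f f + 2 * a * b * Q f g + b\<^sup>2 * Q g g" for a b f g
    unfolding lin sym[of f "\<lambda>x. a * f x + b * g x"] sym[of g "\<lambda>x. a * f x + b * g x"]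
    by (simp add: sym[of g f] algebra_simps power2_eq_square)
  have exp: "ip S g g = (\<Sum>i<k. (ip S g (e i))\<^sup>2)"
     "Q g g = (\<Sum>i<k. \<Sum>j<k. ip S g (e i) * ip S g (e j) * Q (e i) (e j))" if "g \<in> P" for g
  proof -
    let ?g = "\<lambda>x. \<Sum>i<k. ip S g (e i) * e i x"
    have "ip S g g = ip S ?g ?g" using e(3)[OF that] by (intro ip_cong) auto
    then show "ip S g g = (\<Sum>i<k. (ip S g (e i))\<^sup>2)"
      using orthonormal_Parseval[OF e(1)] by (simp add: power2_eq_square)
    have "Q g g = Q ?g ?g" using e(3)[OF that] by (intro cong) auto
    then show "Q g g = (\<Sum>i<k. \<Sum>j<k. ip S g (e i) * ip S g (e j) * Q (e i) (e j))"
      using bilinear_form_sum2[OF assms(4), of "{..<k}" "\<lambda>i. ip S g (e i)" e] by simp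
  qed
  have "k > 0"
  proof (rule ccontr)
    assume "\<not> k > 0"
    with assms(5) exp show False by auto
  qed
  from quadratic_form_attains_max[OF this, of "\<lambda>i j. Q (e i) (e j)"]
  obtain c where c: "(\<Sum>i<k. (c i)\<^sup>2) = 1"
    "\<And>c'. (\<Sum>i<k. (c' i)\<^sup>2) = 1 \<Longrightarrow> (\<Sum>i<k. \<Sum>j<k. c' i * c' j * Q (e i) (e j)) \<le> (\<Sum>i<k. \<Sum>j<k. c i * c j * Q (e i) (e j))"
    by blast
  define u where "u = (\<lambda>x. \<Sum>i<k. c i * e i x)"
  define \<mu> where "\<mu> = Q u u"
  have Qu: "Q u u = (\<Sum>i<k. \<Sum>j<k. c i * c j * Q (e i) (e j))"
    unfolding u_def by (rule bilinear_form_sum2[OF assms(4)]) simp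
  have uu: "ip S u u = 1"
    unfolding u_def orthonormal_Parseval[OF e(1)] using c(1) by (simp add: power2_eq_square)
  have uP: "u \<in> P" unfolding u_def using e(2) by (intro fsubspace_sum[OF assms(3)]) auto
  have le: "Q g g \<le> \<mu> * ip S g g" if g: "g \<in> P" for g
  proof (cases "ip S g g = 0")
    case True
    then have "Q g g = Q (\<lambda>x. 0 * g x + 0 * g x) (\<lambda>x. 0 * g x + 0 * g x)"
      using ip_self_eq_0D[OF assms(1)] by (intro cong) auto
    then show ?thesis using True unfolding lin2 by simp
  next
    case False
    define s where "s = sqrt (ip S g g)"
    have s: "s > 0" "s\<^sup>2 = ip S g g" using False ip_nonneg[of S g] by (auto simp: s_def)
    have "(\<Sum>i<k. (ip S g (e i) / s)\<^sup>2) = 1"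
      using exp(1)[OF g] s False by (simp add: power_divide flip: sum_divide_distrib)
    then have "(\<Sum>i<k. \<Sum>j<k. (ip S g (e i) / s) * (ip S g (e j) / s) * Q (e i) (e j)) \<le> \<mu>"
      unfolding \<mu>_def Qu by (rule c(2))
    moreover have "(\<Sum>i<k. \<Sum>j<k. (ip S g (e i) / s) * (ip S g (e j) / s) * Q (e i) (e j)) = Q g g / s\<^sup>2"
      unfolding exp(2)[OF g] by (simp add: sum_divide_distrib power2_eq_square)
    ultimately have "Q g g / ip S g g \<le> \<mu>" using s by simp
    moreover have "ip S g g > 0" using s by (metis zero_less_power)
    ultimately show ?thesis by (simp add: pos_divide_le_eq)
  qed
  let ?E = "{g\<in>P. Q g g = \<mu> * ip S g g}"
  have "fsubspace ?E"
    unfolding fsubspace_def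
  proof (intro conjI ballI allI)
    show "(\<lambda>_. 0) \<in> ?E" using lin2[of 0 u 0 u] assms(3) by (simp add: ip_def avg_def fsubspace_def)
    fix f g a b assume f: "f \<in> ?E" and g: "g \<in> ?E"
    define z where "z = Q f g - \<mu> * ip S f g"
    have ip2: "ip S (\<lambda>x. a * f x + b * g x) (\<lambda>x. a * f x + b * g x) = a\<^sup>2 * ip S f f + 2 * a * b * ip S f g + b\<^sup>2 * ip S g g" for a b
      unfolding ip_lin ip_commute[of S f "\<lambda>x. a * f x + b * g x"] ip_commute[of S g "\<lambda>x. a * f x + b * g x"]
      by (simp add: ip_commute[of S g f] algebra_simps power2_eq_square)
    have key: "Q (\<lambda>x. a * f x + b * g x) (\<lambda>x. a * f x + b * g x) - \<mu> * ip S (\<lambda>x. a * f x + b * g x) (\<lambda>x. a * f x + b * g x) = 2 * a * b * z" for a b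
      using f g unfolding lin2 ip2 z_def by (simp add: algebra_simps)
    have "2 * a * b * z \<le> 0" for a b
      using le[of "\<lambda>x. a * f x + b * g x"] key[of a b] fsubspace_lin[OF assms(3), of f g a b] f g by simp
    \<comment> \<open>On two null vectors only the cross term survives; semidefiniteness with both
      signs of b forces it to vanish.\<close>
    from this[of 1 1] this[of 1 "-1"] have "2 * 1 * 1 * z \<le> 0" "2 * 1 * (-1) * z \<le> 0" .
    then have "z = 0" by simp
    then show "(\<lambda>x. a * f x + b * g x) \<in> ?E"
      using key[of a b] fsubspace_lin[OF assms(3), of f g a b] f g by simp
  qed
  moreover have "\<exists>g\<in>P. Q g g = \<mu> * ip S g g \<and> ip S g g \<noteq> 0"
    using uP uu by (intro bexI[of _ u]) (simp_all add: \<mu>_def)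
  ultimately show ?thesis using that[of \<mu>] le by blast
qed

lemma orthogonal_projection_exists:
  assumes "finite S" "S \<noteq> {}" "fsubspace P"
  obtains p where "p \<in> P" "\<And>v. v \<in> P \<Longrightarrow> ip S (\<lambda>x. g x - p x) v = 0"
proof -
  obtain k e where e: "orthonormal S k e" "\<And>i. i < k \<Longrightarrow> e i \<in> P"
    "\<And>v x. v \<in> P \<Longrightarrow> x \<in> S \<Longrightarrow> v x = (\<Sum>i<k. ip S v (e i) * e i x)"
    using orthonormal_basis_exists[OF assms] by blast
  define p where "p = (\<lambda>x. \<Sum>i<k. ip S g (e i) * e i x)"
  have "p \<in> P" unfolding p_def using e(2) by (intro fsubspace_sum[OF assms(3)]) auto
  moreover have "ip S (\<lambda>x. g x - p x) v = 0" if v: "v \<in> P" for v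
  proof -
    have "ip S (\<lambda>x. g x - p x) (e i) = 0" if "i < k" for i
      unfolding p_def ip_diff using orthonormal_coeff[OF e(1) that] by simp
    moreover have "ip S (\<lambda>x. g x - p x) v = ip S (\<lambda>x. g x - p x) (\<lambda>x. \<Sum>i<k. ip S v (e i) * e i x)"
      using e(3)[OF v] by (intro ip_cong) auto
    ultimately show ?thesis by (simp add: ip_sum_right)
  qed
  ultimately show ?thesis using that by blast
qed

section \<open>Hypercontractivity on the discrete cube\<close>

text \<open>A Walsh character: the subset y stands for the point of the sign cube whose coordinate
  is -1 exactly on y.\<close>

definition chi :: "'a set \<Rightarrow> 'a set \<Rightarrow> real" where
  "chi S y = (-1) ^ card (S \<inter> y)"

lemma sum_Pow_insert:
  assumes "finite A" "a \<notin> A"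
  shows "sum g (Pow (insert a A)) = sum g (Pow A) + (\<Sum>S\<in>Pow A. g (insert a S))"
proof -
  have inj: "inj_on (insert a) (Pow A)" using assms by (auto simp: inj_on_def)
  have "Pow A \<inter> insert a ` Pow A = {}" using assms by auto
  then show ?thesis
    unfolding Pow_insert using assms by (subst sum.union_disjoint) (auto simp: sum.reindex[OF inj])
qed

lemma power_mean_two:
  fixes x y :: real
  assumes "0 \<le> x" "0 \<le> y" "j \<le> p" "0 < p"
  shows "real p * (x ^ (p - j) * y ^ j) \<le> real (p - j) * x ^ p + real j * y ^ p"
proof (cases "x = 0 \<or> y = 0")
  case True
  then show ?thesis using assms by (cases "j = 0"; cases "j = p") (auto simp: power_0_left of_nat_diff)
next
  case False
  then have xy: "x > 0" "y > 0" using assms by auto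
  have pow: "(x ^ p) powr (real k / real p) = x ^ k" if "x > 0" for x :: real and k
    using that assms(4) by (simp add: powr_powr flip: powr_realpow)
  have "(x ^ p) powr (real (p - j) / real p) * (y ^ p) powr (real j / real p)
     \<le> real (p - j) / real p * x ^ p + real j / real p * y ^ p"
    using assms xy by (intro Youngs_inequality_0) (auto simp: of_nat_diff diff_divide_distrib)
  then show ?thesis
    unfolding pow[OF xy(1)] pow[OF xy(2)] using assms(4) by (simp add: field_simps)
qed

text \<open>Hoelder's inequality with exponents p / (p - j) and p / j. After scaling by a and b it
  is the average of \<open>power_mean_two\<close>. If a or b is zero, scaling is impossible, but the
  function concerned then vanishes on S.\<close>

lemma avg_mixed_moment:
  assumes S: "finite S" "S \<noteq> {}" and nn: "\<And>x. x \<in> S \<Longrightarrow> 0 \<le> X x" "\<And>x. x \<in> S \<Longrightarrow> 0 \<le> Y x"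
    and ab: "0 \<le> a" "0 \<le> b" and le: "avg S (\<lambda>x. X x ^ p) \<le> a ^ p" "avg S (\<lambda>x. Y x ^ p) \<le> b ^ p"
    and p: "j \<le> p" "0 < p"
  shows "avg S (\<lambda>x. X x ^ (p - j) * Y x ^ j) \<le> a ^ (p - j) * b ^ j"
proof (cases "a = 0 \<or> b = 0")
  case True
  have zero: "Z x = 0" if "avg S (\<lambda>x. Z x ^ p) \<le> 0" "x \<in> S" "\<And>x. x \<in> S \<Longrightarrow> 0 \<le> Z x" for Z x
  proof -
    have "avg S (\<lambda>x. Z x ^ p) = 0"
      using that avg_nonneg[of S "\<lambda>x. Z x ^ p"] by force
    then have "Z x ^ p = 0" using avg_eq_0_iff[of S "\<lambda>x. Z x ^ p" x] that S by auto
    then show ?thesis by simp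
  qed
  show ?thesis
  proof (cases "a = 0")
    case a: True
    then have "X x = 0" if "x \<in> S" for x using zero[of X x] le p that nn by (simp add: power_0_left)
    then have "avg S (\<lambda>x. X x ^ (p - j) * Y x ^ j) = avg S (\<lambda>x. 0 ^ (p - j) * Y x ^ j)"
      by (intro avg_cong) auto
    also have "\<dots> \<le> a ^ (p - j) * b ^ j"
      using le(2) p a by (cases "j = p") (auto simp: avg_def power_0_left)
    finally show ?thesis .
  next
    case False
    then have b: "b = 0" using True by simp
    then have "Y x = 0" if "x \<in> S" for x using zero[of Y x] le p that nn by (simp add: power_0_left)
    then have "avg S (\<lambda>x. X x ^ (p - j) * Y x ^ j) = avg S (\<lambda>x. X x ^ (p - j) * 0 ^ j)"
      by (intro avg_cong) auto
    also have "\<dots> \<le> a ^ (p - j) * b ^ j"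
      using le(1) p b by (cases "j = 0") (auto simp: avg_def power_0_left)
    finally show ?thesis .
  qed
next
  case False
  then have ab': "a > 0" "b > 0" using ab by auto
  have "real p * avg S (\<lambda>x. (X x / a) ^ (p - j) * (Y x / b) ^ j)
      = avg S (\<lambda>x. real p * ((X x / a) ^ (p - j) * (Y x / b) ^ j))"
    by (simp add: avg_cmult)
  also have "\<dots> \<le> avg S (\<lambda>x. real (p - j) * (X x / a) ^ p + real j * (Y x / b) ^ p)"
    using nn ab' p by (intro avg_mono power_mean_two) auto
  also have "\<dots> = avg S (\<lambda>x. (real (p - j) / a ^ p) * X x ^ p + (real j / b ^ p) * Y x ^ p)"
    by (simp add: power_divide)
  also have "\<dots> = (real (p - j) / a ^ p) * avg S (\<lambda>x. X x ^ p) + (real j / b ^ p) * avg S (\<lambda>x. Y x ^ p)"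
    by (simp only: avg_add avg_cmult)
  also have "\<dots> \<le> (real (p - j) / a ^ p) * a ^ p + (real j / b ^ p) * b ^ p"
    using le ab' by (intro add_mono mult_left_mono) auto
  also have "\<dots> = real p" using ab' p by (simp add: of_nat_diff)
  finally have "avg S (\<lambda>x. (X x / a) ^ (p - j) * (Y x / b) ^ j) \<le> 1"
    using p by simp
  moreover have "avg S (\<lambda>x. (X x / a) ^ (p - j) * (Y x / b) ^ j)
     = avg S (\<lambda>x. (1 / (a ^ (p - j) * b ^ j)) * (X x ^ (p - j) * Y x ^ j))"
    by (simp add: power_divide)
  ultimately show ?thesis
    using ab' by (simp only: avg_cmult) (simp add: divide_simps split: if_splits)
qed

text \<open>Induction on ratios of consecutive terms: beyond the common factor (p - j) / (j + 1),
  the left side is multiplied by (2p - 2j - 1) / (2j + 1) and the right side by 2p - 1. The constant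
  2p - 1 of Bonami's inequality is decided here.\<close>

lemma binomial_even_le:
  assumes "0 < p"
  shows "j \<le> p \<Longrightarrow> real ((2 * p) choose (2 * j)) \<le> real (p choose j) * (2 * real p - 1) ^ j"
proof (induction j)
  case (Suc j)
  have s: "Suc k * (n choose Suc k) = (n - k) * (n choose k)" for n k
    by (simp only: binomial_absorption binomial_absorb_comp)
  have 1: "real (Suc k) * real (n choose Suc k) = real (n - k) * real (n choose k)" for n k
    using s[of k n] by (metis of_nat_mult)
  define t where "t = 2 * real p - 1"
  have t: "t \<ge> 1" using assms by (simp add: t_def)
  have "real (2 * j + 2) * real (2 * j + 1) * real ((2 * p) choose (2 * Suc j))
      = real (2 * j + 1) * (real (Suc (2 * j + 1)) * real ((2 * p) choose (Suc (2 * j + 1))))"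
    by (simp add: algebra_simps)
  also have "\<dots> = real (2 * p - (2 * j + 1)) * (real (Suc (2 * j)) * real ((2 * p) choose (Suc (2 * j))))"
    unfolding 1[of "2 * j + 1" "2 * p"] by simp
  also have "\<dots> = real (2 * p - (2 * j + 1)) * real (2 * p - 2 * j) * real ((2 * p) choose (2 * j))"
    unfolding 1[of "2 * j" "2 * p"] by simp
  also have "\<dots> \<le> real (2 * p - (2 * j + 1)) * real (2 * p - 2 * j) * (real (p choose j) * t ^ j)"
    using Suc by (intro mult_left_mono) (auto simp: t_def)
  also have "\<dots> = 2 * real (2 * p - (2 * j + 1)) * t ^ j * (real (p - j) * real (p choose j))"
    using Suc.prems by (simp add: of_nat_diff algebra_simps)
  also have "\<dots> = real (2 * j + 2) * (real (2 * p - (2 * j + 1)) * t ^ j * real (p choose Suc j))"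
    unfolding 1[symmetric] by (simp add: algebra_simps)
  also have "\<dots> \<le> real (2 * j + 2) * ((real (2 * j + 1) * t) * t ^ j * real (p choose Suc j))"
  proof -
    have "real (2 * p - (2 * j + 1)) \<le> 1 * t" using Suc.prems by (simp add: t_def of_nat_diff)
    also have "\<dots> \<le> real (2 * j + 1) * t" using t by (intro mult_right_mono) auto
    finally show ?thesis using t by (intro mult_left_mono mult_right_mono) auto
  qed
  also have "\<dots> = real (2 * j + 2) * real (2 * j + 1) * (real (p choose Suc j) * t ^ Suc j)"
    by (simp add: algebra_simps)
  finally show ?case
    unfolding t_def by (rule mult_left_le_imp_le) simp
qed simp

lemma even_binomial_expansion:
  fixes x y :: real
  shows "(x + y) ^ (2 * p) + (x - y) ^ (2 * p)
    = 2 * (\<Sum>j\<le>p. real ((2 * p) choose (2 * j)) * ((x\<^sup>2) ^ (p - j) * (y\<^sup>2) ^ j))"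
proof -
  let ?g = "\<lambda>i. real ((2 * p) choose i) * (y ^ i + (- y) ^ i) * x ^ (2 * p - i)"
  have "(x + y) ^ (2 * p) + (x - y) ^ (2 * p) = (\<Sum>i\<le>2 * p. ?g i)"
  proof -
    have "(y + x) ^ (2 * p) = (\<Sum>i\<le>2 * p. real ((2 * p) choose i) * y ^ i * x ^ (2 * p - i))"
      "(- y + x) ^ (2 * p) = (\<Sum>i\<le>2 * p. real ((2 * p) choose i) * (- y) ^ i * x ^ (2 * p - i))"
      by (rule binomial_ring)+
    then have "(y + x) ^ (2 * p) + (- y + x) ^ (2 * p) = (\<Sum>i\<le>2 * p. ?g i)"
      by (simp only: sum.distrib[symmetric] distrib_left distrib_right)
    moreover have "y + x = x + y" "- y + x = x - y" by simp_all
    ultimately show ?thesis by (simp only:)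
  qed
  also have "\<dots> = (\<Sum>i\<in>(\<lambda>j. 2 * j) ` {..p}. ?g i)"
  proof (rule sum.mono_neutral_right)
    show "\<forall>i\<in>{..2 * p} - (\<lambda>j. 2 * j) ` {..p}. ?g i = 0"
    proof
      fix i assume i: "i \<in> {..2 * p} - (\<lambda>j. 2 * j) ` {..p}"
      then have "odd i" by (auto elim!: evenE)
      then show "?g i = 0" by simp
    qed
  qed auto
  also have "\<dots> = (\<Sum>j\<le>p. ?g (2 * j))"
    by (subst sum.reindex) (auto simp: inj_on_def)
  also have "\<dots> = 2 * (\<Sum>j\<le>p. real ((2 * p) choose (2 * j)) * ((x\<^sup>2) ^ (p - j) * (y\<^sup>2) ^ j))"
    unfolding sum_distrib_left
    by (intro sum.cong) (auto simp: power_mult[symmetric] diff_mult_distrib2)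
  finally show ?thesis .
qed

text \<open>The weights (2p - 1)^card S replace a noise operator. The polynomial is F plus or minus
  H according to the sign of the new coordinate; averaging over this sign leaves only even powers of
  F and H, Hoelder's inequality separates them, and \<open>binomial_even_le\<close> turns the result
  into the binomial expansion of (t * \<gamma> + \<alpha>)^p.\<close>

theorem Bonami:
  assumes "finite A" "0 < p"
  shows "avg (Pow A) (\<lambda>y. (\<Sum>S\<in>Pow A. b S * chi S y) ^ (2 * p))
    \<le> (\<Sum>S\<in>Pow A. (2 * real p - 1) ^ card S * (b S)\<^sup>2) ^ p"
  using assms(1)
proof (induction A arbitrary: b)
  case empty
  then show ?case by (simp add: avg_def chi_def power_mult)
next
  case (insert a A)
  define t where "t = 2 * real p - 1"
  have t: "t \<ge> 1" using assms by (simp add: t_def)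
  define F where "F = (\<lambda>y. \<Sum>S\<in>Pow A. b S * chi S y)"
  define H where "H = (\<lambda>y. \<Sum>S\<in>Pow A. b (insert a S) * chi S y)"
  define \<alpha> where "\<alpha> = (\<Sum>S\<in>Pow A. t ^ card S * (b S)\<^sup>2)"
  define \<gamma> where "\<gamma> = (\<Sum>S\<in>Pow A. t ^ card S * (b (insert a S))\<^sup>2)"
  have nn: "\<alpha> \<ge> 0" "\<gamma> \<ge> 0" using t by (auto simp: \<alpha>_def \<gamma>_def intro!: sum_nonneg)
  have IH: "avg (Pow A) (\<lambda>y. ((F y)\<^sup>2) ^ p) \<le> \<alpha> ^ p" "avg (Pow A) (\<lambda>y. ((H y)\<^sup>2) ^ p) \<le> \<gamma> ^ p"
    using insert.IH[of b] insert.IH[of "\<lambda>S. b (insert a S)"]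
    by (simp_all add: F_def H_def \<alpha>_def \<gamma>_def t_def power_mult)
  have chi1: "chi (insert a S) y = chi S y" if "S \<in> Pow A" "y \<in> Pow A" for S y
  proof -
    have "insert a S \<inter> y = S \<inter> y" using that insert.hyps by auto
    then show ?thesis by (simp add: chi_def)
  qed
  have chi2: "chi S (insert a y) = chi S y" if "S \<in> Pow A" "y \<in> Pow A" for S y
  proof -
    have "S \<inter> insert a y = S \<inter> y" using that insert.hyps by auto
    then show ?thesis by (simp add: chi_def)
  qed
  have chi3: "chi (insert a S) (insert a y) = - chi S y" if "S \<in> Pow A" "y \<in> Pow A" for S y
  proof -
    have "insert a S \<inter> insert a y = insert a (S \<inter> y)" "a \<notin> S \<inter> y" "finite (S \<inter> y)"
      using that insert.hyps by (auto intro: finite_subset)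
    then show ?thesis by (simp add: chi_def)
  qed
  have G1: "(\<Sum>S\<in>Pow (insert a A). b S * chi S y) = F y + H y" if "y \<in> Pow A" for y
    unfolding sum_Pow_insert[OF insert.hyps] F_def H_def using chi1 that by simp
  have G2: "(\<Sum>S\<in>Pow (insert a A). b S * chi S (insert a y)) = F y - H y" if "y \<in> Pow A" for y
    unfolding sum_Pow_insert[OF insert.hyps] F_def H_def using chi2 chi3 that by (simp add: sum_negf)
  have card: "card (Pow (insert a A)) = 2 * card (Pow A)"
    using insert.hyps by (simp add: card_Pow)
  have "avg (Pow (insert a A)) (\<lambda>y. (\<Sum>S\<in>Pow (insert a A). b S * chi S y) ^ (2 * p))
      = avg (Pow A) (\<lambda>y. ((F y + H y) ^ (2 * p) + (F y - H y) ^ (2 * p)) / 2)"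
    unfolding avg_def card sum_Pow_insert[OF insert.hyps, of "\<lambda>y. _ y ^ _"]
    using G1 G2 by (simp add: sum.distrib sum_divide_distrib[symmetric])
  also have "\<dots> = (\<Sum>j\<le>p. real ((2 * p) choose (2 * j)) * avg (Pow A) (\<lambda>y. ((F y)\<^sup>2) ^ (p - j) * ((H y)\<^sup>2) ^ j))"
    unfolding even_binomial_expansion by (simp add: avg_sum avg_cmult)
  also have "\<dots> \<le> (\<Sum>j\<le>p. (real (p choose j) * t ^ j) * (\<alpha> ^ (p - j) * \<gamma> ^ j))"
    using insert.hyps assms nn t IH binomial_even_le
    by (intro sum_mono mult_mono avg_mixed_moment) (auto simp: t_def intro!: avg_nonneg)
  also have "\<dots> = (t * \<gamma> + \<alpha>) ^ p"
    unfolding binomial_ring by (intro sum.cong) (auto simp: power_mult_distrib)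
  also have "t * \<gamma> + \<alpha> = (\<Sum>S\<in>Pow (insert a A). t ^ card S * (b S)\<^sup>2)"
  proof -
    have "card (insert a S) = Suc (card S)" if "S \<in> Pow A" for S
      using that insert.hyps by (subst card_insert_disjoint) (auto intro: finite_subset)
    then show ?thesis
      unfolding sum_Pow_insert[OF insert.hyps] \<alpha>_def \<gamma>_def by (simp add: sum_distrib_left mult.assoc)
  qed
  finally show ?case by (simp only: t_def)
qed

corollary Bonami_homogeneous:
  assumes "finite A" "0 < p" "\<And>S. S \<in> \<S> \<Longrightarrow> S \<subseteq> A \<and> card S = d"
  shows "avg (Pow A) (\<lambda>y. (\<Sum>S\<in>\<S>. b S * chi S y) ^ (2 * p)) \<le> ((2 * real p - 1) ^ d * (\<Sum>S\<in>\<S>. (b S)\<^sup>2)) ^ p"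
proof -
  let ?b = "\<lambda>S. if S \<in> \<S> then b S else 0"
  have sub: "\<S> \<subseteq> Pow A" using assms(3) by auto
  have 1: "(\<Sum>S\<in>Pow A. ?b S * chi S y) = (\<Sum>S\<in>\<S>. b S * chi S y)" for y
    using assms(1) sub by (intro sum.mono_neutral_cong_right) auto
  have "(\<Sum>S\<in>Pow A. (2 * real p - 1) ^ card S * (?b S)\<^sup>2) = (\<Sum>S\<in>\<S>. (2 * real p - 1) ^ d * (b S)\<^sup>2)"
    using assms sub by (intro sum.mono_neutral_cong_right) auto
  then show ?thesis
    using Bonami[OF assms(1,2), of ?b] by (simp add: 1 sum_distrib_left)
qed

section \<open>Averages over permutations\<close>

definition Sy :: "nat \<Rightarrow> (nat \<Rightarrow> nat) set" where
  "Sy n = {p. p permutes {1..n}}"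

abbreviation Al :: "nat \<Rightarrow> (nat \<Rightarrow> nat) set" where
  "Al n \<equiv> carrier (alt_group n)"

abbreviation tp :: "nat \<Rightarrow> nat \<Rightarrow> nat \<Rightarrow> nat" where
  "tp \<equiv> Transposition.transpose"

lemma in_Al_iff: "p \<in> Al n \<longleftrightarrow> p permutes {1..n} \<and> evenperm p"
  by (simp add: alt_group_def)

lemma Al_subset_Sy: "Al n \<subseteq> Sy n"
  by (auto simp: in_Al_iff Sy_def)

lemma finite_Sy [simp]: "finite (Sy n)"
  by (simp add: Sy_def finite_permutations)

lemma id_in_Sy [simp]: "id \<in> Sy n"
  by (simp add: Sy_def)

lemma Sy_nonempty [simp]: "Sy n \<noteq> {}"
  using id_in_Sy by blast

lemma finite_Al [simp]: "finite (Al n)"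
  by (rule finite_alt_carrier)

lemma id_in_Al [simp]: "id \<in> Al n"
  by (simp add: in_Al_iff)

lemma Al_nonempty [simp]: "Al n \<noteq> {}"
  by (rule alt_carrier_nonempty)

lemma Sy_comp: "p \<in> Sy n \<Longrightarrow> q \<in> Sy n \<Longrightarrow> p \<circ> q \<in> Sy n"
  by (simp add: Sy_def permutes_compose)

lemma Sy_inv: "p \<in> Sy n \<Longrightarrow> inv' p \<in> Sy n"
  by (simp add: Sy_def permutes_inv)

lemma Sy_permutation: "p \<in> Sy n \<Longrightarrow> permutation p"
  by (auto simp: Sy_def permutation_permutes)

lemma Al_Sy: "p \<in> Al n \<Longrightarrow> p \<in> Sy n"
  using Al_subset_Sy by auto

lemma Al_comp: "p \<in> Al n \<Longrightarrow> q \<in> Al n \<Longrightarrow> p \<circ> q \<in> Al n"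
  using evenperm_comp[of p q] Sy_permutation[of p n] Sy_permutation[of q n]
  by (auto simp: in_Al_iff Sy_def permutes_compose)

lemma Al_inv: "p \<in> Al n \<Longrightarrow> inv' p \<in> Al n"
  by (rule alt_group_inv_closed)

lemma Sy_inv_comp [simp]: "p \<in> Sy n \<Longrightarrow> inv' p \<circ> p = id" "p \<in> Sy n \<Longrightarrow> p \<circ> inv' p = id"
  by (auto simp: Sy_def permutes_inv_o)

lemma Sy_inv_comp_assoc: "p \<in> Sy n \<Longrightarrow> inv' p \<circ> (p \<circ> q) = q" "p \<in> Sy n \<Longrightarrow> p \<circ> (inv' p \<circ> q) = q"
  "p \<in> Sy n \<Longrightarrow> q \<circ> p \<circ> inv' p = q" "p \<in> Sy n \<Longrightarrow> q \<circ> inv' p \<circ> p = q"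
  by (simp_all add: comp_assoc[symmetric]) (simp_all add: comp_assoc)

lemma transpose_in_Sy: "a \<in> {1..n} \<Longrightarrow> b \<in> {1..n} \<Longrightarrow> tp a b \<in> Sy n"
  by (simp add: Sy_def permutes_swap_id)

lemma avg_right_translate:
  assumes "G = Sy n \<or> G = Al n" "a \<in> G"
  shows "avg G (\<lambda>x. f (x \<circ> a)) = avg G f"
proof -
  have a: "a \<in> Sy n" using assms Al_Sy by auto
  have "bij_betw (\<lambda>x. x \<circ> a) G G"
    using assms a Sy_comp Al_comp Sy_inv Al_inv
    by (intro bij_betw_byWitness[where f' = "\<lambda>x. x \<circ> inv' a"]) (auto simp: Sy_inv_comp_assoc)
  then show ?thesis by (rule avg_reindex)
qed

lemma avg_left_translate:
  assumes "G = Sy n \<or> G = Al n" "a \<in> G"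
  shows "avg G (\<lambda>x. f (a \<circ> x)) = avg G f"
proof -
  have a: "a \<in> Sy n" using assms Al_Sy by auto
  have "bij_betw (\<lambda>x. a \<circ> x) G G"
    using assms a Sy_comp Al_comp Sy_inv Al_inv
    by (intro bij_betw_byWitness[where f' = "\<lambda>x. inv' a \<circ> x"]) (auto simp: Sy_inv_comp_assoc)
  then show ?thesis by (rule avg_reindex)
qed

lemma avg_inverse:
  assumes "G = Sy n \<or> G = Al n"
  shows "avg G (\<lambda>x. f (inv' x)) = avg G f"
proof -
  have "inv' (inv' x) = x" if "x \<in> G" for x
    using assms that Al_Sy permutes_inv_inv by (auto simp: Sy_def)
  then have "bij_betw inv' G G"
    using assms Sy_inv Al_inv by (intro bij_betw_byWitness[where f' = inv']) auto
  then show ?thesis by (rule avg_reindex)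
qed

lemmas avg_Sy_right = avg_right_translate[OF disjI1[OF refl]]
lemmas avg_Al_right = avg_right_translate[OF disjI2[OF refl]]
lemmas avg_Sy_left = avg_left_translate[OF disjI1[OF refl]]
lemmas avg_Al_left = avg_left_translate[OF disjI2[OF refl]]

section \<open>Passing between even and all permutations\<close>

lemma sum_Sy_split:
  fixes f :: "(nat \<Rightarrow> nat) \<Rightarrow> real"
  assumes "a \<in> {1..n}" "b \<in> {1..n}" "a \<noteq> b"
  shows "sum f (Sy n) = sum f (Al n) + (\<Sum>x\<in>Al n. f (x \<circ> tp a b))" "card (Sy n) = 2 * card (Al n)"
proof -
  let ?t = "tp a b"
  have tt: "x \<circ> ?t \<circ> ?t = x" for x :: "nat \<Rightarrow> nat" by (simp add: comp_assoc)
  have t: "?t \<in> Sy n" by (rule transpose_in_Sy[OF assms(1,2)])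
  have ev: "evenperm (x \<circ> ?t) \<longleftrightarrow> \<not> evenperm x" if "x \<in> Sy n" for x
    using evenperm_comp[of x ?t] Sy_permutation[OF that] assms(3)
    by (simp add: permutation_swap_id evenperm_swap)
  have in_diff: "x \<in> Sy n - Al n \<longleftrightarrow> x \<in> Sy n \<and> \<not> evenperm x" for x
    by (auto simp: in_Al_iff Sy_def)
  have in_Al: "x \<in> Al n \<longleftrightarrow> x \<in> Sy n \<and> evenperm x" for x
    by (auto simp: in_Al_iff Sy_def)
  have bij: "bij_betw (\<lambda>x. x \<circ> ?t) (Al n) (Sy n - Al n)"
    using ev Sy_comp[OF _ t]
    by (intro bij_betw_byWitness[where f' = "\<lambda>x. x \<circ> ?t"]) (auto simp: tt in_diff in_Al)
  have "sum f (Sy n) = sum f (Sy n - Al n) + sum f (Al n)"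
    by (rule sum.subset_diff[OF Al_subset_Sy]) simp
  then show "sum f (Sy n) = sum f (Al n) + (\<Sum>x\<in>Al n. f (x \<circ> ?t))"
    using sum.reindex_bij_betw[OF bij, of f] by linarith
  have "card (Sy n - Al n) = card (Al n)" using bij_betw_same_card[OF bij] by simp
  moreover have "card (Al n) + card (Sy n - Al n) = card (Sy n)"
    using Al_subset_Sy by (simp add: card_Diff_subset card_mono)
  ultimately show "card (Sy n) = 2 * card (Al n)" by simp
qed

text \<open>Quantified over all maps and not only permutations, so that u may also be evaluated at
  maps such as \<open>\<rho>(s := j)\<close>.\<close>

definition depends_on :: "nat set \<Rightarrow> ((nat \<Rightarrow> nat) \<Rightarrow> real) \<Rightarrow> bool" where
  "depends_on T u \<longleftrightarrow> (\<forall>x y. (\<forall>i\<in>T. x i = y i) \<longrightarrow> u x = u y)"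

lemma depends_onD: "depends_on T u \<Longrightarrow> (\<And>i. i \<in> T \<Longrightarrow> x i = y i) \<Longrightarrow> u x = u y"
  by (auto simp: depends_on_def)

lemma depends_on_mono: "depends_on T u \<Longrightarrow> T \<subseteq> T' \<Longrightarrow> depends_on T' u"
  by (auto simp: depends_on_def subset_iff)

lemma depends_on_comp: "depends_on T u \<Longrightarrow> depends_on (p ` T) (\<lambda>x. u (x \<circ> p))"
  by (auto simp: depends_on_def)

text \<open>At least two points lie outside T, and their transposition matches even with odd
  permutations without changing \<phi>.\<close>

lemma avg_Al_eq_avg_Sy:
  assumes "depends_on T \<phi>" "T \<subseteq> {1..n}" "card T + 2 \<le> n"
  shows "avg (Al n) \<phi> = avg (Sy n) \<phi>"
proof -
  have "card ({1..n} - T) \<ge> 2"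
    using assms finite_subset[OF assms(2)] by (simp add: card_Diff_subset)
  then obtain B where "B \<subseteq> {1..n} - T" "card B = 2"
    by (rule obtain_subset_with_card_n)
  then obtain a b where ab: "a \<in> {1..n} - T" "b \<in> {1..n} - T" "a \<noteq> b"
    by (auto simp: card_2_iff)
  have "\<phi> (x \<circ> tp a b) = \<phi> x" for x
    using ab by (intro depends_onD[OF assms(1)]) (auto simp: Transposition.transpose_def)
  then show ?thesis
    using sum_Sy_split[of a n b] ab unfolding avg_def by simp
qed

lemma avg_Al_comp_eq_avg_Sy:
  assumes \<phi>: "depends_on T \<phi>" and T: "T \<subseteq> {1..n}" "card T + 2 \<le> n" and \<iota>: "\<iota> \<in> Sy n"
  shows "avg (Al n) (\<lambda>\<sigma>. \<phi> (\<sigma> \<circ> \<iota>)) = avg (Sy n) \<phi>"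
proof -
  have p: "\<iota> permutes {1..n}" using \<iota> by (simp add: Sy_def)
  have "\<iota> ` T \<subseteq> \<iota> ` {1..n}" using T(1) by (rule image_mono)
  then have sub: "\<iota> ` T \<subseteq> {1..n}" by (simp only: permutes_image[OF p])
  have "card (\<iota> ` T) + 2 \<le> n"
    using card_image_le[OF finite_subset[OF T(1)], of \<iota>] T(2) by simp
  from avg_Al_eq_avg_Sy[OF depends_on_comp[OF \<phi>] sub this] show ?thesis
    using avg_Sy_right[OF \<iota>, of \<phi>] by simp
qed

lemma avg_Al_le_twice_avg_Sy:
  assumes "n \<ge> 2" "\<And>x. x \<in> Sy n \<Longrightarrow> 0 \<le> \<phi> x"
  shows "avg (Al n) \<phi> \<le> 2 * avg (Sy n) \<phi>"
proof -
  have "card (Sy n) = 2 * card (Al n)" using sum_Sy_split[of 1 n 2] assms by simp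
  moreover have "sum \<phi> (Al n) \<le> sum \<phi> (Sy n)"
    using assms(2) Al_subset_Sy by (intro sum_mono2) auto
  ultimately show ?thesis unfolding avg_def by (simp add: divide_right_mono)
qed

section \<open>Pure functions and disjoint transpositions\<close>

text \<open>
  The permutation \<open>sw N Y\<close> is the product of the commuting transpositions of \<open>y\<close> and \<open>y + N\<close>,
  for \<open>y\<close> in \<open>Y\<close>.
\<close>

definition sw :: "nat \<Rightarrow> nat set \<Rightarrow> nat \<Rightarrow> nat" where
  "sw N Y x = (if x \<in> Y then x + N else if N \<le> x \<and> x - N \<in> Y then x - N else x)"

lemma sw_in: "x \<in> Y \<Longrightarrow> sw N Y x = x + N"
  by (simp add: sw_def)

lemma sw_in_shift: "Y \<subseteq> {1..N} \<Longrightarrow> x \<in> Y \<Longrightarrow> sw N Y (x + N) = x"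
proof -
  assume Y: "Y \<subseteq> {1..N}" "x \<in> Y"
  then have "x \<in> {1..N}" by blast
  then have "x + N \<notin> {1..N}" by auto
  then have "x + N \<notin> Y" using Y by blast
  then show ?thesis using Y by (simp add: sw_def)
qed

lemma sw_notin: "x \<notin> Y \<Longrightarrow> x \<notin> (\<lambda>y. y + N) ` Y \<Longrightarrow> sw N Y x = x"
  by (auto simp: sw_def image_iff)

lemma sw_low: "x \<in> {1..N} \<Longrightarrow> Y \<subseteq> {1..N} \<Longrightarrow> sw N Y x = (if x \<in> Y then x + N else x)"
  by (auto simp: sw_def)

lemma sw_empty [simp]: "sw N {} = id"
  by (auto simp: sw_def)

lemma sw_high: "x \<in> {1..N} \<Longrightarrow> Y \<subseteq> {1..N} \<Longrightarrow> sw N Y (x + N) = (if x \<in> Y then x else x + N)"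
  by (auto simp: sw_def)

lemma sw_other: "x \<notin> {1..2 * N} \<Longrightarrow> Y \<subseteq> {1..N} \<Longrightarrow> sw N Y x = x"
  by (intro sw_notin) (auto simp: subset_iff)

lemma nat_low_high_cases:
  obtains "x \<in> {1..N}" | z where "x = z + N" "z \<in> {1..N}" | "x \<notin> {1..2 * N :: nat}"
proof (cases "x \<in> {1..N} \<or> x \<notin> {1..2 * N}")
  case False
  then have "x = (x - N) + N" "x - N \<in> {1..N}" by auto
  then show ?thesis using that by blast
qed (use that in blast)

text \<open>The swaps form an elementary abelian 2-group with symmetric difference as addition; its
  cosets are the discrete cubes on which Bonami's inequality is used.\<close>

lemma sw_comp:
  assumes "Y \<subseteq> {1..N}" "Z \<subseteq> {1..N}"
  shows "sw N Y \<circ> sw N Z = sw N (sym_diff Y Z)"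
proof
  fix x
  have D: "sym_diff Y Z \<subseteq> {1..N}" using assms by auto
  show "(sw N Y \<circ> sw N Z) x = sw N (sym_diff Y Z) x"
    by (rule nat_low_high_cases[of x N])
      (auto simp: sw_low[OF _ assms(1)] sw_low[OF _ assms(2)] sw_low[OF _ D]
         sw_high[OF _ assms(1)] sw_high[OF _ assms(2)] sw_high[OF _ D]
         sw_other[OF _ assms(1)] sw_other[OF _ assms(2)] sw_other[OF _ D])
qed

lemma sw_in_Sy:
  assumes "Y \<subseteq> {1..N}" "2 * N \<le> n"
  shows "sw N Y \<in> Sy n"
proof -
  have "sw N Y \<circ> sw N Y = id" using sw_comp[OF assms(1) assms(1)] by simp
  then have b: "bij (sw N Y)" by (intro o_bij)
  have "sw N Y x = x" if "x \<notin> {1..n}" for x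
    using sw_other[OF _ assms(1), of x] that assms(2) by auto
  then show ?thesis using b by (simp add: Sy_def permutes_def bij_iff)
qed

text \<open>
  A function of a \<open>d\<close>-tuple of distinct points is encoded as a function of permutations that depends
  only on the values at \<open>1, \<dots>, d\<close>. The second condition says that the sum over all admissible values
  of one entry of the tuple, the others being fixed, vanishes.
\<close>

definition pure :: "nat \<Rightarrow> nat \<Rightarrow> ((nat \<Rightarrow> nat) \<Rightarrow> real) \<Rightarrow> bool" where
  "pure n d u \<longleftrightarrow> depends_on {1..d} u \<and>
     (\<forall>\<rho>\<in>Sy n. \<forall>s\<in>{1..d}. u \<rho> + (\<Sum>i\<in>{d+1..n}. u (\<rho> \<circ> tp s i)) = 0)"

definition fixing :: "nat \<Rightarrow> nat \<Rightarrow> (nat \<Rightarrow> nat) set" where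
  "fixing n d = {h. h permutes {d+1..n}}"

lemma fixing_fix: "h \<in> fixing n d \<Longrightarrow> x \<le> d \<Longrightarrow> h x = x"
  by (auto simp: fixing_def intro: permutes_not_in)

lemma finite_fixing [simp]: "finite (fixing n d)"
  by (simp add: fixing_def finite_permutations)

lemma fixing_nonempty [simp]: "fixing n d \<noteq> {}"
  using permutes_id[of "{d+1..n}"] unfolding fixing_def by blast

lemma fixing_Sy: "h \<in> fixing n d \<Longrightarrow> h \<in> Sy n"
  by (auto simp: fixing_def Sy_def intro: permutes_subset)

lemma avg_fixing_right:
  assumes "a \<in> fixing n d"
  shows "avg (fixing n d) (\<lambda>h. f (h \<circ> a)) = avg (fixing n d) f"
proof -
  have a: "a \<in> Sy n" using assms by (rule fixing_Sy)
  have "bij_betw (\<lambda>x. x \<circ> a) (fixing n d) (fixing n d)"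
    using assms a by (intro bij_betw_byWitness[where f' = "\<lambda>x. x \<circ> inv' a"])
      (auto simp: Sy_inv_comp_assoc fixing_def permutes_compose permutes_inv)
  then show ?thesis by (rule avg_reindex)
qed

text \<open>The conditional expectation of the swapped function given the first d values of \<rho>.
  A function of these values has the same inner product with \<open>swap_avg\<close> as with the
  swapped function, and purity makes \<open>swap_avg\<close> small.\<close>

definition swap_avg :: "nat \<Rightarrow> nat \<Rightarrow> nat \<Rightarrow> ((nat \<Rightarrow> nat) \<Rightarrow> real) \<Rightarrow> nat set \<Rightarrow> (nat \<Rightarrow> nat) \<Rightarrow> real" where
  "swap_avg n N d u Y \<rho> = avg (fixing n d) (\<lambda>h. u (\<rho> \<circ> h \<circ> sw N Y))"

text \<open>
  Purity in position \<open>k\<close>. Under the average over \<open>h\<close> all positions beyond \<open>d\<close> that are not of the form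
  \<open>j + N\<close> with \<open>j \<in> Y\<close> are equivalent; exchanging \<open>k\<close> with \<open>j + N\<close> merely permutes \<open>j\<close> and \<open>k\<close>.
\<close>

lemma swap_avg_rec:
  assumes u: "pure n d u" and N: "d \<le> N" "2 * N \<le> n"
    and Y: "Y \<subseteq> {1..d}" "k \<in> {1..d}" "k \<notin> Y" and \<rho>: "\<rho> \<in> Sy n"
  shows "(\<Sum>j\<in>insert k Y. swap_avg n N d u Y (\<rho> \<circ> tp j k))
     + real (n - d - card Y) * swap_avg n N d u (insert k Y) \<rho> = 0"
proof -
  let ?H = "fixing n d" and ?a = "swap_avg n N d u"
  have dep: "depends_on {1..d} u" using u by (simp add: pure_def)
  have finY: "finite Y" using Y(1) finite_subset by blast
  have YN: "Y \<subseteq> {1..N}" using Y N by auto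
  have swS: "sw N Y \<in> Sy n" by (rule sw_in_Sy[OF YN N(2)])
  let ?YN = "(\<lambda>y. y + N) ` Y"
  have YNsub: "?YN \<subseteq> {d+1..n}" using Y N by auto
  have A: "avg ?H (\<lambda>h. u (\<rho> \<circ> h \<circ> sw N Y \<circ> tp k (j + N))) = ?a Y (\<rho> \<circ> tp j k)" if j: "j \<in> Y" for j
    unfolding swap_avg_def
  proof (rule avg_cong, rule depends_onD[OF dep])
    fix h x assume h: "h \<in> ?H" and x: "x \<in> {1..d}"
    have jk: "j \<noteq> k" "j \<in> {1..d}" using j Y by auto
    have hx: "h y = y" if "y \<in> {1..d}" for y using fixing_fix[OF h] that by auto
    have hN: "h (y + N) \<noteq> j" "h (y + N) \<noteq> k" if "y \<in> Y" for y
    proof -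
      have "h permutes {d+1..n}" using h by (simp add: fixing_def)
      moreover have "y + N \<in> {d+1..n}" using YNsub that by auto
      ultimately have "h (y + N) \<in> {d+1..n}" using permutes_in_image by metis
      then show "h (y + N) \<noteq> j" "h (y + N) \<noteq> k" using jk Y by auto
    qed
    consider "x = k" | "x = j" | "x \<noteq> k" "x \<noteq> j" "x \<in> Y" | "x \<noteq> k" "x \<noteq> j" "x \<notin> Y" by blast
    then show "(\<rho> \<circ> h \<circ> sw N Y \<circ> tp k (j + N)) x = (\<rho> \<circ> tp j k \<circ> h \<circ> sw N Y) x"
    proof cases
      case 1
      have "sw N Y k = k" using Y N by (intro sw_notin) auto
      then show ?thesis using 1 j jk Y sw_in_shift[OF YN j] hx by simp
    next
      case 2
      have "j \<noteq> j + N" using jk N by auto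
      then show ?thesis using 2 j jk sw_in[OF j] hN[OF j] by (simp add: Transposition.transpose_def)
    next
      case 3
      have "x \<noteq> j + N" using x N j Y by auto
      then show ?thesis using 3 sw_in[of x Y N] hN[of x] by (simp add: Transposition.transpose_def)
    next
      case 4
      have "x \<noteq> j + N" using x N j Y by auto
      moreover have "sw N Y x = x" using 4 x N Y by (intro sw_notin) auto
      ultimately show ?thesis using 4 hx[OF x] by (simp add: Transposition.transpose_def)
    qed
  qed
  have B: "avg ?H (\<lambda>h. u (\<rho> \<circ> h \<circ> sw N Y \<circ> tp k i)) = ?a (insert k Y) \<rho>"
    if i: "i \<in> {d+1..n} - ?YN" for i
  proof -
    let ?t = "tp i (k + N)"
    have kN: "k + N \<in> {d+1..n}" using Y N by auto
    then have t: "?t \<in> ?H" using i by (auto simp: fixing_def intro: permutes_swap_id)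
    have "avg ?H (\<lambda>h. u (\<rho> \<circ> (h \<circ> ?t) \<circ> sw N (insert k Y))) = ?a (insert k Y) \<rho>"
      unfolding swap_avg_def by (rule avg_fixing_right[OF t])
    moreover have "avg ?H (\<lambda>h. u (\<rho> \<circ> (h \<circ> ?t) \<circ> sw N (insert k Y)))
        = avg ?H (\<lambda>h. u (\<rho> \<circ> h \<circ> sw N Y \<circ> tp k i))"
    proof (rule avg_cong, rule depends_onD[OF dep])
      fix h x assume x: "x \<in> {1..d}"
      have "(?t \<circ> sw N (insert k Y)) x = (sw N Y \<circ> tp k i) x"
      proof -
        consider "x = k" | "x \<noteq> k" "x \<in> Y" | "x \<noteq> k" "x \<notin> Y" by blast
        then show ?thesis
        proof cases
          case 1
          have "sw N Y i = i" using i Y by (intro sw_notin) auto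
          then show ?thesis using 1 sw_in[of k "insert k Y" N] by simp
        next
          case 2
          have "x \<noteq> i" "x + N \<noteq> i" "x + N \<noteq> k + N" using i x 2 by auto
          then show ?thesis using 2 sw_in[of x "insert k Y" N] sw_in[of x Y N] by (simp add: Transposition.transpose_def)
        next
          case 3
          have "sw N Y x = x" "sw N (insert k Y) x = x" using 3 x Y N by (auto intro!: sw_notin)
          moreover have "x \<noteq> i" "x \<noteq> k + N" using i x Y N by auto
          ultimately show ?thesis using 3 by (simp add: Transposition.transpose_def)
        qed
      qed
      then show "(\<rho> \<circ> (h \<circ> ?t) \<circ> sw N (insert k Y)) x = (\<rho> \<circ> h \<circ> sw N Y \<circ> tp k i) x"
        by simp
    qed
    ultimately show ?thesis by simp
  qed
  have pure: "u (\<rho> \<circ> h \<circ> sw N Y) + (\<Sum>i\<in>{d+1..n}. u (\<rho> \<circ> h \<circ> sw N Y \<circ> tp k i)) = 0" if "h \<in> ?H" for h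
    using u Y(2) Sy_comp[OF Sy_comp[OF \<rho> fixing_Sy[OF that]] swS] by (simp add: pure_def)
  have "0 = avg ?H (\<lambda>h. u (\<rho> \<circ> h \<circ> sw N Y) + (\<Sum>i\<in>{d+1..n}. u (\<rho> \<circ> h \<circ> sw N Y \<circ> tp k i)))"
    using pure by (simp add: avg_def)
  also have "\<dots> = ?a Y \<rho> + (\<Sum>i\<in>{d+1..n}. avg ?H (\<lambda>h. u (\<rho> \<circ> h \<circ> sw N Y \<circ> tp k i)))"
    by (simp add: avg_add avg_sum swap_avg_def)
  also have "(\<Sum>i\<in>{d+1..n}. avg ?H (\<lambda>h. u (\<rho> \<circ> h \<circ> sw N Y \<circ> tp k i)))
     = (\<Sum>i\<in>{d+1..n} - ?YN. avg ?H (\<lambda>h. u (\<rho> \<circ> h \<circ> sw N Y \<circ> tp k i)))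
      + (\<Sum>i\<in>?YN. avg ?H (\<lambda>h. u (\<rho> \<circ> h \<circ> sw N Y \<circ> tp k i)))"
    by (rule sum.subset_diff[OF YNsub]) simp
  also have "(\<Sum>i\<in>{d+1..n} - ?YN. avg ?H (\<lambda>h. u (\<rho> \<circ> h \<circ> sw N Y \<circ> tp k i)))
      = real (n - d - card Y) * ?a (insert k Y) \<rho>"
  proof -
    have "card ({d+1..n} - ?YN) = n - d - card Y"
      using YNsub finY by (subst card_Diff_subset) (auto simp: card_image)
    then show ?thesis using B by simp
  qed
  also have "(\<Sum>i\<in>?YN. avg ?H (\<lambda>h. u (\<rho> \<circ> h \<circ> sw N Y \<circ> tp k i)))
      = (\<Sum>j\<in>Y. ?a Y (\<rho> \<circ> tp j k))"
    using A by (subst sum.reindex) (auto simp: inj_on_def)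
  finally show ?thesis using Y(3) finY by simp
qed

text \<open>By the recursion, n - d - card Y times the new average is minus a sum of card Y + 1
  right translates of the old one, so each new point costs the 2-norm a factor of at most (card Y +
  1) / (n - 2 * d).\<close>

lemma swap_avg_norm_le:
  assumes u: "pure n d u" and N: "d \<le> N" "2 * N \<le> n" and m: "2 * d < n"
    and Y: "Y \<subseteq> {1..d}"
  shows "sqnorm (Sy n) (swap_avg n N d u Y)
     \<le> (fact (card Y) / real (n - 2 * d) ^ card Y)\<^sup>2 * sqnorm (Sy n) u"
proof -
  have "finite Y" using Y finite_subset by blast
  then show ?thesis using Y
  proof (induction Y)
    case empty
    have "swap_avg n N d u {} \<rho> = u \<rho>" for \<rho>
    proof -
      have "u (\<rho> \<circ> h \<circ> sw N {}) = u \<rho>" if "h \<in> fixing n d" for h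
        using u fixing_fix[OF that] by (intro depends_onD[of "{1..d}" u]) (auto simp: pure_def)
      then have "swap_avg n N d u {} \<rho> = avg (fixing n d) (\<lambda>h. u \<rho>)"
        unfolding swap_avg_def by (rule avg_cong)
      then show ?thesis by (simp add: avg_const)
    qed
    then show ?case by simp
  next
    case (insert k Y)
    let ?a = "swap_avg n N d u" and ?m = "real (n - 2 * d)" and ?c = "real (Suc (card Y))"
    have k: "k \<in> {1..d}" "Y \<subseteq> {1..d}" using insert.prems by auto
    have cardY: "card Y \<le> d" using card_mono[OF _ k(2)] by simp
    have mpos: "?m > 0" using m by simp
    have mle: "?m \<le> real (n - d - card Y)" using cardY m by simp
    have "(?m * ?a (insert k Y) \<rho>)\<^sup>2 \<le> ?c * (\<Sum>j\<in>insert k Y. (?a Y (\<rho> \<circ> tp j k))\<^sup>2)" if \<rho>: "\<rho> \<in> Sy n" for \<rho>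
    proof -
      have "(?m * ?a (insert k Y) \<rho>)\<^sup>2 \<le> (real (n - d - card Y) * ?a (insert k Y) \<rho>)\<^sup>2"
        using mle mpos unfolding power_mult_distrib by (intro mult_right_mono power_mono) auto
      also have "\<dots> = (\<Sum>j\<in>insert k Y. ?a Y (\<rho> \<circ> tp j k))\<^sup>2"
        using swap_avg_rec[OF u N k(2,1) insert.hyps(2) \<rho>] by (simp add: power2_eq_iff eq_neg_iff_add_eq_0 add.commute)
      also have "\<dots> \<le> real (card (insert k Y)) * (\<Sum>j\<in>insert k Y. (?a Y (\<rho> \<circ> tp j k))\<^sup>2)"
        using sum_squared_le_sum_of_squares[of "\<lambda>j. ?a Y (\<rho> \<circ> tp j k)" "insert k Y"]
        by (simp only: mult.commute)
      finally show ?thesis using insert.hyps by simp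
    qed
    then have "avg (Sy n) (\<lambda>\<rho>. (?m * ?a (insert k Y) \<rho>)\<^sup>2)
       \<le> avg (Sy n) (\<lambda>\<rho>. ?c * (\<Sum>j\<in>insert k Y. (?a Y (\<rho> \<circ> tp j k))\<^sup>2))"
      by (rule avg_mono)
    also have "\<dots> = ?c * (\<Sum>j\<in>insert k Y. avg (Sy n) (\<lambda>\<rho>. (?a Y (\<rho> \<circ> tp j k))\<^sup>2))"
      by (simp only: avg_cmult avg_sum)
    also have "\<dots> = ?c * (\<Sum>j\<in>insert k Y. sqnorm (Sy n) (?a Y))"
    proof -
      have "tp j k \<in> Sy n" if "j \<in> insert k Y" for j
        using that k N m by (intro transpose_in_Sy) auto
      then have "avg (Sy n) (\<lambda>\<rho>. (?a Y (\<rho> \<circ> tp j k))\<^sup>2) = avg (Sy n) (\<lambda>\<rho>. (?a Y \<rho>)\<^sup>2)" if "j \<in> insert k Y" for j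
        using that avg_Sy_right[of "tp j k" n "\<lambda>\<rho>. (?a Y \<rho>)\<^sup>2"] by simp
      then have "(\<Sum>j\<in>insert k Y. avg (Sy n) (\<lambda>\<rho>. (?a Y (\<rho> \<circ> tp j k))\<^sup>2))
          = (\<Sum>j\<in>insert k Y. sqnorm (Sy n) (?a Y))"
        by (rule sum.cong[OF refl])
      then show ?thesis by (simp only:)
    qed
    also have "\<dots> = ?c\<^sup>2 * sqnorm (Sy n) (?a Y)"
      using insert.hyps by (simp add: power2_eq_square)
    also have "\<dots> \<le> ?c\<^sup>2 * ((fact (card Y) / ?m ^ card Y)\<^sup>2 * sqnorm (Sy n) u)"
      using insert.IH[OF k(2)] by (intro mult_left_mono) auto
    finally have "?m\<^sup>2 * sqnorm (Sy n) (?a (insert k Y))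
       \<le> ?c\<^sup>2 * ((fact (card Y) / ?m ^ card Y)\<^sup>2 * sqnorm (Sy n) u)"
      by (simp only: power_mult_distrib avg_cmult)
    then have "sqnorm (Sy n) (?a (insert k Y))
       \<le> ?c\<^sup>2 * ((fact (card Y) / ?m ^ card Y)\<^sup>2 * sqnorm (Sy n) u) / ?m\<^sup>2"
      using mpos by (simp only: pos_le_divide_eq zero_less_power mult.commute)
    also have "\<dots> = (fact (card (insert k Y)) / ?m ^ card (insert k Y))\<^sup>2 * sqnorm (Sy n) u"
      using insert.hyps by (simp add: power_divide power_mult_distrib mult_ac)
    finally show ?case .
  qed
qed

lemma sum_Pow_card:
  assumes "finite A"
  shows "(\<Sum>Y\<in>Pow A. g (card Y)) = (\<Sum>k\<le>card A. real (card A choose k) * g k)"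
proof -
  have "(\<Sum>Y\<in>Pow A. g (card Y)) = (\<Sum>k\<le>card A. \<Sum>Y\<in>{Y\<in>Pow A. card Y = k}. g (card Y))"
    using assms by (intro sum.group[symmetric]) (auto intro: card_mono)
  also have "\<dots> = (\<Sum>k\<le>card A. real (card A choose k) * g k)"
    using n_subsets[OF assms] by (intro sum.cong) auto
  finally show ?thesis .
qed

text \<open>The subsets of size k contribute at most (d / m)^k, hence at most (1/4)^k. With m = n -
  2 * d the hypothesis becomes 6 * d \<le> n, the source of that condition in the later
  results.\<close>

lemma sum_fact_over_subsets_le:
  assumes "4 * real d \<le> m" "0 < m"
  shows "(\<Sum>Y\<in>Pow {1..d} - {{}}. fact (card Y) / m ^ card Y) \<le> (1/2::real)"
proof -
  have "(\<Sum>Y\<in>Pow {1..d}. fact (card Y) / m ^ card Y) = (\<Sum>k\<le>d. real (d choose k) * (fact k / m ^ k))"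
    using sum_Pow_card[of "{1..d}" "\<lambda>k. fact k / m ^ k"] by simp
  also have "\<dots> \<le> (\<Sum>k\<le>d. (1/4) ^ k)"
  proof (rule sum_mono)
    fix k
    have "real (d choose k) * fact k \<le> real d ^ k"
      using binomial_fact_pow[of d k] by (metis of_nat_fact of_nat_le_iff of_nat_mult of_nat_power)
    also have "\<dots> \<le> (m / 4) ^ k" using assms by (intro power_mono) auto
    finally show "real (d choose k) * (fact k / m ^ k) \<le> (1/4) ^ k"
      using assms by (simp add: divide_simps power_divide)
  qed
  also have "\<dots> \<le> 3/2"
  proof -
    have "(\<Sum>k\<le>d. (1/4) ^ k) = (4 - (1/4::real) ^ d) / 3"
    proof (induction d)
      case (Suc d)
      then show ?case by (simp only: sum.atMost_Suc power_Suc) (simp add: field_simps)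
    qed simp
    moreover have "0 \<le> (1/4::real) ^ d" by simp
    moreover have "(4 - a) / 3 \<le> 3/2" if "0 \<le> a" for a :: real using that by simp
    ultimately have "(\<Sum>k\<le>d. (1/4::real) ^ k) \<le> 3/2" by metis
    then show ?thesis .
  qed
  finally show ?thesis by (simp add: sum_diff1)
qed

text \<open>The empty set contributes the square norm itself, and by purity all other sets together
  cost at most half of it.\<close>

lemma pure_alternating_sum_ge:
  assumes u: "pure n d u" and N: "d \<le> N" "2 * N \<le> n" and d: "6 * d \<le> n" "0 < n"
  shows "sqnorm (Sy n) u / 2
    \<le> (\<Sum>Y\<in>Pow {1..d}. (-1) ^ card Y * avg (Sy n) (\<lambda>\<rho>. u \<rho> * u (\<rho> \<circ> sw N Y)))"
proof -
  let ?q = "sqnorm (Sy n) u" and ?m = "real (n - 2 * d)"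
  let ?c = "\<lambda>Y :: nat set. fact (card Y) / ?m ^ card Y"
  let ?i = "\<lambda>Y. avg (Sy n) (\<lambda>\<rho>. u \<rho> * u (\<rho> \<circ> sw N Y))"
  have dep: "depends_on {1..d} u" using u by (simp add: pure_def)
  have m: "2 * d < n" "4 * real d \<le> ?m" "0 < ?m" using d by (auto simp: of_nat_diff)
  have q0: "0 \<le> ?q" by (intro avg_nonneg) auto
  have i: "\<bar>?i Y\<bar> \<le> ?c Y * ?q" if Y: "Y \<subseteq> {1..d}" for Y
  proof -
    have "?i Y = avg (fixing n d) (\<lambda>h. ?i Y)" by (simp add: avg_const)
    \<comment> \<open>Replacing \<rho> by \<rho> \<circ> h preserves the mean and does not affect
      the first factor, which reads only the first d values.\<close>
    also have "\<dots> = avg (fixing n d) (\<lambda>h. avg (Sy n) (\<lambda>\<rho>. u \<rho> * u (\<rho> \<circ> h \<circ> sw N Y)))"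
    proof (rule avg_cong)
      fix h assume h: "h \<in> fixing n d"
      have "?i Y = avg (Sy n) (\<lambda>\<rho>. u (\<rho> \<circ> h) * u (\<rho> \<circ> h \<circ> sw N Y))"
        using avg_Sy_right[OF fixing_Sy[OF h], of "\<lambda>\<rho>. u \<rho> * u (\<rho> \<circ> sw N Y)"] by simp
      moreover have "u (\<rho> \<circ> h) = u \<rho>" for \<rho>
        using fixing_fix[OF h] by (intro depends_onD[OF dep]) auto
      ultimately show "?i Y = avg (Sy n) (\<lambda>\<rho>. u \<rho> * u (\<rho> \<circ> h \<circ> sw N Y))" by simp
    qed
    also have "\<dots> = avg (Sy n) (\<lambda>\<rho>. u \<rho> * swap_avg n N d u Y \<rho>)"
      unfolding swap_avg_def by (subst avg_swap) (simp add: avg_cmult)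
    finally have "(?i Y)\<^sup>2 \<le> ?q * sqnorm (Sy n) (swap_avg n N d u Y)"
      using avg_Cauchy_Schwarz[of "Sy n" u "swap_avg n N d u Y"] by simp
    also have "\<dots> \<le> ?q * ((?c Y)\<^sup>2 * ?q)"
      using swap_avg_norm_le[OF u N m(1) Y] q0 by (intro mult_left_mono) auto
    also have "\<dots> = (?c Y * ?q)\<^sup>2" by (simp add: power_mult_distrib power2_eq_square)
    finally show ?thesis
      using q0 by (intro abs_le_square_iff[THEN iffD2, of "?i Y" "?c Y * ?q", simplified abs_of_nonneg, THEN order_trans])
        (auto simp: abs_mult)
  qed
  have "- (?q / 2) \<le> - ((\<Sum>Y\<in>Pow {1..d} - {{}}. ?c Y) * ?q)"
    using sum_fact_over_subsets_le[OF m(2,3)] q0 mult_right_mono by fastforce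
  also have "\<dots> \<le> (\<Sum>Y\<in>Pow {1..d} - {{}}. (-1) ^ card Y * ?i Y)"
    unfolding sum_distrib_right sum_negf[symmetric]
  proof (rule sum_mono)
    fix Y assume "Y \<in> Pow {1..d} - {{}}"
    then have "\<bar>(-1) ^ card Y * ?i Y\<bar> \<le> ?c Y * ?q" using i by (simp add: abs_mult)
    then show "- (?c Y * ?q) \<le> (-1) ^ card Y * ?i Y" by linarith
  qed
  finally have "?q - ?q / 2 \<le> ?q + (\<Sum>Y\<in>Pow {1..d} - {{}}. (-1) ^ card Y * ?i Y)" by linarith
  also have "\<dots> = (\<Sum>Y\<in>Pow {1..d}. (-1) ^ card Y * ?i Y)"
    by (subst (2) sum.remove[of _ "{}"]) (auto simp: power2_eq_square)
  finally show ?thesis by simp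
qed

section \<open>Odd parts under swaps\<close>

lemma depends_on_power: "depends_on T u \<Longrightarrow> depends_on T (\<lambda>x. u x ^ k)"
  unfolding depends_on_def by metis

text \<open>For w depending on S this is, up to the factor 2 ^ card S, the projection to the
  character \<open>chi S\<close> of the group of swaps.\<close>

definition oddpart :: "nat \<Rightarrow> nat set \<Rightarrow> ((nat \<Rightarrow> nat) \<Rightarrow> real) \<Rightarrow> (nat \<Rightarrow> nat) \<Rightarrow> real" where
  "oddpart N S w x = (\<Sum>Y\<in>Pow S. (-1) ^ card Y * w (x \<circ> sw N Y))"

lemma minus_one_power_square [simp]: "((-1 :: real) ^ k)\<^sup>2 = 1" "(-1 :: real) ^ k * ((-1) ^ k * x) = x"
  by (cases "even k"; simp)+

lemma minus_one_power_sym_diff: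
  assumes "finite A" "finite B"
  shows "(-1 :: real) ^ card (sym_diff A B) = (-1) ^ card A * (-1) ^ card B"
proof -
  have "card (sym_diff A B) = card (A - B) + card (B - A)"
    using assms by (intro card_Un_disjoint) auto
  moreover have "card A = card (A - B) + card (A \<inter> B)" "card B = card (B - A) + card (A \<inter> B)"
    using card_Diff_subset_Int[of A B] card_Diff_subset_Int[of B A] assms
    by (auto simp: Int_commute card_mono le_add_diff_inverse2 card_Int_Diff)
  ultimately have "card A + card B = card (sym_diff A B) + 2 * card (A \<inter> B)" by simp
  then have "(-1 :: real) ^ (card A + card B) = (-1) ^ card (sym_diff A B)"
    by (simp only: power_add) simp
  then show ?thesis by (simp add: power_add)
qed

text \<open>A swap outside S is invisible to w; a swap inside S shifts the summation index by a
  symmetric difference, and the parity of that shift is the sign.\<close>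

lemma oddpart_sw:
  assumes S: "S \<subseteq> {1..N}" "y \<subseteq> {1..N}" and w: "depends_on S w"
  shows "oddpart N S w (x \<circ> sw N y) = chi S y * oddpart N S w x"
proof -
  have finS: "finite S" using S(1) finite_subset by blast
  let ?Z = "y \<inter> S"
  have eq: "w (x \<circ> sw N y \<circ> sw N Y) = w (x \<circ> sw N (sym_diff ?Z Y))" if Y: "Y \<in> Pow S" for Y
  proof (rule depends_onD[OF w])
    fix s assume s: "s \<in> S"
    have YN: "Y \<subseteq> {1..N}" "sym_diff ?Z Y \<subseteq> {1..N}" "sym_diff y Y \<subseteq> {1..N}" using Y S by auto
    have "(sw N y \<circ> sw N Y) s = sw N (sym_diff y Y) s" using sw_comp[OF S(2) YN(1)] by simp
    also have "\<dots> = sw N (sym_diff ?Z Y) s"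
      using sw_low[OF _ YN(2), of s] sw_low[OF _ YN(3), of s] s S(1) by auto
    finally show "(x \<circ> sw N y \<circ> sw N Y) s = (x \<circ> sw N (sym_diff ?Z Y)) s" by simp
  qed
  have bij: "bij_betw (\<lambda>Y. sym_diff ?Z Y) (Pow S) (Pow S)"
    by (rule bij_betw_byWitness[where f' = "\<lambda>Y. sym_diff ?Z Y"]) auto
  have "oddpart N S w (x \<circ> sw N y) = (\<Sum>Y\<in>Pow S. (-1) ^ card Y * w (x \<circ> sw N (sym_diff ?Z Y)))"
    unfolding oddpart_def using eq by (intro sum.cong) auto
  also have "\<dots> = (\<Sum>Y\<in>Pow S. (-1) ^ card ?Z * ((-1) ^ card (sym_diff ?Z Y) * w (x \<circ> sw N (sym_diff ?Z Y))))"
  proof (rule sum.cong[OF refl])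
    fix Y assume "Y \<in> Pow S"
    then have "finite Y" using finS finite_subset by blast
    then show "(-1) ^ card Y * w (x \<circ> sw N (sym_diff ?Z Y))
      = (-1) ^ card ?Z * ((-1) ^ card (sym_diff ?Z Y) * w (x \<circ> sw N (sym_diff ?Z Y)))"
      using finS by (simp add: minus_one_power_sym_diff mult.assoc)
  qed
  also have "\<dots> = (-1) ^ card ?Z * (\<Sum>Y\<in>Pow S. (-1) ^ card Y * w (x \<circ> sw N Y))"
    unfolding sum_distrib_left
    using sum.reindex_bij_betw[OF bij, of "\<lambda>Y. (-1) ^ card ?Z * ((-1) ^ card Y * w (x \<circ> sw N Y))"] by simp
  finally show ?thesis by (simp add: oddpart_def chi_def Int_commute)
qed

text \<open>A swapped point s reads the value at s + N, so d points become 2 * d; this determines at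
  how many points globalness is invoked.\<close>

lemma depends_on_oddpart:
  assumes S: "S \<subseteq> {1..N}" and w: "depends_on S w"
  shows "depends_on (S \<union> (\<lambda>s. s + N) ` S) (oddpart N S w)"
  unfolding depends_on_def oddpart_def
proof (intro allI impI sum.cong[OF refl] arg_cong2[where f = "(*)"] refl depends_onD[OF w])
  fix x y :: "nat \<Rightarrow> nat" and Y s
  assume xy: "\<forall>i\<in>S \<union> (\<lambda>s. s + N) ` S. x i = y i" and Y: "Y \<in> Pow S" and s: "s \<in> S"
  have "Y \<subseteq> {1..N}" "s \<in> {1..N}" using Y S s by auto
  then show "(x \<circ> sw N Y) s = (y \<circ> sw N Y) s"
    using xy s by (simp add: sw_low)
qed

lemma avg_oddpart_square_le:
  assumes S: "S \<subseteq> {1..N}" and N: "2 * N \<le> n"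
  shows "sqnorm (Sy n) (oddpart N S w) \<le> 4 ^ card S * sqnorm (Sy n) w"
proof -
  have finS: "finite S" using S(1) finite_subset by blast
  have "(oddpart N S w x)\<^sup>2 \<le> 2 ^ card S * (\<Sum>Y\<in>Pow S. (w (x \<circ> sw N Y))\<^sup>2)" for x
  proof -
    have "(oddpart N S w x)\<^sup>2 \<le> (\<Sum>Y\<in>Pow S. ((-1) ^ card Y * w (x \<circ> sw N Y))\<^sup>2) * real (card (Pow S))"
      unfolding oddpart_def by (rule sum_squared_le_sum_of_squares)
    also have "\<dots> = 2 ^ card S * (\<Sum>Y\<in>Pow S. (w (x \<circ> sw N Y))\<^sup>2)"
      using finS by (simp add: card_Pow power_mult_distrib)
    finally show ?thesis .
  qed
  then have "sqnorm (Sy n) (oddpart N S w) \<le> avg (Sy n) (\<lambda>x. 2 ^ card S * (\<Sum>Y\<in>Pow S. (w (x \<circ> sw N Y))\<^sup>2))"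
    by (intro avg_mono)
  also have "\<dots> = 2 ^ card S * (\<Sum>Y\<in>Pow S. avg (Sy n) (\<lambda>x. (w (x \<circ> sw N Y))\<^sup>2))"
    by (simp only: avg_cmult avg_sum)
  also have "(\<Sum>Y\<in>Pow S. avg (Sy n) (\<lambda>x. (w (x \<circ> sw N Y))\<^sup>2)) = (\<Sum>Y\<in>Pow S. avg (Sy n) (\<lambda>x. (w x)\<^sup>2))"
  proof (rule sum.cong[OF refl])
    fix Y assume "Y \<in> Pow S"
    then have "sw N Y \<in> Sy n" using S N by (intro sw_in_Sy) auto
    then show "avg (Sy n) (\<lambda>x. (w (x \<circ> sw N Y))\<^sup>2) = avg (Sy n) (\<lambda>x. (w x)\<^sup>2)"
      by (rule avg_Sy_right)
  qed
  moreover have "(4 :: real) ^ card S = 2 ^ card S * 2 ^ card S" by (simp add: power_mult_distrib[symmetric])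
  ultimately show ?thesis using finS by (simp add: card_Pow mult.assoc)
qed

section \<open>The level inequality\<close>

text \<open>The bound on restrictions in dual form. Testing against nonnegative functions of t
  points, instead of indicators of the sets \<open>U n I J\<close>, allows squares of odd parts to
  be inserted directly.\<close>

definition global_at :: "nat \<Rightarrow> nat \<Rightarrow> real \<Rightarrow> ((nat \<Rightarrow> nat) \<Rightarrow> real) \<Rightarrow> bool" where
  "global_at n t r f \<longleftrightarrow> (\<forall>T \<phi>. T \<subseteq> {1..n} \<longrightarrow> card T = t \<longrightarrow> depends_on T \<phi> \<longrightarrow> (\<forall>x. 0 \<le> \<phi> x) \<longrightarrow>
     avg (Al n) (\<lambda>x. f x * \<phi> x) \<le> r ^ t * avg (Al n) \<phi>)"

lemma global_atD:
  "global_at n t r f \<Longrightarrow> T \<subseteq> {1..n} \<Longrightarrow> card T = t \<Longrightarrow> depends_on T \<phi> \<Longrightarrow> (\<And>x. 0 \<le> \<phi> x) \<Longrightarrow>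
    avg (Al n) (\<lambda>x. f x * \<phi> x) \<le> r ^ t * avg (Al n) \<phi>"
  by (simp add: global_at_def)

text \<open>The group splits into the fibres of the values on T, each of the form
  \<open>U n I J\<close>. There \<phi> is constant and the mean of f is at most r ^ t.\<close>

lemma biglobal_imp_global_at:
  assumes f: "biglobal n r f" "\<And>\<sigma>. \<sigma> \<in> Al n \<Longrightarrow> 0 \<le> f \<sigma>" "Lp_norm 1 (Al n) f = 1" and t: "t \<le> n"
  shows "global_at n t r f"
  unfolding global_at_def
proof (intro allI impI)
  fix T and \<phi> :: "(nat \<Rightarrow> nat) \<Rightarrow> real"
  assume T: "T \<subseteq> {1..n}" "card T = t" and \<phi>: "depends_on T \<phi>" "\<forall>x. 0 \<le> \<phi> x"
  have finT: "finite T" using T finite_subset by blast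
  define I where "I = sorted_list_of_set T"
  have I: "set I = T" "distinct I" "length I = t" using finT T by (auto simp: I_def)
  have It: "I \<in> tuples n t" using I T by (auto simp: tuples_def)
  define J where "J = (\<lambda>\<sigma> :: nat \<Rightarrow> nat. map \<sigma> I)"
  have fib: "{\<sigma>' \<in> Al n. J \<sigma>' = J \<sigma>} = U n I (J \<sigma>)" for \<sigma>
    by (auto simp: U_def J_def list_eq_iff_nth_eq)
  have key: "(\<Sum>x\<in>U n I (J \<sigma>). f x * \<phi> x) \<le> r ^ t * (\<Sum>x\<in>U n I (J \<sigma>). \<phi> x)" if \<sigma>: "\<sigma> \<in> Al n" for \<sigma>
  proof -
    let ?V = "U n I (J \<sigma>)"
    have \<sigma>V: "\<sigma> \<in> ?V" using \<sigma> unfolding fib[symmetric] by simp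
    have V: "?V \<subseteq> Al n" "finite ?V" by (auto simp: U_def intro: finite_subset[OF _ finite_Al])
    have "J \<sigma> \<in> tuples n t"
    proof -
      have p: "\<sigma> permutes {1..n}" using \<sigma> by (simp add: in_Al_iff)
      then have "inj_on \<sigma> (set I)" using permutes_inj_on by blast
      moreover have "\<sigma> ` T \<subseteq> {1..n}" using T p permutes_in_image by fastforce
      ultimately show ?thesis using I by (auto simp: tuples_def J_def distinct_map)
    qed
    then have "Lp_norm 1 ?V f \<le> r ^ t * 1"
      using f(1,3) t It \<sigma>V unfolding biglobal_def by fastforce
    moreover have "Lp_norm 1 ?V f = avg ?V f"
    proof -
      have "avg ?V (\<lambda>x. \<bar>f x\<bar> powr 1) = avg ?V f" using f(2) V by (intro avg_cong) auto
      moreover have "0 \<le> avg ?V f" using f(2) V by (intro avg_nonneg) auto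
      ultimately show ?thesis by (simp add: Lp_norm_def)
    qed
    moreover have "card ?V > 0" using \<sigma>V V by (auto simp: card_gt_0_iff)
    ultimately have sum: "sum f ?V \<le> r ^ t * real (card ?V)" by (simp add: avg_def divide_le_eq)
    have const: "\<phi> x = \<phi> \<sigma>" if "x \<in> ?V" for x
    proof (rule depends_onD[OF \<phi>(1)])
      fix i assume "i \<in> T"
      then obtain s where "s < length I" "i = I ! s" using I by (metis in_set_conv_nth)
      then show "x i = \<sigma> i" using that by (auto simp: U_def J_def)
    qed
    have "(\<Sum>x\<in>?V. f x * \<phi> x) = sum f ?V * \<phi> \<sigma>" using const by (simp add: sum_distrib_right)
    also have "\<dots> \<le> (r ^ t * real (card ?V)) * \<phi> \<sigma>" using sum \<phi>(2) by (intro mult_right_mono) auto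
    also have "\<dots> = r ^ t * (\<Sum>x\<in>?V. \<phi> x)" using const by simp
    finally show ?thesis .
  qed
  have group: "(\<Sum>j\<in>J ` Al n. \<Sum>x\<in>{x \<in> Al n. J x = j}. h x) = sum h (Al n)" for h :: "(nat \<Rightarrow> nat) \<Rightarrow> real"
    by (rule sum.group) auto
  have "(\<Sum>x\<in>Al n. f x * \<phi> x) = (\<Sum>j\<in>J ` Al n. \<Sum>x\<in>{x \<in> Al n. J x = j}. f x * \<phi> x)"
    by (rule group[symmetric])
  also have "\<dots> \<le> (\<Sum>j\<in>J ` Al n. r ^ t * (\<Sum>x\<in>{x \<in> Al n. J x = j}. \<phi> x))"
  proof (rule sum_mono)
    fix j assume "j \<in> J ` Al n"
    then obtain \<sigma> where "\<sigma> \<in> Al n" "j = J \<sigma>" by blast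
    then show "(\<Sum>x\<in>{x \<in> Al n. J x = j}. f x * \<phi> x) \<le> r ^ t * (\<Sum>x\<in>{x \<in> Al n. J x = j}. \<phi> x)"
      using key[of \<sigma>] fib[of \<sigma>] by simp
  qed
  also have "\<dots> = r ^ t * (\<Sum>x\<in>Al n. \<phi> x)"
    unfolding sum_distrib_left[symmetric] group ..
  finally show "avg (Al n) (\<lambda>x. f x * \<phi> x) \<le> r ^ t * avg (Al n) \<phi>"
    by (simp add: avg_def divide_right_mono)
qed

text \<open>
  On a coset of the group of all \<open>sw N y\<close> the function \<open>G\<close> is a homogeneous polynomial of degree \<open>d\<close> in
  signs whose coefficients have square sum \<open>B\<close>, so all uniform moments of \<open>Z = G\<^sup>2 / B\<close> are under control,
  and those with respect to the density \<open>f\<close> follow at the price of its 2-norm. What remains is the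
  mean of \<open>B\<close> with respect to \<open>f\<close>: as \<open>B\<close> is a sum of nonnegative functions of \<open>2 * d\<close> points, it exceeds
  the uniform mean at most by the factor \<open>r ^ (2 * d)\<close>.
\<close>

lemma odd_chaos_bound:
  fixes L r :: real
  assumes f: "\<And>\<sigma>. \<sigma> \<in> Al n \<Longrightarrow> 0 \<le> f \<sigma>" "avg (Al n) f = 1" "sqnorm (Al n) f \<le> exp (2 * L)"
    and glob: "global_at n (2 * d) r f"
    and n: "2 * d + 2 \<le> n" "2 * N \<le> n"
    and \<S>: "\<And>S. S \<in> \<S> \<Longrightarrow> S \<subseteq> {1..N} \<and> card S = d"
    and w: "\<And>S. S \<in> \<S> \<Longrightarrow> depends_on S (w S)"
    and k: "0 < k" "L + 1 \<le> real k * real d"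
    and \<iota>: "\<iota> \<in> Sy n"
  shows "(avg (Al n) (\<lambda>\<tau>. f \<tau> * (\<Sum>S\<in>\<S>. oddpart N S (w S) (\<tau> \<circ> \<iota>))))\<^sup>2
    \<le> (4 * exp 1 * real k) ^ d * r ^ (2 * d) * 4 ^ d * (\<Sum>S\<in>\<S>. sqnorm (Sy n) (w S))"
proof -
  have fin\<S>: "finite \<S>" by (rule finite_subset[of _ "Pow {1..N}"]) (use \<S> in auto)
  define o' where "o' = (\<lambda>S. oddpart N S (w S))"
  define G where "G = (\<lambda>x. \<Sum>S\<in>\<S>. o' S x)"
  define B where "B = (\<lambda>x. \<Sum>S\<in>\<S>. (o' S x)\<^sup>2)"
  define Z where "Z = (\<lambda>x. (G x)\<^sup>2 / B x)"
  have B0: "0 \<le> B x" for x by (simp add: B_def sum_nonneg)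
  have Z0: "0 \<le> Z x" for x using B0 by (simp add: Z_def)
  \<comment> \<open>Where B x = 0 the quotient Z x is 0 by convention; the identity
    \<open>GZ\<close> survives because all odd parts vanish there.\<close>
  have GB: "G x = 0" if "B x = 0" for x
    using that fin\<S> unfolding B_def G_def by (subst (asm) sum_nonneg_eq_0_iff) auto
  have GZ: "(G x)\<^sup>2 = B x * Z x" for x using GB[of x] by (auto simp: Z_def)
  have osw: "o' S (x \<circ> sw N y) = o' S x * chi S y" if "S \<in> \<S>" "y \<in> Pow {1..N}" for S y x
    unfolding o'_def using oddpart_sw[of S N y "w S" x] \<S> w that by auto
  have chi2: "(chi S y)\<^sup>2 = 1" for S y :: "nat set"
    by (simp add: chi_def power_mult[symmetric])
  have Bsw: "B (x \<circ> sw N y) = B x" if "y \<in> Pow {1..N}" for x y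
    unfolding B_def using osw that by (intro sum.cong) (auto simp: power_mult_distrib chi2)
  \<comment> \<open>On each coset this is Bonami's inequality with p = 2 * k: Z ^ (2 * k) contains G
    to the power 4 * k, and 2 * p - 1 \<le> 4 * k.\<close>
  have moment: "avg (Sy n) (\<lambda>x. Z x ^ (2 * k)) \<le> (real (4 * k)) ^ (d * (2 * k))"
  proof -
    have "avg (Sy n) (\<lambda>x. Z x ^ (2 * k)) = avg (Pow {1..N}) (\<lambda>y. avg (Sy n) (\<lambda>x. Z (x \<circ> sw N y) ^ (2 * k)))"
    proof -
      have "avg (Sy n) (\<lambda>x. Z (x \<circ> sw N y) ^ (2 * k)) = avg (Sy n) (\<lambda>x. Z x ^ (2 * k))" if "y \<in> Pow {1..N}" for y
        using sw_in_Sy[of y N n] that n(2) by (intro avg_Sy_right) auto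
      then have "avg (Pow {1..N}) (\<lambda>y. avg (Sy n) (\<lambda>x. Z (x \<circ> sw N y) ^ (2 * k)))
         = avg (Pow {1..N}) (\<lambda>y. avg (Sy n) (\<lambda>x. Z x ^ (2 * k)))"
        by (rule avg_cong)
      also have "\<dots> = avg (Sy n) (\<lambda>x. Z x ^ (2 * k))" by (rule avg_const) auto
      finally show ?thesis by (rule sym)
    qed
    also have "\<dots> = avg (Sy n) (\<lambda>x. avg (Pow {1..N}) (\<lambda>y. Z (x \<circ> sw N y) ^ (2 * k)))"
      by (rule avg_swap)
    also have "\<dots> \<le> avg (Sy n) (\<lambda>x. (real (4 * k)) ^ (d * (2 * k)))"
    proof (rule avg_mono)
      fix x
      have "avg (Pow {1..N}) (\<lambda>y. Z (x \<circ> sw N y) ^ (2 * k))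
          = avg (Pow {1..N}) (\<lambda>y. (1 / B x ^ (2 * k)) * (\<Sum>S\<in>\<S>. o' S x * chi S y) ^ (2 * (2 * k)))"
      proof (rule avg_cong)
        fix y assume y: "y \<in> Pow {1..N}"
        have "G (x \<circ> sw N y) = (\<Sum>S\<in>\<S>. o' S x * chi S y)"
          unfolding G_def using osw y by (intro sum.cong) auto
        then show "Z (x \<circ> sw N y) ^ (2 * k) = (1 / B x ^ (2 * k)) * (\<Sum>S\<in>\<S>. o' S x * chi S y) ^ (2 * (2 * k))"
          unfolding Z_def Bsw[OF y] power_divide power_mult[symmetric] by simp
      qed
      also have "\<dots> \<le> (1 / B x ^ (2 * k)) * ((2 * real (2 * k) - 1) ^ d * B x) ^ (2 * k)"
        unfolding avg_cmult B_def using \<S> k B0[of x] unfolding B_def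
        by (intro mult_left_mono Bonami_homogeneous) auto
      also have "\<dots> \<le> (real (4 * k)) ^ (d * (2 * k))"
      proof (cases "B x = 0")
        case False
        have "(1 / B x ^ (2 * k)) * ((2 * real (2 * k) - 1) ^ d * B x) ^ (2 * k) = (2 * real (2 * k) - 1) ^ (d * (2 * k))"
          using False by (simp add: power_mult_distrib power_mult)
        also have "\<dots> \<le> (real (4 * k)) ^ (d * (2 * k))" using k by (intro power_mono) auto
        finally show ?thesis .
      qed (use k in simp)
      finally show "avg (Pow {1..N}) (\<lambda>y. Z (x \<circ> sw N y) ^ (2 * k)) \<le> (real (4 * k)) ^ (d * (2 * k))" .
    qed
    finally show ?thesis by (simp add: avg_const)
  qed
  have fZ0: "0 \<le> avg (Al n) (\<lambda>\<tau>. f \<tau> * Z (\<tau> \<circ> \<iota>))" using f(1) Z0 by (intro avg_nonneg) auto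
  have fZ: "avg (Al n) (\<lambda>\<tau>. f \<tau> * Z (\<tau> \<circ> \<iota>)) \<le> (4 * exp 1 * real k) ^ d"
  proof -
    have "avg (Al n) (\<lambda>\<tau>. f \<tau> * Z (\<tau> \<circ> \<iota>)) ^ k \<le> avg (Al n) (\<lambda>\<tau>. f \<tau> * Z (\<tau> \<circ> \<iota>) ^ k)"
      using f Z0 by (intro avg_power_Jensen) auto
    then have "(avg (Al n) (\<lambda>\<tau>. f \<tau> * Z (\<tau> \<circ> \<iota>)) ^ k)\<^sup>2 \<le> (avg (Al n) (\<lambda>\<tau>. f \<tau> * Z (\<tau> \<circ> \<iota>) ^ k))\<^sup>2"
      using fZ0 by (intro power_mono) auto
    also have "\<dots> \<le> sqnorm (Al n) f * avg (Al n) (\<lambda>\<tau>. (Z (\<tau> \<circ> \<iota>) ^ k)\<^sup>2)"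
      by (rule avg_Cauchy_Schwarz)
    also have "\<dots> \<le> exp (2 * L) * (2 * (real (4 * k)) ^ (d * (2 * k)))"
    proof (rule mult_mono)
      have "avg (Al n) (\<lambda>\<tau>. (Z (\<tau> \<circ> \<iota>) ^ k)\<^sup>2) \<le> 2 * avg (Sy n) (\<lambda>\<tau>. (Z (\<tau> \<circ> \<iota>) ^ k)\<^sup>2)"
        using n by (intro avg_Al_le_twice_avg_Sy) auto
      also have "avg (Sy n) (\<lambda>\<tau>. (Z (\<tau> \<circ> \<iota>) ^ k)\<^sup>2) = avg (Sy n) (\<lambda>x. (Z x ^ k)\<^sup>2)"
        by (rule avg_Sy_right[OF \<iota>])
      also have "\<dots> = avg (Sy n) (\<lambda>x. Z x ^ (2 * k))" by (simp add: power_mult[symmetric] mult.commute)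
      finally show "avg (Al n) (\<lambda>\<tau>. (Z (\<tau> \<circ> \<iota>) ^ k)\<^sup>2) \<le> 2 * (real (4 * k)) ^ (d * (2 * k))"
        using moment by linarith
    qed (auto intro!: f avg_nonneg)
    \<comment> \<open>The hypothesis L + 1 \<le> k * d is made for this line: the cost exp (2 * L)
      of the 2-norm and the factor 2 for leaving the alternating group shrink to exp 1 ^ d after the
      root of order 2 * k.\<close>
    also have "\<dots> \<le> exp (real (d * (2 * k))) * (real (4 * k)) ^ (d * (2 * k))"
    proof -
      have "2 * exp (2 * L) \<le> exp 2 * exp (2 * L)"
        using exp_ge_add_one_self[of 2] by (intro mult_right_mono) auto
      also have "\<dots> = exp (2 + 2 * L)" by (rule exp_add[symmetric])
      also have "\<dots> \<le> exp (real (d * (2 * k)))" using k by (simp add: algebra_simps)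
      finally have "2 * exp (2 * L) * (real (4 * k)) ^ (d * (2 * k)) \<le> exp (real (d * (2 * k))) * (real (4 * k)) ^ (d * (2 * k))"
        by (intro mult_right_mono) auto
      then show ?thesis by (simp only: mult_ac)
    qed
    also have "\<dots> = ((4 * exp 1 * real k) ^ d) ^ (2 * k)"
    proof -
      have "exp (real (d * (2 * k))) = exp 1 ^ (d * (2 * k))"
        by (metis exp_of_nat_mult mult.right_neutral)
      then show ?thesis by (simp add: power_mult[symmetric] power_mult_distrib)
    qed
    finally have "avg (Al n) (\<lambda>\<tau>. f \<tau> * Z (\<tau> \<circ> \<iota>)) ^ (2 * k) \<le> ((4 * exp 1 * real k) ^ d) ^ (2 * k)"
      by (simp add: power_mult[symmetric] mult.commute)
    then show ?thesis using k by (subst (asm) power_mono_iff) (auto simp: fZ0)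
  qed
  have fB: "avg (Al n) (\<lambda>\<tau>. f \<tau> * B (\<tau> \<circ> \<iota>)) \<le> r ^ (2 * d) * 4 ^ d * (\<Sum>S\<in>\<S>. sqnorm (Sy n) (w S))"
  proof -
    have "avg (Al n) (\<lambda>\<tau>. f \<tau> * B (\<tau> \<circ> \<iota>)) = (\<Sum>S\<in>\<S>. avg (Al n) (\<lambda>\<tau>. f \<tau> * (o' S (\<tau> \<circ> \<iota>))\<^sup>2))"
      by (simp add: B_def sum_distrib_left avg_sum)
    also have "\<dots> \<le> (\<Sum>S\<in>\<S>. r ^ (2 * d) * (4 ^ d * sqnorm (Sy n) (w S)))"
    proof (rule sum_mono)
      fix S assume S: "S \<in> \<S>"
      let ?T = "\<iota> ` (S \<union> (\<lambda>s. s + N) ` S)"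
      have SN: "S \<subseteq> {1..N}" "card S = d" using \<S>[OF S] by auto
      have finS: "finite S" using SN finite_subset by blast
      have p: "\<iota> permutes {1..n}" using \<iota> by (simp add: Sy_def)
      have sub: "S \<union> (\<lambda>s. s + N) ` S \<subseteq> {1..n}" using SN n(2) by force
      have T: "?T \<subseteq> {1..n}" using sub permutes_in_image[OF p] by blast
      have "S \<inter> (\<lambda>s. s + N) ` S = {}"
      proof -
        have "x \<notin> {1..N}" if "x \<in> (\<lambda>s. s + N) ` S" for x using that SN by auto
        then show ?thesis using SN by blast
      qed
      then have card: "card (S \<union> (\<lambda>s. s + N) ` S) = 2 * d"
        using finS SN by (subst card_Un_disjoint) (auto simp: card_image)
      then have cT: "card ?T = 2 * d"
        using card_image[OF inj_on_subset[OF permutes_inj[OF p] subset_UNIV]] by simp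
      have dep': "depends_on (S \<union> (\<lambda>s. s + N) ` S) (o' S)"
        unfolding o'_def by (rule depends_on_oddpart[OF SN(1) w[OF S]])
      then have "depends_on ?T (\<lambda>x. o' S (x \<circ> \<iota>))" by (rule depends_on_comp)
      then have dep: "depends_on ?T (\<lambda>x. (o' S (x \<circ> \<iota>))\<^sup>2)" by (rule depends_on_power)
      have "avg (Al n) (\<lambda>\<tau>. f \<tau> * (o' S (\<tau> \<circ> \<iota>))\<^sup>2) \<le> r ^ (2 * d) * avg (Al n) (\<lambda>x. (o' S (x \<circ> \<iota>))\<^sup>2)"
        by (rule global_atD[OF glob T cT dep]) simp
      also have "avg (Al n) (\<lambda>x. (o' S (x \<circ> \<iota>))\<^sup>2) = sqnorm (Sy n) (o' S)"
        using dep' sub card n by (intro avg_Al_comp_eq_avg_Sy[OF depends_on_power _ _ \<iota>]) auto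
      also have "r ^ (2 * d) * \<dots> \<le> r ^ (2 * d) * (4 ^ d * sqnorm (Sy n) (w S))"
        using avg_oddpart_square_le[OF SN(1) n(2), of "w S"] SN unfolding o'_def
        by (intro mult_left_mono) (auto simp: power_mult)
      finally show "avg (Al n) (\<lambda>\<tau>. f \<tau> * (o' S (\<tau> \<circ> \<iota>))\<^sup>2) \<le> r ^ (2 * d) * (4 ^ d * sqnorm (Sy n) (w S))" .
    qed
    finally show ?thesis by (simp add: sum_distrib_left mult.assoc)
  qed
  \<comment> \<open>Cauchy-Schwarz will separate sqrt (f * B), which globalness controls, from sqrt
    (f * Z), which the moments control; \<open>sgn\<close> restores the sign of G.\<close>
  have "(avg (Al n) (\<lambda>\<tau>. f \<tau> * G (\<tau> \<circ> \<iota>)))\<^sup>2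
     = (avg (Al n) (\<lambda>\<tau>. sqrt (f \<tau> * B (\<tau> \<circ> \<iota>)) * (sqrt (f \<tau> * Z (\<tau> \<circ> \<iota>)) * sgn (G (\<tau> \<circ> \<iota>)))))\<^sup>2"
  proof (intro arg_cong[where f = "\<lambda>t. t\<^sup>2"] avg_cong)
    fix \<tau> assume "\<tau> \<in> Al n"
    then have f0: "0 \<le> f \<tau>" by (rule f)
    have "sqrt (f \<tau> * B (\<tau> \<circ> \<iota>)) * sqrt (f \<tau> * Z (\<tau> \<circ> \<iota>)) = sqrt ((f \<tau>)\<^sup>2 * (G (\<tau> \<circ> \<iota>))\<^sup>2)"
      unfolding GZ real_sqrt_mult[symmetric] by (simp add: power2_eq_square mult_ac)
    also have "\<dots> = f \<tau> * \<bar>G (\<tau> \<circ> \<iota>)\<bar>" using f0 by (simp add: real_sqrt_mult)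
    finally show "f \<tau> * G (\<tau> \<circ> \<iota>) = sqrt (f \<tau> * B (\<tau> \<circ> \<iota>)) * (sqrt (f \<tau> * Z (\<tau> \<circ> \<iota>)) * sgn (G (\<tau> \<circ> \<iota>)))"
     
      by (simp add: mult.assoc[symmetric] abs_mult_sgn)
  qed
  also have "\<dots> \<le> avg (Al n) (\<lambda>\<tau>. (sqrt (f \<tau> * B (\<tau> \<circ> \<iota>)))\<^sup>2) * avg (Al n) (\<lambda>\<tau>. (sqrt (f \<tau> * Z (\<tau> \<circ> \<iota>)) * sgn (G (\<tau> \<circ> \<iota>)))\<^sup>2)"
    by (rule avg_Cauchy_Schwarz)
  also have "\<dots> \<le> avg (Al n) (\<lambda>\<tau>. f \<tau> * B (\<tau> \<circ> \<iota>)) * avg (Al n) (\<lambda>\<tau>. f \<tau> * Z (\<tau> \<circ> \<iota>))"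
  proof (intro mult_mono avg_mono)
    fix \<tau> assume "\<tau> \<in> Al n"
    then have "0 \<le> f \<tau> * B (\<tau> \<circ> \<iota>)" "0 \<le> f \<tau> * Z (\<tau> \<circ> \<iota>)" using f(1) B0 Z0 by auto
    then show "(sqrt (f \<tau> * B (\<tau> \<circ> \<iota>)))\<^sup>2 \<le> f \<tau> * B (\<tau> \<circ> \<iota>)"
      "(sqrt (f \<tau> * Z (\<tau> \<circ> \<iota>)) * sgn (G (\<tau> \<circ> \<iota>)))\<^sup>2 \<le> f \<tau> * Z (\<tau> \<circ> \<iota>)"
      by (auto simp: power_mult_distrib sgn_if)
  qed (use f(1) B0 Z0 in \<open>auto intro!: avg_nonneg\<close>)
  also have "\<dots> \<le> (r ^ (2 * d) * 4 ^ d * (\<Sum>S\<in>\<S>. sqnorm (Sy n) (w S))) * (4 * exp 1 * real k) ^ d"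
    using fB fZ fZ0 by (intro mult_mono) (auto intro!: sum_nonneg mult_nonneg_nonneg avg_nonneg simp: power_mult)
  finally show ?thesis unfolding G_def o'_def by (simp only: mult_ac)
qed

section \<open>The operator of a density on pure functions\<close>

definition Kop :: "nat \<Rightarrow> ((nat \<Rightarrow> nat) \<Rightarrow> real) \<Rightarrow> ((nat \<Rightarrow> nat) \<Rightarrow> real) \<Rightarrow> (nat \<Rightarrow> nat) \<Rightarrow> real" where
  "Kop n f e \<iota> = avg (Al n) (\<lambda>\<tau>. f \<tau> * e (\<tau> \<circ> \<iota>))"

lemma depends_on_Kop: "depends_on T e \<Longrightarrow> depends_on T (Kop n f e)"
  unfolding depends_on_def Kop_def by (auto intro!: avg_cong)

text \<open>Purity concerns right multiplication by transpositions, which commutes with the left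
  multiplications averaged by \<open>Kop\<close>.\<close>

lemma pure_Kop:
  assumes "pure n d u"
  shows "pure n d (Kop n f u)"
  unfolding pure_def
proof (intro conjI ballI)
  show "depends_on {1..d} (Kop n f u)" using assms by (intro depends_on_Kop) (simp add: pure_def)
  fix \<rho> s assume \<rho>: "\<rho> \<in> Sy n" and s: "s \<in> {1..d}"
  have "Kop n f u \<rho> + (\<Sum>i\<in>{d+1..n}. Kop n f u (\<rho> \<circ> tp s i))
     = avg (Al n) (\<lambda>\<tau>. f \<tau> * (u (\<tau> \<circ> \<rho>) + (\<Sum>i\<in>{d+1..n}. u (\<tau> \<circ> \<rho> \<circ> tp s i))))"
    by (simp add: Kop_def distrib_left avg_add sum_distrib_left avg_sum comp_assoc)
  also have "\<dots> = avg (Al n) (\<lambda>\<tau>. 0)"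
  proof (rule avg_cong)
    fix \<tau> assume "\<tau> \<in> Al n"
    then have "\<tau> \<circ> \<rho> \<in> Sy n" by (rule Sy_comp[OF Al_Sy \<rho>])
    then have "u (\<tau> \<circ> \<rho>) + (\<Sum>i\<in>{d+1..n}. u (\<tau> \<circ> \<rho> \<circ> tp s i)) = 0"
      using assms s unfolding pure_def by blast
    then show "f \<tau> * (u (\<tau> \<circ> \<rho>) + (\<Sum>i\<in>{d+1..n}. u (\<tau> \<circ> \<rho> \<circ> tp s i))) = 0" by simp
  qed
  finally show "Kop n f u \<rho> + (\<Sum>i\<in>{d+1..n}. Kop n f u (\<rho> \<circ> tp s i)) = 0"
    by (simp add: avg_const)
qed

lemma fsubspace_pure: "fsubspace {u. pure n d u}"
  unfolding fsubspace_def
proof (intro conjI ballI allI)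
  show "(\<lambda>_. 0) \<in> {u. pure n d u}" by (simp add: pure_def depends_on_def)
  fix f g a b assume fg: "f \<in> {u. pure n d u}" "g \<in> {u. pure n d u}"
  have dep: "depends_on {1..d} (\<lambda>x. a * f x + b * g x)"
    using fg unfolding mem_Collect_eq pure_def depends_on_def by metis
  have "a * f \<rho> + b * g \<rho> + (\<Sum>i\<in>{d+1..n}. a * f (\<rho> \<circ> tp s i) + b * g (\<rho> \<circ> tp s i)) = 0"
    if "\<rho> \<in> Sy n" "s \<in> {1..d}" for \<rho> s
  proof -
    have "f \<rho> + (\<Sum>i\<in>{d+1..n}. f (\<rho> \<circ> tp s i)) = 0" "g \<rho> + (\<Sum>i\<in>{d+1..n}. g (\<rho> \<circ> tp s i)) = 0"
      using fg that unfolding pure_def by blast+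
    then have "a * (f \<rho> + (\<Sum>i\<in>{d+1..n}. f (\<rho> \<circ> tp s i))) + b * (g \<rho> + (\<Sum>i\<in>{d+1..n}. g (\<rho> \<circ> tp s i))) = 0"
      by simp
    then show ?thesis by (simp add: algebra_simps sum.distrib sum_distrib_left)
  qed
  then show "(\<lambda>x. a * f x + b * g x) \<in> {u. pure n d u}" using dep by (simp add: pure_def)
qed

section \<open>Relabelling of positions\<close>

lemma ex_permutation_image:
  assumes "S \<subseteq> {1..N}" "card S = d"
  obtains p where "p permutes {1..N}" "p ` {1..d} = S"
proof -
  have finS: "finite S" using assms finite_subset by blast
  have dN: "d \<le> N" using card_mono[OF _ assms(1)] assms(2) by simp
  have "\<exists>f. bij_betw f {1..d} S"
    using assms finS by (intro finite_same_card_bij) auto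
  then obtain f where f: "bij_betw f {1..d} S" ..
  have "card ({1..N} - {1..d}) = card ({1..N} - S)"
    using assms finS dN by (simp add: card_Diff_subset)
  then have "\<exists>g. bij_betw g ({1..N} - {1..d}) ({1..N} - S)"
    by (intro finite_same_card_bij) auto
  then obtain g where g: "bij_betw g ({1..N} - {1..d}) ({1..N} - S)" ..
  define p where "p = (\<lambda>x. if x \<in> {1..d} then f x else if x \<in> {1..N} - {1..d} then g x else x)"
  have "bij_betw p {1..d} S = bij_betw f {1..d} S"
    by (rule bij_betw_cong) (simp add: p_def)
  then have 1: "bij_betw p {1..d} S" using f by simp
  have "bij_betw p ({1..N} - {1..d}) ({1..N} - S) = bij_betw g ({1..N} - {1..d}) ({1..N} - S)"
    by (rule bij_betw_cong) (auto simp: p_def)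
  then have 2: "bij_betw p ({1..N} - {1..d}) ({1..N} - S)" using g by simp
  have "bij_betw p ({1..d} \<union> ({1..N} - {1..d})) (S \<union> ({1..N} - S))"
    by (rule bij_betw_combine[OF 1 2]) auto
  moreover have "{1..d} \<union> ({1..N} - {1..d}) = {1..N}" "S \<union> ({1..N} - S) = {1..N}"
    using dN assms(1) by auto
  ultimately have "bij_betw p {1..N} {1..N}" by simp
  then have "p permutes {1..N}" by (rule bij_imp_permutes) (use dN in \<open>auto simp: p_def\<close>)
  moreover have "p ` {1..d} = S" using 1 by (rule bij_betw_imp_surj_on)
  ultimately show ?thesis by (rule that)
qed

text \<open>The same permutation on both halves {1..N} and {N+1..2*N}. It can carry {1..d} to any S
  of the same size while respecting the pairing of y with y + N, so it conjugates swaps to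
  swaps.\<close>

definition dbl :: "nat \<Rightarrow> (nat \<Rightarrow> nat) \<Rightarrow> nat \<Rightarrow> nat" where
  "dbl N p x = (if x \<in> {1..N} then p x else if x \<in> {N+1..2*N} then p (x - N) + N else x)"

lemma dbl_low: "x \<in> {1..N} \<Longrightarrow> dbl N p x = p x"
  by (simp add: dbl_def)

lemma dbl_high: "x \<in> {1..N} \<Longrightarrow> dbl N p (x + N) = p x + N"
  by (auto simp: dbl_def)

lemma dbl_other: "x \<notin> {1..2 * N} \<Longrightarrow> dbl N p x = x"
  by (auto simp: dbl_def)

lemma dbl_comp:
  assumes "q permutes {1..N}"
  shows "dbl N p \<circ> dbl N q = dbl N (p \<circ> q)"
proof
  fix x
  have q: "q x \<in> {1..N}" if "x \<in> {1..N}" for x using assms that permutes_in_image by metis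
  show "(dbl N p \<circ> dbl N q) x = dbl N (p \<circ> q) x"
    by (rule nat_low_high_cases[of x N]) (simp_all add: dbl_low dbl_high dbl_other q del: atLeastAtMost_iff One_nat_def)
qed

lemma dbl_in_Sy:
  assumes p: "p permutes {1..N}" and N: "2 * N \<le> n"
  shows "dbl N p \<in> Sy n"
proof -
  have id: "dbl N id = id" by (auto simp: dbl_def)
  have "dbl N p \<circ> dbl N (inv' p) = id" "dbl N (inv' p) \<circ> dbl N p = id"
    using dbl_comp[OF permutes_inv[OF p], of p] dbl_comp[OF p, of "inv' p"] permutes_inv_o[OF p] id by auto
  then have b: "bij (dbl N p)" by (intro o_bij)
  have "dbl N p x = x" if "x \<notin> {1..n}" for x
    using that N by (intro dbl_other) auto
  then show ?thesis using b by (simp add: Sy_def permutes_def bij_iff)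
qed

lemma dbl_sw:
  assumes p: "p permutes {1..N}" and Y: "Y \<subseteq> {1..N}"
  shows "dbl N p \<circ> sw N Y = sw N (p ` Y) \<circ> dbl N p"
proof
  fix x
  have pY: "p ` Y \<subseteq> {1..N}" using p Y permutes_in_image by fastforce
  have pin: "p x \<in> {1..N}" if "x \<in> {1..N}" for x using p that permutes_in_image by metis
  have pmem: "p x \<in> p ` Y \<longleftrightarrow> x \<in> Y" for x using permutes_inj[OF p] by (auto dest: injD)
  show "(dbl N p \<circ> sw N Y) x = (sw N (p ` Y) \<circ> dbl N p) x"
    by (rule nat_low_high_cases[of x N])
      (simp_all add: dbl_low dbl_high dbl_other sw_low[OF _ Y] sw_low[OF _ pY] sw_high[OF _ Y] sw_high[OF _ pY]
         sw_other[OF _ Y] sw_other[OF _ pY] pin pmem del: atLeastAtMost_iff One_nat_def)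
qed

text \<open>
  The Hilbert-Schmidt norm \<open>X\<close> of \<open>Kop n f\<close> on pure functions is bounded by duality: pairing \<open>f\<close> with the odd
  parts of \<open>\<Sum>i<K. w i \<iota> * e i\<close>, where \<open>w i = Kop n f (e i)\<close>, gives back a multiple of \<open>X\<close>, while the mean square of
  this family is \<open>X\<close> as well.
\<close>

lemma level_weight_bound:
  fixes L r :: real
  assumes f: "\<And>\<sigma>. \<sigma> \<in> Al n \<Longrightarrow> 0 \<le> f \<sigma>" "avg (Al n) f = 1" "sqnorm (Al n) f \<le> exp (2 * L)"
    and glob: "global_at n (2 * d) r f"
    and n: "2 * d + 2 \<le> n" "2 * N \<le> n" "d \<le> N" "6 * d \<le> n"
    and k: "0 < k" "L + 1 \<le> real k * real d"
    and e: "orthonormal (Sy n) K e" "\<And>i. i < K \<Longrightarrow> pure n d (e i)"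
  shows "(\<Sum>i<K. sqnorm (Sy n) (Kop n f (e i)))
     \<le> 4 * ((4 * exp 1 * real k) ^ d * r ^ (2 * d) * 4 ^ d) / real (N choose d)"
proof -
  define w where "w = (\<lambda>i. Kop n f (e i))"
  define X where "X = (\<Sum>i<K. sqnorm (Sy n) (w i))"
  define C where "C = (4 * exp 1 * real k) ^ d * r ^ (2 * d) * 4 ^ d"
  define \<S> where "\<S> = {S. S \<subseteq> {1..N} \<and> card S = d}"
  have fin\<S>: "finite \<S>" unfolding \<S>_def by (rule finite_subset[of _ "Pow {1..N}"]) auto
  have card\<S>: "card \<S> = N choose d" unfolding \<S>_def by (subst n_subsets) auto
  have c0: "0 < real (N choose d)" using n(3) by simp
  have X0: "0 \<le> X" unfolding X_def by (intro sum_nonneg avg_nonneg) auto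
  define p where "p = (\<lambda>S. SOME q. q permutes {1..N} \<and> q ` {1..d} = S)"
  have p: "p S permutes {1..N}" "p S ` {1..d} = S" if "S \<in> \<S>" for S
  proof -
    have "S \<subseteq> {1..N}" "card S = d" using that by (auto simp: \<S>_def)
    then obtain q where q: "q permutes {1..N}" "q ` {1..d} = S" by (rule ex_permutation_image)
    have "p S permutes {1..N} \<and> p S ` {1..d} = S"
      unfolding p_def by (rule someI[where x = q]) (use q in blast)
    then show "p S permutes {1..N}" "p S ` {1..d} = S" by auto
  qed
  define \<pi> where "\<pi> = (\<lambda>S. dbl N (p S))"
  have \<pi>: "\<pi> S \<in> Sy n" if "S \<in> \<S>" for S unfolding \<pi>_def using p that n by (intro dbl_in_Sy) auto
  \<comment> \<open>For fixed \<iota>, the combination of the e i with the values of the w i as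
    coefficients, relabelled so that it reads the positions in S instead of 1, ..., d.\<close>
  define W where "W = (\<lambda>\<iota> S x. \<Sum>i<K. w i (\<iota> \<circ> \<pi> S) * e i (x \<circ> \<pi> S))"
  have depW: "depends_on S (W \<iota> S)" if S: "S \<in> \<S>" for \<iota> S
  proof -
    have "\<pi> S ` {1..d} = p S ` {1..d}" unfolding \<pi>_def using n(3) by (intro image_cong) (auto simp: dbl_def)
    then have im: "\<pi> S ` {1..d} = S" using p(2)[OF S] by simp
    have "depends_on S (\<lambda>x. e i (x \<circ> \<pi> S))" if "i < K" for i
      using depends_on_comp[of "{1..d}" "e i" "\<pi> S"] e(2)[OF that] im by (simp add: pure_def)
    then show ?thesis unfolding depends_on_def W_def by (auto intro!: sum.cong)
  qed
  have lower: "X / 2 \<le> avg (Sy n) (\<lambda>\<iota>. avg (Al n) (\<lambda>\<tau>. f \<tau> * oddpart N S (W \<iota> S) (\<tau> \<circ> \<iota>)))" if S: "S \<in> \<S>" for S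
  proof -
    have bij: "bij_betw ((`) (p S)) (Pow {1..d}) (Pow S)"
    proof -
      have "bij_betw (p S) {1..d} S"
        using p[OF S] permutes_inj_on by (auto simp: bij_betw_def)
      then show ?thesis by (rule bij_betw_Pow)
    qed
    have "X / 2 = (\<Sum>i<K. sqnorm (Sy n) (w i) / 2)"
      by (simp add: X_def sum_divide_distrib)
    also have "\<dots> \<le> (\<Sum>i<K. \<Sum>Y\<in>Pow {1..d}. (-1) ^ card Y * avg (Sy n) (\<lambda>\<iota>. w i \<iota> * w i (\<iota> \<circ> sw N Y)))"
      using e(2) n by (intro sum_mono pure_alternating_sum_ge) (auto simp: w_def intro!: pure_Kop)
    also have "\<dots> = (\<Sum>i<K. \<Sum>Y\<in>Pow {1..d}. (-1) ^ card (p S ` Y) * avg (Sy n) (\<lambda>\<iota>. w i (\<iota> \<circ> \<pi> S) *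
          avg (Al n) (\<lambda>\<tau>. f \<tau> * e i (\<tau> \<circ> \<iota> \<circ> sw N (p S ` Y) \<circ> \<pi> S))))"
    proof (intro sum.cong refl arg_cong2[where f = "(*)"])
      fix i Y assume Y: "Y \<in> Pow {1..d}"
      have "inj_on (p S) Y" using p(1)[OF S] permutes_inj_on by blast
      then show "(-1::real) ^ card Y = (-1) ^ card (p S ` Y)" by (simp add: card_image)
      have "Y \<subseteq> {1..N}" using Y n(3) by auto
      then have sw: "\<pi> S \<circ> sw N Y = sw N (p S ` Y) \<circ> \<pi> S"
        unfolding \<pi>_def by (rule dbl_sw[OF p(1)[OF S]])
      have "avg (Sy n) (\<lambda>\<iota>. w i \<iota> * w i (\<iota> \<circ> sw N Y)) = avg (Sy n) (\<lambda>\<iota>. w i (\<iota> \<circ> \<pi> S) * w i (\<iota> \<circ> \<pi> S \<circ> sw N Y))"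
        using avg_Sy_right[OF \<pi>[OF S], of "\<lambda>\<iota>. w i \<iota> * w i (\<iota> \<circ> sw N Y)"] by simp
      also have "\<dots> = avg (Sy n) (\<lambda>\<iota>. w i (\<iota> \<circ> \<pi> S) * avg (Al n) (\<lambda>\<tau>. f \<tau> * e i (\<tau> \<circ> \<iota> \<circ> sw N (p S ` Y) \<circ> \<pi> S)))"
        unfolding comp_assoc sw by (simp add: w_def Kop_def comp_assoc)
      finally show "avg (Sy n) (\<lambda>\<iota>. w i \<iota> * w i (\<iota> \<circ> sw N Y)) = avg (Sy n) (\<lambda>\<iota>. w i (\<iota> \<circ> \<pi> S) *
          avg (Al n) (\<lambda>\<tau>. f \<tau> * e i (\<tau> \<circ> \<iota> \<circ> sw N (p S ` Y) \<circ> \<pi> S)))" .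
    qed
    also have "\<dots> = (\<Sum>i<K. \<Sum>Y\<in>Pow S. (-1) ^ card Y * avg (Sy n) (\<lambda>\<iota>. w i (\<iota> \<circ> \<pi> S) *
          avg (Al n) (\<lambda>\<tau>. f \<tau> * e i (\<tau> \<circ> \<iota> \<circ> sw N Y \<circ> \<pi> S))))"
      by (intro sum.cong refl sum.reindex_bij_betw[OF bij])
    also have "\<dots> = avg (Sy n) (\<lambda>\<iota>. avg (Al n) (\<lambda>\<tau>. f \<tau> * oddpart N S (W \<iota> S) (\<tau> \<circ> \<iota>)))"
    proof -
      have "avg (Al n) (\<lambda>\<tau>. f \<tau> * oddpart N S (W \<iota> S) (\<tau> \<circ> \<iota>))
         = (\<Sum>i<K. \<Sum>Y\<in>Pow S. (-1) ^ card Y * (w i (\<iota> \<circ> \<pi> S) * avg (Al n) (\<lambda>\<tau>. f \<tau> * e i (\<tau> \<circ> \<iota> \<circ> sw N Y \<circ> \<pi> S))))" for \<iota>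
      proof -
        have "f \<tau> * oddpart N S (W \<iota> S) (\<tau> \<circ> \<iota>)
          = (\<Sum>i<K. \<Sum>Y\<in>Pow S. (-1) ^ card Y * (w i (\<iota> \<circ> \<pi> S) * (f \<tau> * e i (\<tau> \<circ> \<iota> \<circ> sw N Y \<circ> \<pi> S))))" for \<tau>
          unfolding oddpart_def W_def sum_distrib_left by (subst sum.swap) (simp only: mult_ac)
        then show ?thesis by (simp only: avg_sum avg_cmult)
      qed
      then show ?thesis by (simp only: avg_sum avg_cmult)
    qed
    finally show ?thesis .
  qed
  have normW: "sqnorm (Sy n) (W \<iota> S) = (\<Sum>i<K. (w i (\<iota> \<circ> \<pi> S))\<^sup>2)" if S: "S \<in> \<S>" for \<iota> S
  proof -
    have "sqnorm (Sy n) (W \<iota> S) = avg (Sy n) (\<lambda>x. (\<Sum>i<K. w i (\<iota> \<circ> \<pi> S) * e i x)\<^sup>2)"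
      unfolding W_def by (rule avg_Sy_right[OF \<pi>[OF S]])
    also have "\<dots> = (\<Sum>i<K. (w i (\<iota> \<circ> \<pi> S))\<^sup>2)"
      using orthonormal_Parseval[OF e(1), of "\<lambda>i. w i (\<iota> \<circ> \<pi> S)" "\<lambda>i. w i (\<iota> \<circ> \<pi> S)"]
      unfolding ip_self[symmetric] by (simp add: power2_eq_square)
    finally show ?thesis .
  qed
  let ?F = "\<lambda>\<iota>. avg (Al n) (\<lambda>\<tau>. f \<tau> * (\<Sum>S\<in>\<S>. oddpart N S (W \<iota> S) (\<tau> \<circ> \<iota>)))"
  have "real (card \<S>) * (X / 2) = (\<Sum>S\<in>\<S>. X / 2)" by simp
  also have "\<dots> \<le> (\<Sum>S\<in>\<S>. avg (Sy n) (\<lambda>\<iota>. avg (Al n) (\<lambda>\<tau>. f \<tau> * oddpart N S (W \<iota> S) (\<tau> \<circ> \<iota>))))"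
    by (rule sum_mono[OF lower])
  also have "\<dots> = avg (Sy n) ?F"
    by (simp add: avg_sum sum_distrib_left)
  finally have le: "real (card \<S>) * (X / 2) \<le> avg (Sy n) ?F" .
  \<comment> \<open>All position sets S are paired with f at once. The left side is quadratic in
    card \<S>, the chaos bound only linear; the quotient is the gain 1 / (N choose d).\<close>
  have "(real (card \<S>) * (X / 2))\<^sup>2 \<le> (avg (Sy n) ?F)\<^sup>2"
    using le X0 by (intro power_mono) auto
  also have "\<dots> \<le> sqnorm (Sy n) (?F)" by (rule avg_square_le) auto
  also have "\<dots> \<le> avg (Sy n) (\<lambda>\<iota>. C * (\<Sum>S\<in>\<S>. sqnorm (Sy n) (W \<iota> S)))"
    unfolding C_def
    by (intro avg_mono odd_chaos_bound[OF f glob n(1,2) _ depW k]) (auto simp: \<S>_def)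
  also have "\<dots> = C * (\<Sum>S\<in>\<S>. \<Sum>i<K. avg (Sy n) (\<lambda>\<iota>. (w i (\<iota> \<circ> \<pi> S))\<^sup>2))"
    using normW by (simp add: avg_cmult avg_sum)
  also have "\<dots> = C * (\<Sum>S\<in>\<S>. X)"
  proof -
    have "(\<Sum>i<K. avg (Sy n) (\<lambda>\<iota>. (w i (\<iota> \<circ> \<pi> S))\<^sup>2)) = X" if "S \<in> \<S>" for S
      unfolding X_def using avg_Sy_right[OF \<pi>[OF that], of "\<lambda>\<iota>. (w _ \<iota>)\<^sup>2"] by (intro sum.cong) auto
    then show ?thesis by simp
  qed
  finally have "(real (card \<S>) * (X / 2))\<^sup>2 \<le> C * (real (card \<S>) * X)" by simp
  then have "X * (real (card \<S>) * real (card \<S>) * X) \<le> X * (4 * C * real (card \<S>))"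
    by (simp add: power2_eq_square field_simps)
  then have "X \<le> 4 * C / real (card \<S>)"
  proof (cases "X = 0")
    case True
    have "0 \<le> C" unfolding C_def by (simp add: power_mult)
    then show ?thesis using True by simp
  next
    case False
    then have "real (card \<S>) * real (card \<S>) * X \<le> 4 * C * real (card \<S>)"
      using \<open>X * _ \<le> X * _\<close> X0 by simp
    then have "real (card \<S>) * (real (card \<S>) * X) \<le> real (card \<S>) * (4 * C)" by (simp only: mult_ac)
    then have "real (card \<S>) * X \<le> 4 * C" using c0 unfolding card\<S> by (simp only: mult_le_cancel_left_pos)
    then show ?thesis using c0 unfolding card\<S> by (simp add: pos_le_divide_eq mult.commute)
  qed
  then show ?thesis unfolding X_def C_def w_def card\<S> .
qed

section \<open>Functions orthogonal to all functions of few points\<close>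

lemma conv_eq:
  assumes "\<sigma> \<in> Al n"
  shows "conv n f g \<sigma> = avg (Al n) (\<lambda>\<tau>. f \<tau> * g (inv' \<tau> \<circ> \<sigma>))"
  unfolding conv_def by (intro avg_cong) (simp add: alt_group_inv_equality alt_group_mult)

lemma avg_Al_comp_inverse:
  assumes "\<sigma> \<in> Al n"
  shows "avg (Al n) (\<lambda>\<tau>. \<phi> (inv' \<tau> \<circ> \<sigma>)) = avg (Al n) \<phi>"
  using avg_inverse[of "Al n" n "\<lambda>\<tau>. \<phi> (\<tau> \<circ> \<sigma>)"] avg_Al_right[OF assms, of \<phi>] by simp

lemma avg_conv_mult:
  "avg (Al n) (\<lambda>\<sigma>. conv n f g \<sigma> * \<psi> \<sigma>) = avg (Al n) (\<lambda>\<tau>. f \<tau> * avg (Al n) (\<lambda>\<sigma>. g \<sigma> * \<psi> (\<tau> \<circ> \<sigma>)))"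
proof -
  have "avg (Al n) (\<lambda>\<sigma>. conv n f g \<sigma> * \<psi> \<sigma>) = avg (Al n) (\<lambda>\<sigma>. avg (Al n) (\<lambda>\<tau>. f \<tau> * (g (inv' \<tau> \<circ> \<sigma>) * \<psi> \<sigma>)))"
    by (intro avg_cong) (simp add: conv_eq mult.assoc flip: avg_cmult_right)
  also have "\<dots> = avg (Al n) (\<lambda>\<tau>. avg (Al n) (\<lambda>\<sigma>. f \<tau> * (g (inv' \<tau> \<circ> \<sigma>) * \<psi> \<sigma>)))"
    by (rule avg_swap)
  also have "\<dots> = avg (Al n) (\<lambda>\<tau>. f \<tau> * avg (Al n) (\<lambda>\<sigma>. g \<sigma> * \<psi> (\<tau> \<circ> \<sigma>)))"
  proof (rule avg_cong)
    fix \<tau> assume \<tau>: "\<tau> \<in> Al n"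
    have "avg (Al n) (\<lambda>\<sigma>. g (inv' \<tau> \<circ> \<sigma>) * \<psi> \<sigma>) = avg (Al n) (\<lambda>\<sigma>. g \<sigma> * \<psi> (\<tau> \<circ> \<sigma>))"
      using avg_Al_left[OF Al_inv[OF \<tau>], of "\<lambda>\<sigma>. g \<sigma> * \<psi> (\<tau> \<circ> \<sigma>)"]
      by (simp only: Sy_inv_comp_assoc[OF Al_Sy[OF \<tau>]])
    then show "avg (Al n) (\<lambda>\<sigma>. f \<tau> * (g (inv' \<tau> \<circ> \<sigma>) * \<psi> \<sigma>)) = f \<tau> * avg (Al n) (\<lambda>\<sigma>. g \<sigma> * \<psi> (\<tau> \<circ> \<sigma>))"
      by (simp add: avg_cmult)
  qed
  finally show ?thesis .
qed

text \<open>\<iota> places the points 1, ..., D at arbitrary positions, so this is the orthogonal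
  complement of the functions of D positions.\<close>

definition high :: "nat \<Rightarrow> nat \<Rightarrow> ((nat \<Rightarrow> nat) \<Rightarrow> real) set" where
  "high n D = {g. \<forall>\<iota>\<in>Sy n. \<forall>\<phi>. depends_on {1..D} \<phi> \<longrightarrow> avg (Al n) (\<lambda>\<sigma>. g \<sigma> * \<phi> (\<sigma> \<circ> \<iota>)) = 0}"

lemma highD: "g \<in> high n D \<Longrightarrow> \<iota> \<in> Sy n \<Longrightarrow> depends_on {1..D} \<phi> \<Longrightarrow> avg (Al n) (\<lambda>\<sigma>. g \<sigma> * \<phi> (\<sigma> \<circ> \<iota>)) = 0"
  by (simp add: high_def)

lemma fsubspace_high: "fsubspace (high n D)"
  unfolding fsubspace_def
proof (intro conjI ballI allI)
  show "(\<lambda>_. 0) \<in> high n D" by (simp add: high_def avg_const)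
  fix f g a b assume fg: "f \<in> high n D" "g \<in> high n D"
  show "(\<lambda>x. a * f x + b * g x) \<in> high n D"
    unfolding high_def
  proof (intro CollectI ballI allI impI)
    fix \<iota> \<phi> assume "\<iota> \<in> Sy n" "depends_on {1..D} \<phi>"
    then have "avg (Al n) (\<lambda>\<sigma>. f \<sigma> * \<phi> (\<sigma> \<circ> \<iota>)) = 0" "avg (Al n) (\<lambda>\<sigma>. g \<sigma> * \<phi> (\<sigma> \<circ> \<iota>)) = 0"
      using fg by (auto intro: highD)
    then show "avg (Al n) (\<lambda>\<sigma>. (a * f \<sigma> + b * g \<sigma>) * \<phi> (\<sigma> \<circ> \<iota>)) = 0"
      by (simp add: distrib_right mult.assoc avg_add avg_cmult)
  qed
qed

lemma high_right_translate:
  assumes "g \<in> high n D" "a \<in> Al n"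
  shows "(\<lambda>\<sigma>. g (\<sigma> \<circ> a)) \<in> high n D"
  unfolding high_def
proof (intro CollectI ballI allI impI)
  fix \<iota> \<phi> assume \<iota>: "\<iota> \<in> Sy n" and \<phi>: "depends_on {1..D} \<phi>"
  have "avg (Al n) (\<lambda>\<sigma>. g (\<sigma> \<circ> a) * \<phi> (\<sigma> \<circ> \<iota>)) = avg (Al n) (\<lambda>\<sigma>. g (\<sigma> \<circ> a) * \<phi> (\<sigma> \<circ> a \<circ> (inv' a \<circ> \<iota>)))"
    by (simp only: comp_assoc Sy_inv_comp_assoc[OF Al_Sy[OF assms(2)]])
  also have "\<dots> = avg (Al n) (\<lambda>\<sigma>. g \<sigma> * \<phi> (\<sigma> \<circ> (inv' a \<circ> \<iota>)))"
    using avg_Al_right[OF assms(2), of "\<lambda>\<sigma>. g \<sigma> * \<phi> (\<sigma> \<circ> (inv' a \<circ> \<iota>))"] by simp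
  also have "\<dots> = 0"
    by (rule highD[OF assms(1) Sy_comp[OF Sy_inv[OF Al_Sy[OF assms(2)]] \<iota>] \<phi>])
  finally show "avg (Al n) (\<lambda>\<sigma>. g (\<sigma> \<circ> a) * \<phi> (\<sigma> \<circ> \<iota>)) = 0" .
qed

lemma high_conv:
  assumes "g \<in> high n D"
  shows "conv n f g \<in> high n D"
  unfolding high_def
proof (intro CollectI ballI allI impI)
  fix \<iota> \<phi> assume \<iota>: "\<iota> \<in> Sy n" and \<phi>: "depends_on {1..D} \<phi>"
  have "depends_on {1..D} (\<lambda>x. \<phi> (\<tau> \<circ> x))" for \<tau>
    using \<phi> by (auto simp: depends_on_def)
  then have "avg (Al n) (\<lambda>\<sigma>. g \<sigma> * \<phi> (\<tau> \<circ> \<sigma> \<circ> \<iota>)) = 0" for \<tau>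
    using highD[OF assms \<iota>, of "\<lambda>x. \<phi> (\<tau> \<circ> x)"] by (simp add: comp_assoc)
  then show "avg (Al n) (\<lambda>\<sigma>. conv n f g \<sigma> * \<phi> (\<sigma> \<circ> \<iota>)) = 0"
    unfolding avg_conv_mult by (simp add: avg_const)
qed

section \<open>Stabilizers and invariant functions\<close>

definition stab :: "nat \<Rightarrow> nat set \<Rightarrow> (nat \<Rightarrow> nat) set" where
  "stab n T = {h \<in> Al n. \<forall>i\<in>T. h i = i}"

lemma stab_Al: "h \<in> stab n T \<Longrightarrow> h \<in> Al n"
  by (simp add: stab_def)

lemma stab_mono: "T \<subseteq> T' \<Longrightarrow> stab n T' \<subseteq> stab n T"
  by (auto simp: stab_def)

text \<open>Even permutations with the same values at the t chosen positions differ by a right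
  factor in the stabilizer, so g does not depend on the representative. \<open>SOME\<close> also
  extends u to all maps as a function of t values.\<close>

lemma factor_through_restriction:
  assumes \<iota>: "\<iota> \<in> Sy n" and g: "\<And>h \<sigma>. h \<in> stab n (\<iota> ` {1..t}) \<Longrightarrow> \<sigma> \<in> Al n \<Longrightarrow> g (\<sigma> \<circ> h) = g \<sigma>"
  obtains u where "depends_on {1..t} u" "\<And>\<sigma>. \<sigma> \<in> Al n \<Longrightarrow> u (\<sigma> \<circ> \<iota>) = g \<sigma>"
proof -
  let ?R = "\<lambda>\<rho> \<sigma>. \<sigma> \<in> Al n \<and> (\<forall>i\<in>{1..t}. \<sigma> (\<iota> i) = \<rho> i)"
  define u where "u = (\<lambda>\<rho>. g (SOME \<sigma>. ?R \<rho> \<sigma>))"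
  have "depends_on {1..t} u"
    unfolding depends_on_def
  proof (intro allI impI)
    fix x y :: "nat \<Rightarrow> nat" assume "\<forall>i\<in>{1..t}. x i = y i"
    then have "?R x = ?R y" by (intro ext) auto
    then show "u x = u y" unfolding u_def by (rule arg_cong[where f = "\<lambda>R. g (SOME \<sigma>. R \<sigma>)"])
  qed
  moreover have "u (\<sigma> \<circ> \<iota>) = g \<sigma>" if \<sigma>: "\<sigma> \<in> Al n" for \<sigma>
  proof -
    define \<sigma>' where "\<sigma>' = (SOME \<sigma>'. ?R (\<sigma> \<circ> \<iota>) \<sigma>')"
    have "?R (\<sigma> \<circ> \<iota>) \<sigma>'" unfolding \<sigma>'_def by (rule someI[where x = \<sigma>]) (simp add: \<sigma>)
    then have \<sigma>': "\<sigma>' \<in> Al n" "\<And>i. i \<in> {1..t} \<Longrightarrow> \<sigma>' (\<iota> i) = \<sigma> (\<iota> i)" by auto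
    have "inj \<sigma>" using \<sigma> permutes_inj by (auto simp: in_Al_iff)
    then have "inv' \<sigma> \<circ> \<sigma>' \<in> stab n (\<iota> ` {1..t})"
      using \<sigma>' \<sigma> by (auto simp: stab_def intro!: Al_comp Al_inv)
    then have "g (\<sigma> \<circ> (inv' \<sigma> \<circ> \<sigma>')) = g \<sigma>" by (rule g) (rule \<sigma>)
    then show ?thesis
      unfolding u_def \<sigma>'_def[symmetric] by (simp only: Sy_inv_comp_assoc[OF Al_Sy[OF \<sigma>]])
  qed
  ultimately show ?thesis by (rule that)
qed

text \<open>A function invariant under the stabilizer of T is a function of the points of T, and so
  g is orthogonal to itself.\<close>

lemma high_invariant_eq_0:
  assumes g: "g \<in> high n D" and T: "T \<subseteq> {1..n}" "card T \<le> D" "D \<le> n"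
    and inv: "\<And>h \<sigma>. h \<in> stab n T \<Longrightarrow> \<sigma> \<in> Al n \<Longrightarrow> g (\<sigma> \<circ> h) = g \<sigma>"
  shows "ip (Al n) g g = 0"
proof -
  have "\<exists>S. T \<subseteq> S \<and> S \<subseteq> {1..n} \<and> card S = D"
    using T by (intro exists_subset_between) auto
  then obtain S where S: "T \<subseteq> S" "S \<subseteq> {1..n}" "card S = D" by blast
  then obtain \<iota> where \<iota>: "\<iota> permutes {1..n}" "\<iota> ` {1..D} = S"
    using ex_permutation_image[OF S(2,3)] by metis
  then have \<iota>S: "\<iota> \<in> Sy n" by (simp add: Sy_def)
  have inv': "g (\<sigma> \<circ> h) = g \<sigma>" if "h \<in> stab n (\<iota> ` {1..D})" "\<sigma> \<in> Al n" for h \<sigma>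
    using inv stab_mono[OF S(1), of n] that unfolding \<iota>(2) by blast
  obtain u where u: "depends_on {1..D} u" "\<And>\<sigma>. \<sigma> \<in> Al n \<Longrightarrow> u (\<sigma> \<circ> \<iota>) = g \<sigma>"
    using factor_through_restriction[OF \<iota>S inv'] by blast
  have "avg (Al n) (\<lambda>\<sigma>. g \<sigma> * u (\<sigma> \<circ> \<iota>)) = 0" by (rule highD[OF g \<iota>S u(1)])
  then show ?thesis unfolding ip_def using avg_cong[of "Al n" "\<lambda>\<sigma>. g \<sigma> * u (\<sigma> \<circ> \<iota>)" "\<lambda>\<sigma>. g \<sigma> * g \<sigma>"] u(2) by simp
qed

section \<open>Double transpositions\<close>

lemma comp_two_transpositions_in_Al:
  assumes "\<sigma> \<in> Al n" "a \<in> {1..n}" "b \<in> {1..n}" "c \<in> {1..n}" "d \<in> {1..n}" "a \<noteq> b" "c \<noteq> d"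
  shows "\<sigma> \<circ> tp a b \<circ> tp c d \<in> Al n" "tp a b \<circ> tp c d \<in> Al n"
proof -
  have "evenperm (tp a b \<circ> tp c d)"
    using assms by (simp add: evenperm_comp permutation_swap_id evenperm_swap)
  then show t: "tp a b \<circ> tp c d \<in> Al n"
    using assms by (simp add: in_Al_iff permutes_compose permutes_swap_id)
  show "\<sigma> \<circ> tp a b \<circ> tp c d \<in> Al n" using Al_comp[OF assms(1) t] by (simp add: comp_assoc)
qed

text \<open>Double transpositions of four distinct points generate the alternating group on at least
  five points: if the two transpositions overlap, insert twice a transposition of two points x and y
  that neither involves.\<close>

lemma invariant_even_permutation:
  assumes X: "X \<subseteq> {1..n}" "5 \<le> card X"
    and dbl: "\<And>a b c d \<sigma>. {a,b,c,d} \<subseteq> X \<Longrightarrow> card {a,b,c,d} = 4 \<Longrightarrow> \<sigma> \<in> Al n \<Longrightarrow> g (\<sigma> \<circ> tp a b \<circ> tp c d) = g \<sigma>"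
    and h: "h permutes X" "evenperm h" and \<sigma>: "\<sigma> \<in> Al n"
  shows "g (\<sigma> \<circ> h) = g \<sigma>"
proof -
  have finX: "finite X" using X finite_subset by blast
  have pair: "g (\<sigma> \<circ> tp a b \<circ> tp c d) = g \<sigma>"
    if abcd: "{a,b,c,d} \<subseteq> X" "a \<noteq> b" "c \<noteq> d" and \<sigma>: "\<sigma> \<in> Al n" for a b c d \<sigma>
  proof (cases "card {a,b,c,d} = 4")
    case False
    have le4: "card {a,b,c,d} \<le> 4" by (simp add: card_insert_if)
    then have "card {a,b,c,d} \<le> 3" using False by linarith
    then have "2 \<le> card (X - {a,b,c,d})"
      using X(2) abcd(1) by (subst card_Diff_subset) auto
    then obtain B where "B \<subseteq> X - {a,b,c,d}" "card B = 2" by (rule obtain_subset_with_card_n)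
    then obtain x y where xy: "x \<in> X - {a,b,c,d}" "y \<in> X - {a,b,c,d}" "x \<noteq> y"
      by (auto simp: card_2_iff)
    have in1: "{a,b,x,y} \<subseteq> X" "card {a,b,x,y} = 4" using xy abcd by auto
    have in2: "{x,y,c,d} \<subseteq> X" "card {x,y,c,d} = 4" using xy abcd by auto
    have \<sigma>': "\<sigma> \<circ> tp a b \<circ> tp x y \<in> Al n"
      using in1 abcd xy X(1) by (intro comp_two_transpositions_in_Al \<sigma>) auto
    have "g (\<sigma> \<circ> tp a b \<circ> tp c d) = g (\<sigma> \<circ> tp a b \<circ> tp x y \<circ> tp x y \<circ> tp c d)"
      by (simp add: comp_assoc)
    also have "\<dots> = g \<sigma>" using dbl[OF in2 \<sigma>'] dbl[OF in1 \<sigma>] by simp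
    finally show ?thesis .
  qed (use dbl abcd \<sigma> in blast)
  \<comment> \<open>So that the induction can advance by single transpositions, odd permutations are
    included, made even by an arbitrary transposition in front.\<close>
  have "(evenperm h \<longrightarrow> (\<forall>\<sigma>\<in>Al n. g (\<sigma> \<circ> h) = g \<sigma>)) \<and>
    (\<not> evenperm h \<longrightarrow> (\<forall>\<sigma>\<in>Al n. \<forall>a\<in>X. \<forall>b\<in>X. a \<noteq> b \<longrightarrow> g (\<sigma> \<circ> tp a b \<circ> h) = g \<sigma>))"
    using h(1) finX
  proof (induction rule: permutes_induct)
    case id
    then show ?case by simp
  next
    case (swap a b p)
    have ev: "evenperm (tp a b \<circ> p) \<longleftrightarrow> \<not> evenperm p"
      using swap permutes_imp_permutation[OF finX]
      by (simp add: evenperm_comp permutation_swap_id evenperm_swap)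
    show ?case
    proof (intro conjI impI ballI)
      fix \<sigma> assume "evenperm (tp a b \<circ> p)" "\<sigma> \<in> Al n"
      then have "g (\<sigma> \<circ> tp a b \<circ> p) = g \<sigma>" using ev swap by blast
      then show "g (\<sigma> \<circ> (tp a b \<circ> p)) = g \<sigma>" by (simp only: comp_assoc)
    next
      fix \<sigma> c d assume o: "\<not> evenperm (tp a b \<circ> p)" "\<sigma> \<in> Al n" "c \<in> X" "d \<in> X" "c \<noteq> d"
      have "\<sigma> \<circ> tp c d \<circ> tp a b \<in> Al n"
        using o swap X(1) by (intro comp_two_transpositions_in_Al) auto
      then have "g (\<sigma> \<circ> tp c d \<circ> tp a b \<circ> p) = g (\<sigma> \<circ> tp c d \<circ> tp a b)" using o(1) ev swap by blast
      also have "\<dots> = g \<sigma>" using o swap by (intro pair) auto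
      finally show "g (\<sigma> \<circ> tp c d \<circ> (tp a b \<circ> p)) = g \<sigma>" by (simp add: comp_assoc)
    qed
  qed
  then show ?thesis using h(2) \<sigma> by blast
qed

text \<open>z is a 3-cycle of b, c, d. It permutes cyclically the three nontrivial elements of the
  Klein four-group on a, b, c, d, each of which is the product of the other two.\<close>

lemma double_transposition_conjugation:
  assumes "card {a,b,c,d} = 4"
  defines "z \<equiv> tp b c \<circ> tp c d"
  shows "z \<circ> (tp a b \<circ> tp c d) = (tp a c \<circ> tp b d) \<circ> z"
    "z \<circ> (tp a c \<circ> tp b d) = (tp a d \<circ> tp b c) \<circ> z"
    "(tp a b \<circ> tp c d) \<circ> (tp a c \<circ> tp b d) = tp a d \<circ> tp b c"
proof -
  have "a \<noteq> b" "a \<noteq> c" "a \<noteq> d" "b \<noteq> c" "b \<noteq> d" "c \<noteq> d"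
    using assms by (auto simp: card_insert_if split: if_splits)
  note ne = this this[symmetric]
  have "(z \<circ> (tp a b \<circ> tp c d)) x = ((tp a c \<circ> tp b d) \<circ> z) x \<and>
    (z \<circ> (tp a c \<circ> tp b d)) x = ((tp a d \<circ> tp b c) \<circ> z) x \<and>
    ((tp a b \<circ> tp c d) \<circ> (tp a c \<circ> tp b d)) x = (tp a d \<circ> tp b c) x" for x
  proof -
    consider "x = a" | "x = b" | "x = c" | "x = d" | "x \<noteq> a" "x \<noteq> b" "x \<noteq> c" "x \<noteq> d" by blast
    then show ?thesis
      by cases (simp_all add: z_def Transposition.transpose_def ne)
  qed
  then show "z \<circ> (tp a b \<circ> tp c d) = (tp a c \<circ> tp b d) \<circ> z"
    "z \<circ> (tp a c \<circ> tp b d) = (tp a d \<circ> tp b c) \<circ> z"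
    "(tp a b \<circ> tp c d) \<circ> (tp a c \<circ> tp b d) = tp a d \<circ> tp b c"
    by (intro ext; blast)+
qed

lemma orthonormal_append:
  assumes "orthonormal S k e" "orthonormal S l e'" "\<And>i j. i < k \<Longrightarrow> j < l \<Longrightarrow> ip S (e i) (e' j) = 0"
  shows "orthonormal S (k + l) (\<lambda>i. if i < k then e i else e' (i - k))"
  using assms unfolding orthonormal_def by (auto simp: ip_commute[of S "e' _" "e _"])

text \<open>
  Some double transposition \<open>s\<close> outside \<open>T\<close> acts nontrivially on \<open>E\<close>. It is not \<open>- 1\<close> on \<open>E\<close> either, because it is
  the product of two of its conjugates. Hence both eigenspaces of \<open>s\<close> in \<open>E\<close> are nonzero, and they are
  invariant under the permutations that fix four more points.
\<close>

lemma orthonormal_in_invariant_subspace: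
  assumes "fsubspace E" "T \<subseteq> {1..n}" "card T + 4 * j \<le> D" "D < n"
    and "\<And>g a. g \<in> E \<Longrightarrow> a \<in> stab n T \<Longrightarrow> (\<lambda>\<sigma>. g (\<sigma> \<circ> a)) \<in> E"
    and "\<exists>g\<in>E. ip (Al n) g g \<noteq> 0"
    and "\<And>g T'. g \<in> E \<Longrightarrow> T' \<subseteq> {1..n} \<Longrightarrow> card T' \<le> D \<Longrightarrow>
      (\<And>h \<sigma>. h \<in> stab n T' \<Longrightarrow> \<sigma> \<in> Al n \<Longrightarrow> g (\<sigma> \<circ> h) = g \<sigma>) \<Longrightarrow> ip (Al n) g g = 0"
  shows "\<exists>k e. 2 ^ j \<le> k \<and> orthonormal (Al n) k e \<and> (\<forall>i<k. e i \<in> E)"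
  using assms
proof (induction j arbitrary: E T)
  case 0
  then obtain g where g: "g \<in> E" "ip (Al n) g g \<noteq> 0" by blast
  have "orthonormal (Al n) 0 (\<lambda>_ _. 0)" by (simp add: orthonormal_def)
  from orthonormal_extend[OF this g(2)]
  have "orthonormal (Al n) (Suc 0) ((\<lambda>_ _. 0)(0 := (\<lambda>x. g x / sqrt (ip (Al n) g g))))" by simp
  moreover have "(\<lambda>x. g x / sqrt (ip (Al n) g g)) \<in> E"
    using fsubspace_cmult[OF 0(1) g(1), of "1 / sqrt (ip (Al n) g g)"] by simp
  ultimately show ?case by (intro exI[of _ "Suc 0"] exI conjI) auto
next
  case (Suc j)
  note E = Suc.prems(1) and T = Suc.prems(2) and cT = Suc.prems(3) and inv = Suc.prems(5) and noinv = Suc.prems(7)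
  let ?X = "{1..n} - T"
  have finT: "finite T" using T finite_subset by blast
  \<comment> \<open>At least five points remain because card T + 4 * (j + 1) \<le> D < n.\<close>
  have cX: "5 \<le> card ?X" using finT T cT Suc.prems(4) by (simp add: card_Diff_subset)
  have "\<exists>a b c d g \<sigma>. {a,b,c,d} \<subseteq> ?X \<and> card {a,b,c,d} = 4 \<and> g \<in> E \<and> \<sigma> \<in> Al n \<and> g (\<sigma> \<circ> tp a b \<circ> tp c d) \<noteq> g \<sigma>"
  proof (rule ccontr)
    assume contra: "\<not> ?thesis"
    obtain g where g: "g \<in> E" "ip (Al n) g g \<noteq> 0" using Suc.prems(6) by blast
    have triv: "g (\<sigma> \<circ> tp a b \<circ> tp c d) = g \<sigma>"
      if *: "{a,b,c,d} \<subseteq> ?X" "card {a,b,c,d} = 4" "\<sigma> \<in> Al n" for a b c d \<sigma>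
    proof (rule ccontr)
      assume "g (\<sigma> \<circ> tp a b \<circ> tp c d) \<noteq> g \<sigma>"
      then have "\<exists>a b c d g \<sigma>. {a,b,c,d} \<subseteq> ?X \<and> card {a,b,c,d} = 4 \<and> g \<in> E \<and> \<sigma> \<in> Al n \<and> g (\<sigma> \<circ> tp a b \<circ> tp c d) \<noteq> g \<sigma>"
        using * g(1) by (intro exI conjI)
      with contra show False by (rule notE)
    qed
    have "g (\<sigma> \<circ> h) = g \<sigma>" if h: "h \<in> stab n T" and \<sigma>: "\<sigma> \<in> Al n" for h \<sigma>
    proof -
      have h': "h permutes {1..n}" "evenperm h" "\<And>i. i \<in> T \<Longrightarrow> h i = i" using h unfolding stab_def in_Al_iff by blast+
      have "h permutes ?X" by (rule permutes_superset[OF h'(1)]) (use h'(3) in auto)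
      from invariant_even_permutation[OF Diff_subset cX triv this h'(2) \<sigma>] show ?thesis .
    qed
    from noinv[OF g(1) T _ this] have "ip (Al n) g g = 0" using cT by simp
    then show False using g(2) by simp
  qed
  then obtain a b c d g\<^sub>0 \<sigma>\<^sub>0 where abcd: "{a,b,c,d} \<subseteq> ?X" "card {a,b,c,d} = 4"
    and g0: "g\<^sub>0 \<in> E" "\<sigma>\<^sub>0 \<in> Al n" "g\<^sub>0 (\<sigma>\<^sub>0 \<circ> tp a b \<circ> tp c d) \<noteq> g\<^sub>0 \<sigma>\<^sub>0"
    apply (elim exE conjE) by (rule that)
  have ne: "a \<noteq> b" "a \<noteq> c" "a \<noteq> d" "b \<noteq> c" "b \<noteq> d" "c \<noteq> d"
    using abcd(2) by (auto simp: card_insert_if split: if_splits)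
  have inn: "a \<in> {1..n}" "b \<in> {1..n}" "c \<in> {1..n}" "d \<in> {1..n}" "a \<notin> T" "b \<notin> T" "c \<notin> T" "d \<notin> T"
    using abcd(1) by auto
  define s where "s = tp a b \<circ> tp c d"
  have stabT: "tp x y \<circ> tp z w \<in> stab n T" if "x \<in> {a,b,c,d}" "y \<in> {a,b,c,d}" "z \<in> {a,b,c,d}" "w \<in> {a,b,c,d}" "x \<noteq> y" "z \<noteq> w" for x y z w
  proof -
    have "x \<in> {1..n}" "y \<in> {1..n}" "z \<in> {1..n}" "w \<in> {1..n}" "x \<notin> T" "y \<notin> T" "z \<notin> T" "w \<notin> T"
      using that inn by auto
    then show ?thesis
      using comp_two_transpositions_in_Al(2)[of id n x y z w] that by (auto simp: stab_def Transposition.transpose_def)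
  qed
  have s: "s \<in> stab n T" unfolding s_def using ne by (intro stabT) auto
  have sA: "s \<in> Al n" using s by (rule stab_Al)
  have ss: "s \<circ> s = id" using ne by (auto simp: s_def fun_eq_iff Transposition.transpose_def)
  define T' where "T' = T \<union> {a,b,c,d}"
  have T': "T' \<subseteq> {1..n}" "card T' + 4 * j \<le> D"
  proof -
    have "card T' = card T + 4" unfolding T'_def using finT abcd by (subst card_Un_disjoint) auto
    then show "card T' + 4 * j \<le> D" using cT by simp
  qed (use T inn in \<open>auto simp: T'_def\<close>)
  have comm: "h \<circ> s = s \<circ> h" if "h \<in> stab n T'" for h
  proof
    fix x
    have h: "h a = a" "h b = b" "h c = c" "h d = d" "inj h"
      using that permutes_inj by (auto simp: stab_def T'_def in_Al_iff)
    have s_in: "s y \<in> {a,b,c,d}" if "y \<in> {a,b,c,d}" for y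
      using that by (auto simp: s_def Transposition.transpose_def)
    have s_out: "s y = y" if "y \<notin> {a,b,c,d}" for y
      using that by (simp add: s_def Transposition.transpose_def)
    have h_in: "h y = y" if "y \<in> {a,b,c,d}" for y using that h by auto
    show "(h \<circ> s) x = (s \<circ> h) x"
    proof (cases "x \<in> {a,b,c,d}")
      case True
      then show ?thesis using h_in[OF s_in[OF True]] h_in[OF True] by simp
    next
      case False
      have "h x \<notin> {a,b,c,d}"
      proof
        assume y: "h x \<in> {a,b,c,d}"
        then have "h (h x) = h x" by (rule h_in)
        then have "h x = x" by (rule injD[OF h(5)])
        then show False using y False by simp
      qed
      then show ?thesis using s_out[OF False] s_out[of "h x"] by simp
    qed
  qed
  \<comment> \<open>The eigenspaces of s for \<epsilon> = 1 and \<epsilon> = -1 are orthogonal, so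
    the orthonormal families found in them can be joined: the size doubles while T grows by four
    points.\<close>
  define Ee where "Ee = (\<lambda>\<epsilon>::real. {g\<in>E. \<forall>\<sigma>\<in>Al n. g (\<sigma> \<circ> s) = \<epsilon> * g \<sigma>})"
  have Ee_sub: "fsubspace (Ee \<epsilon>)" for \<epsilon>
    using E unfolding fsubspace_def Ee_def by (auto simp: algebra_simps)
  have Ee_inv: "(\<lambda>\<sigma>. g (\<sigma> \<circ> h)) \<in> Ee \<epsilon>" if g: "g \<in> Ee \<epsilon>" and h: "h \<in> stab n T'" for g h \<epsilon>
  proof -
    have hT: "h \<in> stab n T" using h by (auto simp: stab_def T'_def)
    have "g (\<sigma> \<circ> s \<circ> h) = \<epsilon> * g (\<sigma> \<circ> h)" if \<sigma>: "\<sigma> \<in> Al n" for \<sigma>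
    proof -
      have "\<sigma> \<circ> s \<circ> h = \<sigma> \<circ> h \<circ> s" using comm[OF h] by (simp add: comp_assoc)
      moreover have "\<sigma> \<circ> h \<in> Al n" using \<sigma> h stab_Al Al_comp by blast
      ultimately show ?thesis using g by (simp add: Ee_def)
    qed
    moreover have "(\<lambda>\<sigma>. g (\<sigma> \<circ> h)) \<in> E" by (rule inv[OF _ hT]) (use g in \<open>simp add: Ee_def\<close>)
    ultimately show ?thesis unfolding Ee_def by blast
  qed
  have proj: "(\<lambda>\<sigma>. g \<sigma> + \<epsilon> * g (\<sigma> \<circ> s)) \<in> Ee \<epsilon>" if g: "g \<in> E" and \<epsilon>: "\<epsilon> * \<epsilon> = 1" for g \<epsilon>
  proof -
    have "(\<lambda>\<sigma>. 1 * g \<sigma> + \<epsilon> * g (\<sigma> \<circ> s)) \<in> E" by (rule fsubspace_lin[OF E g inv[OF g s]])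
    moreover have "g (\<sigma> \<circ> s \<circ> s) = g \<sigma>" for \<sigma> using ss by (simp add: comp_assoc)
    ultimately show ?thesis using \<epsilon> by (simp add: Ee_def distrib_left mult.assoc[symmetric])
  qed
  have ipne: "ip (Al n) g g \<noteq> 0" if "\<sigma> \<in> Al n" "g \<sigma> \<noteq> 0" for g \<sigma>
    using ip_self_eq_0D[of "Al n" g \<sigma>] that by auto
  have nz_minus: "\<exists>g\<in>Ee (-1). ip (Al n) g g \<noteq> 0"
  proof (rule bexI)
    show "(\<lambda>\<sigma>. g\<^sub>0 \<sigma> + (-1) * g\<^sub>0 (\<sigma> \<circ> s)) \<in> Ee (-1)" by (rule proj[OF g0(1)]) simp
    have "g\<^sub>0 \<sigma>\<^sub>0 + (-1) * g\<^sub>0 (\<sigma>\<^sub>0 \<circ> s) \<noteq> 0" using g0(3) by (simp add: s_def comp_assoc)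
    then show "ip (Al n) (\<lambda>\<sigma>. g\<^sub>0 \<sigma> + (-1) * g\<^sub>0 (\<sigma> \<circ> s)) (\<lambda>\<sigma>. g\<^sub>0 \<sigma> + (-1) * g\<^sub>0 (\<sigma> \<circ> s)) \<noteq> 0"
      by (rule ipne[OF g0(2), of "\<lambda>\<sigma>. g\<^sub>0 \<sigma> + (-1) * g\<^sub>0 (\<sigma> \<circ> s)"])
  qed
  have nz_plus: "\<exists>g\<in>Ee 1. ip (Al n) g g \<noteq> 0"
  proof (rule ccontr)
    assume contra: "\<not> ?thesis"
    have neg: "g (\<sigma> \<circ> s) = - g \<sigma>" if "g \<in> E" "\<sigma> \<in> Al n" for g \<sigma>
    proof -
      have "ip (Al n) (\<lambda>\<sigma>. g \<sigma> + 1 * g (\<sigma> \<circ> s)) (\<lambda>\<sigma>. g \<sigma> + 1 * g (\<sigma> \<circ> s)) = 0"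
        using contra bspec[OF _ proj[OF that(1), of 1], of "\<lambda>g. ip (Al n) g g = 0"] by simp
      from ip_self_eq_0D[OF finite_Al this that(2)] have "g \<sigma> + 1 * g (\<sigma> \<circ> s) = 0" .
      then show ?thesis by simp
    qed
    let ?z = "tp b c \<circ> tp c d"
    have z: "?z \<in> stab n T" using ne by (intro stabT) auto
    have z': "inv' ?z \<in> stab n T"
    proof -
      have "inj ?z" using stab_Al[OF z] permutes_inj by (auto simp: in_Al_iff)
      then show ?thesis using z Al_inv[of ?z n] inv_f_eq[of ?z] unfolding stab_def by blast
    qed
    have conj: "g (\<sigma> \<circ> s') = - g \<sigma>"
      if s12: "?z \<circ> s'' = s' \<circ> ?z" and neg'': "\<And>g \<sigma>. g \<in> E \<Longrightarrow> \<sigma> \<in> Al n \<Longrightarrow> g (\<sigma> \<circ> s'') = - g \<sigma>"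
        and g: "g \<in> E" and \<sigma>: "\<sigma> \<in> Al n" for s' s'' g \<sigma>
    proof -
      have zS: "?z \<in> Sy n" using stab_Al[OF z] by (rule Al_Sy)
      have "s' = ?z \<circ> s'' \<circ> inv' ?z" unfolding s12 using zS by (simp only: Sy_inv_comp_assoc)
      then have "g (\<sigma> \<circ> s') = (\<lambda>\<sigma>. g (\<sigma> \<circ> inv' ?z)) (\<sigma> \<circ> ?z \<circ> s'')" by (simp only: comp_assoc)
      also have "\<dots> = - (\<lambda>\<sigma>. g (\<sigma> \<circ> inv' ?z)) (\<sigma> \<circ> ?z)"
        by (rule neg''[OF inv[OF g z'] Al_comp[OF \<sigma> stab_Al[OF z]]])
      also have "\<dots> = - g \<sigma>" using zS by (simp only: Sy_inv_comp_assoc)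
      finally show ?thesis .
    qed
    have dt: "?z \<circ> s = (tp a c \<circ> tp b d) \<circ> ?z" "?z \<circ> (tp a c \<circ> tp b d) = (tp a d \<circ> tp b c) \<circ> ?z"
      "s \<circ> (tp a c \<circ> tp b d) = tp a d \<circ> tp b c"
      unfolding s_def by (rule double_transposition_conjugation[OF abcd(2)])+
    have neg1: "g (\<sigma> \<circ> (tp a c \<circ> tp b d)) = - g \<sigma>" if "g \<in> E" "\<sigma> \<in> Al n" for g \<sigma>
      by (rule conj[OF dt(1) neg that])
    have neg2: "g (\<sigma> \<circ> (tp a d \<circ> tp b c)) = - g \<sigma>" if "g \<in> E" "\<sigma> \<in> Al n" for g \<sigma>
      by (rule conj[OF dt(2) neg1 that])
    have "g \<sigma> = 0" if g: "g \<in> E" "\<sigma> \<in> Al n" for g \<sigma>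
    proof -
      have "g (\<sigma> \<circ> s \<circ> (tp a c \<circ> tp b d)) = - g (\<sigma> \<circ> s)" by (rule neg1[OF g(1) Al_comp[OF g(2) sA]])
      also have "\<dots> = g \<sigma>" using neg[OF g] by simp
      finally have "g (\<sigma> \<circ> (tp a d \<circ> tp b c)) = g \<sigma>" using dt(3) by (simp only: comp_assoc)
      then show ?thesis using neg2[OF g] by simp
    qed
    from this[OF g0(1) Al_comp[OF g0(2) sA]] this[OF g0(1,2)] show False
      using g0(3) by (simp add: s_def comp_assoc)
  qed
  have noinv': "ip (Al n) g g = 0"
    if "g \<in> Ee \<epsilon>" "T' \<subseteq> {1..n}" "card T' \<le> D" "\<And>h \<sigma>. h \<in> stab n T' \<Longrightarrow> \<sigma> \<in> Al n \<Longrightarrow> g (\<sigma> \<circ> h) = g \<sigma>" for g T' \<epsilon>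
  proof -
    have "g \<in> E" using that(1) by (simp add: Ee_def)
    from noinv[OF this that(2-4)] show ?thesis .
  qed
  have IH: "\<exists>k e. 2 ^ j \<le> k \<and> orthonormal (Al n) k e \<and> (\<forall>i<k. e i \<in> Ee \<epsilon>)"
    if nz: "\<exists>g\<in>Ee \<epsilon>. ip (Al n) g g \<noteq> 0" for \<epsilon>
  proof (rule Suc.IH[OF Ee_sub T' Suc.prems(4)])
    show "(\<lambda>\<sigma>. g (\<sigma> \<circ> a)) \<in> Ee \<epsilon>" if "g \<in> Ee \<epsilon>" "a \<in> stab n T'" for g a
      by (rule Ee_inv[OF that])
    show "\<exists>g\<in>Ee \<epsilon>. ip (Al n) g g \<noteq> 0" by (rule nz)
    show "ip (Al n) g g = 0" if "g \<in> Ee \<epsilon>" "U \<subseteq> {1..n}" "card U \<le> D"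
      "\<And>h \<sigma>. h \<in> stab n U \<Longrightarrow> \<sigma> \<in> Al n \<Longrightarrow> g (\<sigma> \<circ> h) = g \<sigma>" for g U
      by (rule noinv'[OF that])
  qed
  obtain k1 e1 where e1: "2 ^ j \<le> k1" "orthonormal (Al n) k1 e1" "\<forall>i<k1. e1 i \<in> Ee 1"
    using IH[OF nz_plus] by blast
  obtain k2 e2 where e2: "2 ^ j \<le> k2" "orthonormal (Al n) k2 e2" "\<forall>i<k2. e2 i \<in> Ee (-1)"
    using IH[OF nz_minus] by blast
  have orth: "ip (Al n) (e1 i) (e2 i') = 0" if "i < k1" "i' < k2" for i i'
  proof -
    have "ip (Al n) (e1 i) (e2 i') = avg (Al n) (\<lambda>\<sigma>. e1 i (\<sigma> \<circ> s) * e2 i' (\<sigma> \<circ> s))"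
      unfolding ip_def using avg_Al_right[OF sA, of "\<lambda>\<sigma>. e1 i \<sigma> * e2 i' \<sigma>"] by simp
    also have "\<dots> = avg (Al n) (\<lambda>\<sigma>. - (e1 i \<sigma> * e2 i' \<sigma>))"
      using e1(3) e2(3) that by (intro avg_cong) (auto simp: Ee_def)
    also have "\<dots> = - ip (Al n) (e1 i) (e2 i')" by (simp add: avg_minus ip_def)
    finally show ?thesis by simp
  qed
  let ?e = "\<lambda>i. if i < k1 then e1 i else e2 (i - k1)"
  have "orthonormal (Al n) (k1 + k2) ?e" by (rule orthonormal_append[OF e1(2) e2(2) orth])
  moreover have "\<forall>i<k1 + k2. ?e i \<in> E" using e1(3) e2(3) by (auto simp: Ee_def)
  moreover have "2 ^ Suc j \<le> k1 + k2" using e1(1) e2(1) by simp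
  ultimately show ?case by blast
qed

text \<open>High multiplicity makes the top eigenvalue small: k orthonormal functions with the same
  quotient \<mu> give k * \<mu> \<le> \<open>sqnorm (Al n) f\<close>, and right invariance of the
  eigenspace provides k \<ge> 2 ^ j.\<close>

theorem conv_high_norm_le:
  assumes g: "g \<in> high n (4 * j)" and n: "4 * j < n"
  shows "2 ^ j * sqnorm (Al n) (conv n f g) \<le> sqnorm (Al n) f * sqnorm (Al n) g"
proof -
  let ?P = "high n (4 * j)"
  define Q where "Q = (\<lambda>g h. avg (Al n) (\<lambda>\<sigma>. conv n f g \<sigma> * conv n f h \<sigma>))"
  have conv_lin: "conv n f (\<lambda>x. a * g x + b * h x) \<sigma> = a * conv n f g \<sigma> + b * conv n f h \<sigma>" for a b g h \<sigma>
    by (simp add: conv_def distrib_left avg_add avg_cmult mult.left_commute)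
  have conv_cong: "conv n f g \<sigma> = conv n f g' \<sigma>" if "\<And>x. x \<in> Al n \<Longrightarrow> g x = g' x" "\<sigma> \<in> Al n" for g g' \<sigma>
    using that by (simp add: conv_eq) (intro avg_cong, simp add: Al_comp Al_inv)
  have bil: "bilinear_form (Al n) Q"
    unfolding bilinear_form_def
  proof (intro conjI allI impI)
    fix g h k a b
    show "Q (\<lambda>x. a * g x + b * h x) k = a * Q g k + b * Q h k"
      by (simp add: Q_def conv_lin distrib_right mult.assoc avg_add avg_cmult)
    show "Q g h = Q h g" by (simp add: Q_def mult.commute)
  next
    fix g g' h :: "(nat \<Rightarrow> nat) \<Rightarrow> real" assume "\<forall>x\<in>Al n. g x = g' x"
    then show "Q g h = Q g' h"
      unfolding Q_def using conv_cong[of g g'] by (intro avg_cong) simp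
  qed
  have Qself: "Q g g = sqnorm (Al n) (conv n f g)" for g
    by (simp add: Q_def power2_eq_square)
  have Q0: "0 \<le> Q g g" for g unfolding Qself by (intro avg_nonneg) auto
  have conv_rt: "conv n f (\<lambda>\<sigma>. g (\<sigma> \<circ> a)) \<sigma> = conv n f g (\<sigma> \<circ> a)" if "a \<in> Al n" "\<sigma> \<in> Al n" for g a \<sigma>
    using that by (simp add: conv_eq Al_comp comp_assoc)
  have Q_rt: "Q (\<lambda>\<sigma>. g (\<sigma> \<circ> a)) (\<lambda>\<sigma>. g (\<sigma> \<circ> a)) = Q g g" if a: "a \<in> Al n" for g a
  proof -
    have "Q (\<lambda>\<sigma>. g (\<sigma> \<circ> a)) (\<lambda>\<sigma>. g (\<sigma> \<circ> a)) = avg (Al n) (\<lambda>\<sigma>. (conv n f g (\<sigma> \<circ> a))\<^sup>2)"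
      unfolding Qself using conv_rt[OF a] by (intro avg_cong) simp
    then show ?thesis unfolding Qself using avg_Al_right[OF a, of "\<lambda>\<sigma>. (conv n f g \<sigma>)\<^sup>2"] by simp
  qed
  have ip_rt: "ip (Al n) (\<lambda>\<sigma>. g (\<sigma> \<circ> a)) (\<lambda>\<sigma>. g (\<sigma> \<circ> a)) = ip (Al n) g g" if a: "a \<in> Al n" for g a
    unfolding ip_def by (rule avg_Al_right[OF a, of "\<lambda>\<sigma>. g \<sigma> * g \<sigma>"])
  show ?thesis
  proof (cases "\<exists>g\<in>?P. ip (Al n) g g \<noteq> 0")
    case False
    then have "g \<sigma> = 0" if "\<sigma> \<in> Al n" for \<sigma> using g ip_self_eq_0D[OF finite_Al _ that] by blast
    then have "conv n f g \<sigma> = conv n f (\<lambda>_. 0) \<sigma>" if "\<sigma> \<in> Al n" for \<sigma> by (intro conv_cong that)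
    then have "sqnorm (Al n) (conv n f g) = sqnorm (Al n) (conv n f (\<lambda>_. 0))"
      by (intro avg_cong) simp
    also have "\<dots> = 0" by (simp add: conv_def avg_const)
    finally show ?thesis by (simp add: avg_nonneg)
  next
    case True
    obtain \<mu> where \<mu>: "\<And>g. g \<in> ?P \<Longrightarrow> Q g g \<le> \<mu> * ip (Al n) g g"
      "fsubspace {g\<in>?P. Q g g = \<mu> * ip (Al n) g g}" "\<exists>g\<in>?P. Q g g = \<mu> * ip (Al n) g g \<and> ip (Al n) g g \<noteq> 0"
      by (rule max_eigenspace[OF finite_Al Al_nonempty fsubspace_high bil True]) blast
    let ?E = "{g\<in>?P. Q g g = \<mu> * ip (Al n) g g}"
    have "\<exists>k e. 2 ^ j \<le> k \<and> orthonormal (Al n) k e \<and> (\<forall>i<k. e i \<in> ?E)"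
    proof (rule orthonormal_in_invariant_subspace[OF \<mu>(2), of "{}" n j "4 * j"])
      show "(\<lambda>\<sigma>. g (\<sigma> \<circ> a)) \<in> ?E" if "g \<in> ?E" "a \<in> stab n {}" for g a
        using that stab_Al[OF that(2)] high_right_translate[of g n "4 * j" a] by (simp add: Q_rt ip_rt)
      show "\<exists>g\<in>?E. ip (Al n) g g \<noteq> 0" using \<mu>(3) by blast
      show "ip (Al n) g g = 0" if "g \<in> ?E" "T' \<subseteq> {1..n}" "card T' \<le> 4 * j"
        "\<And>h \<sigma>. h \<in> stab n T' \<Longrightarrow> \<sigma> \<in> Al n \<Longrightarrow> g (\<sigma> \<circ> h) = g \<sigma>" for g T'
      proof -
        have "g \<in> ?P" using that(1) by simp
        from high_invariant_eq_0[OF this that(2,3) less_imp_le[OF n] that(4)] show ?thesis .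
      qed
    qed (use n in auto)
    then obtain k e where e: "2 ^ j \<le> k" "orthonormal (Al n) k e" "\<And>i. i < k \<Longrightarrow> e i \<in> ?E" by blast
    have \<mu>0: "0 \<le> \<mu>"
    proof -
      obtain g where g: "Q g g = \<mu> * ip (Al n) g g" "ip (Al n) g g \<noteq> 0" using \<mu>(3) by blast
      have "0 \<le> \<mu> * ip (Al n) g g" using Q0[of g] g(1) by simp
      moreover have "0 < ip (Al n) g g" using g(2) ip_nonneg[of "Al n" g] by simp
      ultimately show ?thesis by (simp add: zero_le_mult_iff)
    qed
    have "real k * \<mu> = (\<Sum>i<k. Q (e i) (e i))"
      using e by (simp add: orthonormal_def)
    also have "\<dots> = avg (Al n) (\<lambda>\<sigma>. \<Sum>i<k. (conv n f (e i) \<sigma>)\<^sup>2)"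
      by (simp add: Qself avg_sum)
    also have "\<dots> \<le> avg (Al n) (\<lambda>\<sigma>. ip (Al n) f f)"
    proof (rule avg_mono)
      fix \<sigma> assume \<sigma>: "\<sigma> \<in> Al n"
      \<comment> \<open>For fixed \<sigma> these functions of \<tau> are again orthonormal, and
        \<open>conv n f (e i) \<sigma>\<close> is the coefficient of f at \<open>?e i\<close>;
        Bessel's inequality applies at each \<sigma>.\<close>
      let ?e = "\<lambda>i \<tau>. e i (inv' \<tau> \<circ> \<sigma>)"
      have "ip (Al n) (?e i) (?e i') = ip (Al n) (e i) (e i')" for i i'
        unfolding ip_def by (rule avg_Al_comp_inverse[OF \<sigma>, of "\<lambda>x. e i x * e i' x"])
      then have "orthonormal (Al n) k ?e" using e(2) by (simp add: orthonormal_def)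
      from Bessel[OF this, of f] show "(\<Sum>i<k. (conv n f (e i) \<sigma>)\<^sup>2) \<le> ip (Al n) f f"
        by (simp add: conv_eq[OF \<sigma>] ip_def)
    qed
    finally have k: "real k * \<mu> \<le> ip (Al n) f f" by (simp add: avg_const)
    have "2 ^ j * sqnorm (Al n) (conv n f g) \<le> 2 ^ j * (\<mu> * ip (Al n) g g)"
      using \<mu>(1)[OF g] by (simp add: Qself)
    also have "\<dots> \<le> (real k * \<mu>) * ip (Al n) g g"
    proof -
      have "(2 :: real) ^ j \<le> real k" using e(1) by (metis of_nat_le_iff of_nat_numeral of_nat_power)
      then show ?thesis using \<mu>0 ip_nonneg[of "Al n" g] by (simp add: mult.assoc[symmetric] mult_right_mono)
    qed
    also have "\<dots> \<le> ip (Al n) f f * ip (Al n) g g"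
      using k ip_nonneg by (intro mult_right_mono) auto
    finally show ?thesis by (simp add: ip_self)
  qed
qed

lemma stab_comp: "h \<in> stab n T \<Longrightarrow> h' \<in> stab n T \<Longrightarrow> h \<circ> h' \<in> stab n T"
  by (auto simp: stab_def intro: Al_comp)

lemma stab_inv:
  assumes "h \<in> stab n T"
  shows "inv' h \<in> stab n T"
proof -
  have "inj h" using stab_Al[OF assms] permutes_inj by (auto simp: in_Al_iff)
  then have "inv' h i = i" if "i \<in> T" for i
    using that assms by (intro inv_f_eq) (auto simp: stab_def)
  then show ?thesis using Al_inv[OF stab_Al[OF assms]] by (simp add: stab_def)
qed

lemma avg_stab_right:
  assumes a: "a \<in> stab n T"
  shows "avg (stab n T) (\<lambda>h. f (a \<circ> h)) = avg (stab n T) f"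
proof -
  note aS = Al_Sy[OF stab_Al[OF a]]
  have "bij_betw (\<lambda>x. a \<circ> x) (stab n T) (stab n T)"
    using stab_comp[OF a] stab_comp[OF stab_inv[OF a]]
    by (intro bij_betw_byWitness[where f' = "\<lambda>x. inv' a \<circ> x"]) (auto simp: Sy_inv_comp_assoc[OF aS])
  then show ?thesis by (rule avg_reindex)
qed

section \<open>Functions of few points\<close>

text \<open>
  On permutations this is the left-hand side of the purity condition at \<open>s\<close>; written in this way it is
  meaningful for all maps and does not involve the value at \<open>s\<close>.
\<close>

definition swap_sum :: "nat \<Rightarrow> nat \<Rightarrow> ((nat \<Rightarrow> nat) \<Rightarrow> real) \<Rightarrow> nat \<Rightarrow> (nat \<Rightarrow> nat) \<Rightarrow> real" where
  "swap_sum n t u s \<rho> = (\<Sum>j\<in>{1..n} - \<rho> ` ({1..t} - {s}). u (\<rho>(s := j)))"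

lemma depends_on_swap_sum:
  assumes "depends_on {1..t} u"
  shows "depends_on ({1..t} - {s}) (swap_sum n t u s)"
  unfolding depends_on_def
proof (intro allI impI)
  fix x y :: "nat \<Rightarrow> nat" assume xy: "\<forall>i\<in>{1..t} - {s}. x i = y i"
  then have "x ` ({1..t} - {s}) = y ` ({1..t} - {s})" by (intro image_cong) auto
  moreover have "u (x(s := j)) = u (y(s := j))" for j
    using xy by (intro depends_onD[OF assms]) auto
  ultimately show "swap_sum n t u s x = swap_sum n t u s y" by (simp add: swap_sum_def)
qed

text \<open>A value not taken at the other positions is \<rho> i for i = s or i > t, and to u,
  putting it at s looks like exchanging s and i.\<close>

lemma swap_sum_eq:
  assumes u: "depends_on {1..t} u" and s: "s \<in> {1..t}" "t \<le> n" and \<rho>: "\<rho> \<in> Sy n"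
  shows "swap_sum n t u s \<rho> = u \<rho> + (\<Sum>i\<in>{t+1..n}. u (\<rho> \<circ> tp s i))"
proof -
  have p: "\<rho> permutes {1..n}" using \<rho> by (simp add: Sy_def)
  have inj: "inj \<rho>" by (rule permutes_inj[OF p])
  have "{1..n} - ({1..t} - {s}) = insert s {t+1..n}" using s by auto
  then have "{1..n} - \<rho> ` ({1..t} - {s}) = \<rho> ` (insert s {t+1..n})"
    using image_set_diff[OF inj, of "{1..n}" "{1..t} - {s}"] permutes_image[OF p] by simp
  then have "swap_sum n t u s \<rho> = (\<Sum>j\<in>\<rho> ` (insert s {t+1..n}). u (\<rho>(s := j)))"
    by (simp only: swap_sum_def)
  also have "\<dots> = (\<Sum>i\<in>insert s {t+1..n}. u (\<rho>(s := \<rho> i)))"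
    unfolding sum.reindex[OF inj_on_subset[OF inj subset_UNIV]] comp_def ..
  also have "\<dots> = (\<Sum>i\<in>insert s {t+1..n}. u (\<rho> \<circ> tp s i))"
  proof (rule sum.cong[OF refl])
    fix i assume "i \<in> insert s {t+1..n}"
    then show "u (\<rho>(s := \<rho> i)) = u (\<rho> \<circ> tp s i)"
      by (intro depends_onD[OF u]) (auto simp: Transposition.transpose_def)
  qed
  finally show ?thesis using s by simp
qed

lemma card_fixing: "d \<le> n \<Longrightarrow> card (fixing n d) = fact (n - d)"
  unfolding fixing_def by (subst card_permutations[of "{d+1..n}" "n - d"]) auto

text \<open>Let w be the sum that purity requires to vanish. It is a function of t - 1 points, hence
  orthogonal to u. But w is a sum of right translates of u by transpositions that leave w unchanged,
  hence it is orthogonal to itself as well.\<close>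

lemma pure_if_orthogonal_to_fewer_points:
  assumes u: "depends_on {1..t} u" and t: "t + 2 \<le> n" and \<iota>: "\<iota> \<in> Sy n"
    and ug: "\<And>\<sigma>. \<sigma> \<in> Al n \<Longrightarrow> u (\<sigma> \<circ> \<iota>) = g \<sigma>"
    and orth: "\<And>\<iota>' \<phi>. \<iota>' \<in> Sy n \<Longrightarrow> depends_on {1..t - 1} \<phi> \<Longrightarrow> avg (Al n) (\<lambda>\<sigma>. g \<sigma> * \<phi> (\<sigma> \<circ> \<iota>')) = 0"
  shows "pure n t u"
  unfolding pure_def
proof (intro conjI ballI u)
  fix \<rho> s assume \<rho>: "\<rho> \<in> Sy n" and s: "s \<in> {1..t}"
  define w where "w = swap_sum n t u s"
  have w: "depends_on ({1..t} - {s}) w" unfolding w_def by (rule depends_on_swap_sum[OF u])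
  have wt: "depends_on {1..t} w" by (rule depends_on_mono[OF w]) auto
  have weq: "w \<rho> = (\<Sum>i\<in>insert s {t+1..n}. u (\<rho> \<circ> tp s i))" if "\<rho> \<in> Sy n" for \<rho>
    unfolding w_def using swap_sum_eq[OF u s _ that] t s by simp
  have "avg (Sy n) (\<lambda>\<rho>. u \<rho> * w \<rho>) = 0"
  proof -
    have uw: "depends_on {1..t} (\<lambda>x. u x * w x)"
      using u wt unfolding depends_on_def by metis
    have "avg (Sy n) (\<lambda>\<rho>. u \<rho> * w \<rho>) = avg (Al n) (\<lambda>x. u (x \<circ> \<iota>) * w (x \<circ> \<iota>))"
      using t by (intro avg_Al_comp_eq_avg_Sy[OF uw _ _ \<iota>, symmetric]) auto
    \<comment> \<open>The transposition moves the free slot s to the end, so that the test function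
      reads only the slots 1, ..., t - 1.\<close>
    also have "\<dots> = avg (Al n) (\<lambda>\<sigma>. g \<sigma> * (\<lambda>x. w (x \<circ> tp s t)) (\<sigma> \<circ> (\<iota> \<circ> tp s t)))"
      using ug by (intro avg_cong) (simp add: comp_assoc)
    also have "\<dots> = 0"
    proof (rule orth)
      show "\<iota> \<circ> tp s t \<in> Sy n" using s t by (intro Sy_comp[OF \<iota>] transpose_in_Sy) auto
      have "depends_on (tp s t ` ({1..t} - {s})) (\<lambda>x. w (x \<circ> tp s t))" by (rule depends_on_comp[OF w])
      moreover have "tp s t ` ({1..t} - {s}) \<subseteq> {1..t - 1}"
        using s by (auto simp: Transposition.transpose_def)
      ultimately show "depends_on {1..t - 1} (\<lambda>x. w (x \<circ> tp s t))" by (rule depends_on_mono)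
    qed
    finally show ?thesis .
  qed
  moreover have "avg (Sy n) (\<lambda>\<rho>. w \<rho> * w \<rho>) = (\<Sum>i\<in>insert s {t+1..n}. avg (Sy n) (\<lambda>\<rho>. u \<rho> * w \<rho>))"
  proof -
    have "avg (Sy n) (\<lambda>\<rho>. w \<rho> * w \<rho>) = avg (Sy n) (\<lambda>\<rho>. \<Sum>i\<in>insert s {t+1..n}. u (\<rho> \<circ> tp s i) * w \<rho>)"
    proof (rule avg_cong)
      fix x assume "x \<in> Sy n"
      from weq[OF this] show "w x * w x = (\<Sum>i\<in>insert s {t+1..n}. u (x \<circ> tp s i) * w x)"
        by (simp add: sum_distrib_right distrib_right)
    qed
    also have "\<dots> = (\<Sum>i\<in>insert s {t+1..n}. avg (Sy n) (\<lambda>\<rho>. u (\<rho> \<circ> tp s i) * w \<rho>))"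
      by (rule avg_sum)
    also have "\<dots> = (\<Sum>i\<in>insert s {t+1..n}. avg (Sy n) (\<lambda>\<rho>. u \<rho> * w \<rho>))"
    proof (rule sum.cong[OF refl])
      fix i assume i: "i \<in> insert s {t+1..n}"
      have ts: "tp s i \<in> Sy n" using i s t by (intro transpose_in_Sy) auto
      have "w (\<rho> \<circ> tp s i) = w \<rho>" for \<rho>
        using i by (intro depends_onD[OF w]) (auto simp: Transposition.transpose_def)
      then show "avg (Sy n) (\<lambda>\<rho>. u (\<rho> \<circ> tp s i) * w \<rho>) = avg (Sy n) (\<lambda>\<rho>. u \<rho> * w \<rho>)"
        using avg_Sy_right[OF ts, of "\<lambda>\<rho>. u \<rho> * w \<rho>"] by simp
    qed
    finally show ?thesis .
  qed
  ultimately have "ip (Sy n) w w = 0" by (simp add: ip_def)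
  from ip_self_eq_0D[OF finite_Sy this \<rho>] weq[OF \<rho>] s
  show "u \<rho> + (\<Sum>i\<in>{t+1..n}. u (\<rho> \<circ> tp s i)) = 0" by simp
qed

lemma Kop_square_le:
  assumes e: "orthonormal (Sy n) K e" and exp: "\<And>x. x \<in> Sy n \<Longrightarrow> v x = (\<Sum>i<K. ip (Sy n) v (e i) * e i x)"
    and \<iota>: "\<iota> \<in> Sy n"
  shows "(Kop n f v \<iota>)\<^sup>2 \<le> ip (Sy n) v v * (\<Sum>i<K. (Kop n f (e i) \<iota>)\<^sup>2)"
proof -
  have "Kop n f v \<iota> = avg (Al n) (\<lambda>\<tau>. f \<tau> * (\<Sum>i<K. ip (Sy n) v (e i) * e i (\<tau> \<circ> \<iota>)))"
    unfolding Kop_def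
  proof (rule avg_cong)
    fix \<tau> assume "\<tau> \<in> Al n"
    from exp[OF Sy_comp[OF Al_Sy[OF this] \<iota>]]
    show "f \<tau> * v (\<tau> \<circ> \<iota>) = f \<tau> * (\<Sum>i<K. ip (Sy n) v (e i) * e i (\<tau> \<circ> \<iota>))" by (rule arg_cong)
  qed
  also have "\<dots> = (\<Sum>i<K. ip (Sy n) v (e i) * Kop n f (e i) \<iota>)"
    by (simp add: Kop_def sum_distrib_left avg_sum mult.left_commute[of "f _"] avg_cmult)
  finally have "(Kop n f v \<iota>)\<^sup>2 \<le> (\<Sum>i<K. (ip (Sy n) v (e i))\<^sup>2) * (\<Sum>i<K. (Kop n f (e i) \<iota>)\<^sup>2)"
    using Cauchy_Schwarz_ineq_sum[of "\<lambda>i. ip (Sy n) v (e i)" "\<lambda>i. Kop n f (e i) \<iota>" "{..<K}"] by simp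
  also have "\<dots> \<le> ip (Sy n) v v * (\<Sum>i<K. (Kop n f (e i) \<iota>)\<^sup>2)"
    by (intro mult_right_mono Bessel[OF e] sum_nonneg) auto
  finally show "(Kop n f v \<iota>)\<^sup>2 \<le> ip (Sy n) v v * (\<Sum>i<K. (Kop n f (e i) \<iota>)\<^sup>2)" .
qed

text \<open>
  Both sides are right invariant quadratic forms, so it is enough to compare them on one eigenspace.
  Take an element of it that correlates with a function of \<open>t\<close> points, with \<open>t\<close> minimal. Its average over the
  stabilizer of these points stays in the eigenspace and is pure of level \<open>t\<close>, so the summand \<open>d = t\<close> suffices.
\<close>

theorem low_norm_le:
  assumes D: "D + 2 \<le> n"
    and e: "\<And>d. d \<in> {1..D} \<Longrightarrow> orthonormal (Sy n) (K d) (e d)"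
      "\<And>d v x. d \<in> {1..D} \<Longrightarrow> pure n d v \<Longrightarrow> x \<in> Sy n \<Longrightarrow> v x = (\<Sum>i<K d. ip (Sy n) v (e d i) * e d i x)"
    and g: "\<And>h. h \<in> high n D \<Longrightarrow> ip (Al n) g h = 0" "avg (Al n) g = 0"
  shows "ip (Al n) g g \<le> (\<Sum>d\<in>{1..D}. fact n / fact (n - d) * (\<Sum>i<K d. sqnorm (Sy n) (Kop n g (e d i))))"
proof -
  define P where "P = {g. (\<forall>h\<in>high n D. ip (Al n) g h = 0) \<and> avg (Al n) g = 0}"
  have P: "fsubspace P"
    unfolding fsubspace_def P_def by (auto simp: ip_lin avg_add avg_cmult) (auto simp: ip_def avg_def)
  define B where "B = (\<lambda>g h. \<Sum>d\<in>{1..D}. fact n / fact (n - d) * (\<Sum>i<K d. avg (Sy n) (\<lambda>\<iota>. Kop n g (e d i) \<iota> * Kop n h (e d i) \<iota>)))"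
  \<comment> \<open>With the sign reversed, the maximum of Q / ip is minus the minimum of B / ip. If
    B \<ge> ip at one nonzero minimizer, then B \<ge> ip on all of P.\<close>
  define Q where "Q = (\<lambda>g h. - B g h)"
  have Klin: "Kop n (\<lambda>x. a * g x + b * h x) v \<iota> = a * Kop n g v \<iota> + b * Kop n h v \<iota>" for a b g h v \<iota>
    by (simp add: Kop_def distrib_right mult.assoc avg_add avg_cmult)
  have bil: "bilinear_form (Al n) Q"
    unfolding bilinear_form_def
  proof (intro conjI allI impI)
    fix g h k a b
    have "B (\<lambda>x. a * g x + b * h x) k = a * B g k + b * B h k"
      unfolding B_def Klin
      by (simp add: distrib_right distrib_left mult.assoc avg_add avg_cmult sum.distrib sum_distrib_left mult.left_commute)
    then show "Q (\<lambda>x. a * g x + b * h x) k = a * Q g k + b * Q h k"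
      by (simp add: Q_def)
    show "Q g h = Q h g" by (simp add: Q_def B_def mult.commute)
  next
    fix g g' h :: "(nat \<Rightarrow> nat) \<Rightarrow> real" assume "\<forall>x\<in>Al n. g x = g' x"
    then have "Kop n g v \<iota> = Kop n g' v \<iota>" for v \<iota> unfolding Kop_def by (intro avg_cong) simp
    then show "Q g h = Q g' h" by (simp add: Q_def B_def)
  qed
  have Bself: "B g g = (\<Sum>d\<in>{1..D}. fact n / fact (n - d) * (\<Sum>i<K d. sqnorm (Sy n) (Kop n g (e d i))))" for g
    by (simp add: B_def power2_eq_square)
  have K_rt: "Kop n (\<lambda>\<sigma>. g (\<sigma> \<circ> a)) v \<iota> = Kop n g v (inv' a \<circ> \<iota>)" if a: "a \<in> Al n" for g a v \<iota>
  proof -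
    have "Kop n (\<lambda>\<sigma>. g (\<sigma> \<circ> a)) v \<iota> = avg (Al n) (\<lambda>\<sigma>. g (\<sigma> \<circ> a) * v (\<sigma> \<circ> a \<circ> (inv' a \<circ> \<iota>)))"
      unfolding Kop_def by (simp only: comp_assoc Sy_inv_comp_assoc[OF Al_Sy[OF a]])
    then show ?thesis
      unfolding Kop_def using avg_Al_right[OF a, of "\<lambda>\<sigma>. g \<sigma> * v (\<sigma> \<circ> (inv' a \<circ> \<iota>))"] by simp
  qed
  have Q_rt: "Q (\<lambda>\<sigma>. g (\<sigma> \<circ> a)) (\<lambda>\<sigma>. g (\<sigma> \<circ> a)) = Q g g" if a: "a \<in> Al n" for g a
  proof -
    have "avg (Sy n) (\<lambda>\<iota>. (Kop n g v (inv' a \<circ> \<iota>))\<^sup>2) = avg (Sy n) (\<lambda>\<iota>. (Kop n g v \<iota>)\<^sup>2)" for v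
      by (rule avg_Sy_left[OF Sy_inv[OF Al_Sy[OF a]], of "\<lambda>\<iota>. (Kop n g v \<iota>)\<^sup>2"])
    then show ?thesis unfolding Q_def Bself K_rt[OF a] by simp
  qed
  have ip_rt: "ip (Al n) (\<lambda>\<sigma>. g (\<sigma> \<circ> a)) (\<lambda>\<sigma>. g (\<sigma> \<circ> a)) = ip (Al n) g g" if a: "a \<in> Al n" for g a
    unfolding ip_def by (rule avg_Al_right[OF a, of "\<lambda>\<sigma>. g \<sigma> * g \<sigma>"])
  have P_rt: "(\<lambda>\<sigma>. g (\<sigma> \<circ> a)) \<in> P" if g: "g \<in> P" and a: "a \<in> Al n" for g a
  proof -
    have "ip (Al n) (\<lambda>\<sigma>. g (\<sigma> \<circ> a)) h = 0" if h: "h \<in> high n D" for h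
    proof -
      have "ip (Al n) (\<lambda>\<sigma>. g (\<sigma> \<circ> a)) h = ip (Al n) (\<lambda>\<sigma>. g (\<sigma> \<circ> a)) (\<lambda>\<sigma>. h (\<sigma> \<circ> a \<circ> inv' a))"
        by (simp only: Sy_inv_comp_assoc[OF Al_Sy[OF a]])
      also have "\<dots> = ip (Al n) g (\<lambda>\<sigma>. h (\<sigma> \<circ> inv' a))"
        unfolding ip_def by (rule avg_Al_right[OF a, of "\<lambda>\<sigma>. g \<sigma> * h (\<sigma> \<circ> inv' a)"])
      also have "\<dots> = 0" using g high_right_translate[OF h Al_inv[OF a]] by (simp add: P_def)
      finally show ?thesis .
    qed
    moreover have "avg (Al n) (\<lambda>\<sigma>. g (\<sigma> \<circ> a)) = 0" using g avg_Al_right[OF a, of g] by (simp add: P_def)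
    ultimately show ?thesis by (simp add: P_def)
  qed
  have gP: "g \<in> P" using g by (simp add: P_def)
  have B0: "0 \<le> B h h" for h unfolding Bself by (intro sum_nonneg mult_nonneg_nonneg avg_nonneg) auto
  have "ip (Al n) g g \<le> B g g"
  proof (cases "\<exists>g\<in>P. ip (Al n) g g \<noteq> 0")
    case False
    then show ?thesis using gP B0[of g] by auto
  next
    case True
    obtain \<mu> where \<mu>: "\<And>g. g \<in> P \<Longrightarrow> Q g g \<le> \<mu> * ip (Al n) g g"
      "fsubspace {g\<in>P. Q g g = \<mu> * ip (Al n) g g}" "\<exists>g\<in>P. Q g g = \<mu> * ip (Al n) g g \<and> ip (Al n) g g \<noteq> 0"
      by (rule max_eigenspace[OF finite_Al Al_nonempty P bil True]) blast
    define E where "E = {g\<in>P. Q g g = \<mu> * ip (Al n) g g}"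
    have E: "fsubspace E" using \<mu>(2) by (simp only: E_def)
    have E_rt: "(\<lambda>\<sigma>. g (\<sigma> \<circ> a)) \<in> E" if "g \<in> E" "a \<in> Al n" for g a
      using that P_rt[of g a] by (simp add: E_def Q_rt ip_rt)
    let ?orth = "\<lambda>t. \<forall>g\<in>E. \<forall>\<iota>\<in>Sy n. \<forall>\<phi>. depends_on {1..t} \<phi> \<longrightarrow> avg (Al n) (\<lambda>\<sigma>. g \<sigma> * \<phi> (\<sigma> \<circ> \<iota>)) = 0"
    have "\<not> ?orth D"
    proof
      assume o: "?orth D"
      obtain g where g: "g \<in> E" "ip (Al n) g g \<noteq> 0" using \<mu>(3) by (auto simp: E_def)
      have "g \<in> high n D" using o g(1) unfolding high_def by blast
      then have "ip (Al n) g g = 0" using g(1) by (simp add: E_def P_def)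
      then show False using g(2) by simp
    qed
    then have "\<exists>t\<le>D. (\<forall>i<t. ?orth i) \<and> \<not> ?orth t"
      using ex_least_nat_le[of "\<lambda>t. \<not> ?orth t" D] by blast
    then obtain t where t: "t \<le> D" "\<forall>i<t. ?orth i" "\<not> ?orth t" by blast
    from t(3) obtain g\<^sub>0 \<iota> \<phi> where g0: "g\<^sub>0 \<in> E" "\<iota> \<in> Sy n" "depends_on {1..t} \<phi>"
      "avg (Al n) (\<lambda>\<sigma>. g\<^sub>0 \<sigma> * \<phi> (\<sigma> \<circ> \<iota>)) \<noteq> 0" by blast
    have "t \<noteq> 0"
    proof
      assume "t = 0"
      then have \<phi>: "\<phi> x = \<phi> id" for x using g0(3) by (auto simp: depends_on_def)
      have "avg (Al n) (\<lambda>\<sigma>. g\<^sub>0 \<sigma> * \<phi> (\<sigma> \<circ> \<iota>)) = avg (Al n) (\<lambda>\<sigma>. g\<^sub>0 \<sigma> * \<phi> id)"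
        by (intro avg_cong arg_cong2[where f = "(*)"] refl \<phi>)
      also have "\<dots> = avg (Al n) g\<^sub>0 * \<phi> id" by (rule avg_cmult_right)
      finally have "avg (Al n) (\<lambda>\<sigma>. g\<^sub>0 \<sigma> * \<phi> (\<sigma> \<circ> \<iota>)) = avg (Al n) g\<^sub>0 * \<phi> id" .
      then show False using g0(1,4) by (simp add: E_def P_def)
    qed
    then have t1: "t \<in> {1..D}" "t + 2 \<le> n" "t - 1 < t" using t D by auto
    let ?H = "stab n (\<iota> ` {1..t})"
    have Hfin: "finite ?H" "?H \<noteq> {}"
      by (auto simp: stab_def intro!: exI[of _ id])
    define g' where "g' = (\<lambda>\<sigma>. avg ?H (\<lambda>h. g\<^sub>0 (\<sigma> \<circ> h)))"
    have g'E: "g' \<in> E" unfolding g'_def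
      using E_rt[OF g0(1)] stab_Al by (intro fsubspace_avg[OF E]) blast
    have g'inv: "g' (\<sigma> \<circ> h) = g' \<sigma>" if "h \<in> ?H" for h \<sigma>
      unfolding g'_def using avg_stab_right[OF that, of "\<lambda>x. g\<^sub>0 (\<sigma> \<circ> x)"] by (simp add: comp_assoc)
    have "avg (Al n) (\<lambda>\<sigma>. g' \<sigma> * \<phi> (\<sigma> \<circ> \<iota>)) = avg ?H (\<lambda>h. avg (Al n) (\<lambda>\<sigma>. g\<^sub>0 (\<sigma> \<circ> h) * \<phi> (\<sigma> \<circ> \<iota>)))"
      unfolding g'_def avg_cmult_right[symmetric] by (rule avg_swap)
    also have "\<dots> = avg ?H (\<lambda>h. avg (Al n) (\<lambda>\<sigma>. g\<^sub>0 \<sigma> * \<phi> (\<sigma> \<circ> \<iota>)))"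
    proof (rule avg_cong)
      fix h assume h: "h \<in> ?H"
      have "\<phi> (\<sigma> \<circ> h \<circ> \<iota>) = \<phi> (\<sigma> \<circ> \<iota>)" for \<sigma>
        using h by (intro depends_onD[OF g0(3)]) (auto simp: stab_def)
      then show "avg (Al n) (\<lambda>\<sigma>. g\<^sub>0 (\<sigma> \<circ> h) * \<phi> (\<sigma> \<circ> \<iota>)) = avg (Al n) (\<lambda>\<sigma>. g\<^sub>0 \<sigma> * \<phi> (\<sigma> \<circ> \<iota>))"
        using avg_Al_right[OF stab_Al[OF h], of "\<lambda>\<sigma>. g\<^sub>0 \<sigma> * \<phi> (\<sigma> \<circ> \<iota>)"] by simp
    qed
    also have "\<dots> = avg (Al n) (\<lambda>\<sigma>. g\<^sub>0 \<sigma> * \<phi> (\<sigma> \<circ> \<iota>))" by (rule avg_const[OF Hfin])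
    finally have g'\<phi>: "avg (Al n) (\<lambda>\<sigma>. g' \<sigma> * \<phi> (\<sigma> \<circ> \<iota>)) \<noteq> 0" using g0(4) by simp
    have nz: "ip (Al n) g' g' \<noteq> 0"
    proof
      assume "ip (Al n) g' g' = 0"
      then have "avg (Al n) (\<lambda>\<sigma>. g' \<sigma> * \<phi> (\<sigma> \<circ> \<iota>)) = avg (Al n) (\<lambda>\<sigma>. 0)"
        using ip_self_eq_0D[OF finite_Al, of n g'] by (intro avg_cong) simp
      then show False using g'\<phi> by (simp add: avg_const)
    qed
    then have pos: "0 < ip (Al n) g' g'" using ip_nonneg[of "Al n" g'] by simp
    obtain u where u: "depends_on {1..t} u" "\<And>\<sigma>. \<sigma> \<in> Al n \<Longrightarrow> u (\<sigma> \<circ> \<iota>) = g' \<sigma>"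
      using factor_through_restriction[OF g0(2), of t g'] g'inv by metis
    have orth: "avg (Al n) (\<lambda>\<sigma>. g' \<sigma> * \<psi> (\<sigma> \<circ> \<iota>')) = 0" if "\<iota>' \<in> Sy n" "depends_on {1..t - 1} \<psi>" for \<iota>' \<psi>
      using t(2) t1(3) g'E that by blast
    have pure: "pure n t u"
      by (rule pure_if_orthogonal_to_fewer_points[OF u(1) t1(2) g0(2) u(2) orth])
    have uu: "ip (Sy n) u u = ip (Al n) g' g'"
    proof -
      have "ip (Sy n) u u = avg (Al n) (\<lambda>x. (u (x \<circ> \<iota>))\<^sup>2)"
        unfolding ip_self using t1
        by (intro avg_Al_comp_eq_avg_Sy[OF depends_on_power[OF u(1)] _ _ g0(2), symmetric]) auto
      also have "\<dots> = ip (Al n) g' g'" unfolding ip_self using u(2) by (intro avg_cong) simp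
      finally show ?thesis .
    qed
    \<comment> \<open>Pairing g' with its own factorization u returns the square norm of g', so the
      functions \<open>Kop n g' (e t i)\<close> are large at \<iota>. The same holds at \<iota>
      \<circ> h for (n - t)! permutations h, a proportion (n - t)! / n! of the symmetric group; this
      is the origin of the weights in the statement.\<close>
    have S: "ip (Al n) g' g' \<le> (\<Sum>i<K t. (Kop n g' (e t i) (\<iota> \<circ> h))\<^sup>2)" if h: "h \<in> fixing n t" for h
    proof -
      have \<iota>h: "\<iota> \<circ> h \<in> Sy n" by (rule Sy_comp[OF g0(2) fixing_Sy[OF h]])
      have "u (\<sigma> \<circ> (\<iota> \<circ> h)) = g' \<sigma>" if "\<sigma> \<in> Al n" for \<sigma>
      proof -
        have "u (\<sigma> \<circ> (\<iota> \<circ> h)) = u (\<sigma> \<circ> \<iota>)" using fixing_fix[OF h] by (intro depends_onD[OF u(1)]) auto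
        then show ?thesis using u(2)[OF that] by simp
      qed
      then have "ip (Al n) g' g' = Kop n g' u (\<iota> \<circ> h)"
        unfolding ip_def Kop_def by (intro avg_cong) simp
      then have "(ip (Al n) g' g')\<^sup>2 \<le> ip (Al n) g' g' * (\<Sum>i<K t. (Kop n g' (e t i) (\<iota> \<circ> h))\<^sup>2)"
        using Kop_square_le[OF e(1)[OF t1(1)] e(2)[OF t1(1) pure] \<iota>h, of g'] uu by simp
      then show ?thesis using pos by (simp add: power2_eq_square)
    qed
    have "ip (Al n) g' g' \<le> fact n / fact (n - t) * (\<Sum>i<K t. sqnorm (Sy n) (Kop n g' (e t i)))"
    proof -
      let ?s = "\<lambda>\<iota>. \<Sum>i<K t. (Kop n g' (e t i) \<iota>)\<^sup>2"
      have inj: "inj_on (\<lambda>h. \<iota> \<circ> h) (fixing n t)"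
        by (rule inj_on_inverseI[where g = "\<lambda>x. inv' \<iota> \<circ> x"]) (simp only: Sy_inv_comp_assoc[OF g0(2)])
      have "fact (n - t) * ip (Al n) g' g' = (\<Sum>h\<in>fixing n t. ip (Al n) g' g')"
        using t1 by (simp add: card_fixing)
      also have "\<dots> \<le> (\<Sum>h\<in>fixing n t. ?s (\<iota> \<circ> h))" by (rule sum_mono[OF S])
      also have "\<dots> = sum ?s ((\<lambda>h. \<iota> \<circ> h) ` fixing n t)" using sum.reindex[OF inj, of ?s] by simp
      also have "\<dots> \<le> sum ?s (Sy n)"
        using Sy_comp[OF g0(2) fixing_Sy] by (intro sum_mono2) (auto intro: sum_nonneg)
      also have "\<dots> = fact n * avg (Sy n) ?s"
      proof -
        have "card (Sy n) = fact n" unfolding Sy_def by (rule card_permutations) auto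
        then show ?thesis by (simp add: avg_def)
      qed
      also have "avg (Sy n) ?s = (\<Sum>i<K t. sqnorm (Sy n) (Kop n g' (e t i)))" by (rule avg_sum)
      finally show ?thesis by (simp add: pos_le_divide_eq mult.commute)
    qed
    also have "\<dots> \<le> B g' g'"
      unfolding Bself using t1(1)
      by (intro member_le_sum[of t "{1..D}" "\<lambda>d. fact n / fact (n - d) * (\<Sum>i<K d. sqnorm (Sy n) (Kop n g' (e d i)))"])
        (auto intro!: divide_nonneg_nonneg mult_nonneg_nonneg sum_nonneg avg_nonneg)
    also have "\<dots> = - \<mu> * ip (Al n) g' g'" using g'E by (simp add: E_def Q_def)
    finally have "1 * ip (Al n) g' g' \<le> - \<mu> * ip (Al n) g' g'" by simp
    then have "1 \<le> - \<mu>" using pos by (rule mult_right_le_imp_le)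
    then have "ip (Al n) g g \<le> - \<mu> * ip (Al n) g g"
      using mult_right_mono[of 1 "- \<mu>" "ip (Al n) g g"] ip_nonneg[of "Al n" g] by simp
    also have "\<dots> \<le> B g g" using \<mu>(1)[OF gP] by (simp add: Q_def)
    finally show ?thesis .
  qed
  then show ?thesis by (simp only: Bself)
qed

section \<open>Convolution powers\<close>

text \<open>The operators compose in the order opposite to the factors, which is harmless for powers
  of one density.\<close>

lemma Kop_conv: "Kop n (conv n f g) e \<iota> = Kop n g (Kop n f e) \<iota>"
proof -
  have "Kop n (conv n f g) e \<iota> = avg (Al n) (\<lambda>\<tau>. f \<tau> * avg (Al n) (\<lambda>\<sigma>. g \<sigma> * e (\<tau> \<circ> \<sigma> \<circ> \<iota>)))"
    unfolding Kop_def avg_conv_mult ..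
  also have "\<dots> = avg (Al n) (\<lambda>\<tau>. avg (Al n) (\<lambda>\<sigma>. g \<sigma> * (f \<tau> * e (\<tau> \<circ> (\<sigma> \<circ> \<iota>)))))"
    by (simp add: avg_cmult[symmetric] mult.left_commute comp_assoc)
  also have "\<dots> = avg (Al n) (\<lambda>\<sigma>. avg (Al n) (\<lambda>\<tau>. g \<sigma> * (f \<tau> * e (\<tau> \<circ> (\<sigma> \<circ> \<iota>)))))"
    by (rule avg_swap)
  finally show ?thesis by (simp only: Kop_def avg_cmult)
qed

lemma Kop_norm_le:
  assumes exp: "\<And>x. x \<in> Sy n \<Longrightarrow> v x = (\<Sum>i<K. ip (Sy n) v (e i) * e i x)"
    and e: "orthonormal (Sy n) K e"
  shows "sqnorm (Sy n) (Kop n f v) \<le> (\<Sum>i<K. sqnorm (Sy n) (Kop n f (e i))) * ip (Sy n) v v"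
proof -
  have "sqnorm (Sy n) (Kop n f v) \<le> avg (Sy n) (\<lambda>\<iota>. ip (Sy n) v v * (\<Sum>i<K. (Kop n f (e i) \<iota>)\<^sup>2))"
    by (intro avg_mono Kop_square_le[OF e exp])
  also have "\<dots> = (\<Sum>i<K. sqnorm (Sy n) (Kop n f (e i))) * ip (Sy n) v v"
    by (simp add: avg_cmult avg_sum mult.commute)
  finally show ?thesis .
qed

text \<open>On pure functions the squared Hilbert-Schmidt norm H bounds the squared operator norm.
  Of the m + 1 composed operators, m are estimated by the operator norm and one by the
  Hilbert-Schmidt norm.\<close>

lemma level_weight_conv_power:
  fixes f :: "(nat \<Rightarrow> nat) \<Rightarrow> real" and e :: "nat \<Rightarrow> (nat \<Rightarrow> nat) \<Rightarrow> real"
  assumes e: "orthonormal (Sy n) K e" "\<And>i. i < K \<Longrightarrow> pure n d (e i)"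
    and exp: "\<And>v x. pure n d v \<Longrightarrow> x \<in> Sy n \<Longrightarrow> v x = (\<Sum>i<K. ip (Sy n) v (e i) * e i x)"
  defines "H \<equiv> (\<Sum>i<K. sqnorm (Sy n) (Kop n f (e i)))"
  shows "(\<Sum>i<K. sqnorm (Sy n) (Kop n ((conv n f ^^ m) f) (e i))) \<le> H ^ Suc m"
proof -
  have H0: "0 \<le> H" unfolding H_def by (intro sum_nonneg avg_nonneg) auto
  have one: "sqnorm (Sy n) (Kop n f v) \<le> H * ip (Sy n) v v" if "pure n d v" for v
    unfolding H_def by (rule Kop_norm_le[OF exp[OF that] e(1)])
  have many: "sqnorm (Sy n) (Kop n ((conv n f ^^ m) f) v) \<le> H ^ Suc m * ip (Sy n) v v" if "pure n d v" for v m
    using that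
  proof (induction m arbitrary: v)
    case 0
    then show ?case using one[of v] by simp
  next
    case (Suc m)
    have "sqnorm (Sy n) (Kop n ((conv n f ^^ Suc m) f) v)
        = sqnorm (Sy n) (Kop n ((conv n f ^^ m) f) (Kop n f v))"
      by (simp add: Kop_conv)
    also have "\<dots> \<le> H ^ Suc m * ip (Sy n) (Kop n f v) (Kop n f v)"
      by (rule Suc.IH[OF pure_Kop[OF Suc.prems]])
    also have "\<dots> \<le> H ^ Suc m * (H * ip (Sy n) v v)"
      using one[OF Suc.prems] H0 unfolding ip_self by (intro mult_left_mono) auto
    finally show ?case by (simp add: mult_ac)
  qed
  show ?thesis
  proof (cases m)
    case 0
    then show ?thesis by (simp add: H_def)
  next
    case (Suc m')
    have "(\<Sum>i<K. sqnorm (Sy n) (Kop n ((conv n f ^^ m) f) (e i)))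
       = (\<Sum>i<K. sqnorm (Sy n) (Kop n ((conv n f ^^ m') f) (Kop n f (e i))))"
      by (simp add: Suc Kop_conv)
    also have "\<dots> \<le> (\<Sum>i<K. H ^ Suc m' * ip (Sy n) (Kop n f (e i)) (Kop n f (e i)))"
      using e(2) by (intro sum_mono many pure_Kop) auto
    also have "\<dots> = H ^ Suc m' * H"
      unfolding H_def ip_self by (simp add: sum_distrib_left)
    finally show ?thesis by (simp add: Suc mult_ac)
  qed
qed

section \<open>The high part of convolution powers\<close>

lemma high_left_translate:
  assumes h: "h \<in> high n D" and \<tau>: "\<tau> \<in> Al n"
  shows "(\<lambda>\<sigma>. h (\<tau> \<circ> \<sigma>)) \<in> high n D"
  unfolding high_def
proof (intro CollectI ballI allI impI)
  fix \<iota> \<phi> assume \<iota>: "\<iota> \<in> Sy n" and \<phi>: "depends_on {1..D} \<phi>"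
  have dep: "depends_on {1..D} (\<lambda>x. \<phi> (inv' \<tau> \<circ> x))"
    using \<phi> by (auto simp: depends_on_def)
  have "avg (Al n) (\<lambda>\<sigma>. h (\<tau> \<circ> \<sigma>) * \<phi> (\<sigma> \<circ> \<iota>)) = avg (Al n) (\<lambda>\<sigma>. h (\<tau> \<circ> \<sigma>) * \<phi> (inv' \<tau> \<circ> (\<tau> \<circ> \<sigma> \<circ> \<iota>)))"
    by (simp only: comp_assoc Sy_inv_comp_assoc[OF Al_Sy[OF \<tau>]])
  also have "\<dots> = avg (Al n) (\<lambda>\<sigma>. h \<sigma> * \<phi> (inv' \<tau> \<circ> (\<sigma> \<circ> \<iota>)))"
    by (rule avg_Al_left[OF \<tau>, of "\<lambda>\<sigma>. h \<sigma> * \<phi> (inv' \<tau> \<circ> (\<sigma> \<circ> \<iota>))"])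
  also have "\<dots> = 0" by (rule highD[OF h \<iota> dep])
  finally show "avg (Al n) (\<lambda>\<sigma>. h (\<tau> \<circ> \<sigma>) * \<phi> (\<sigma> \<circ> \<iota>)) = 0" .
qed

lemma conv_diff: "conv n f (\<lambda>x. g x - h x) \<sigma> = conv n f g \<sigma> - conv n f h \<sigma>"
  by (simp add: conv_def right_diff_distrib avg_diff)

text \<open>p is the projection of the power to \<open>high\<close>. Left and right invariance make
  convolution preserve \<open>high\<close> and its orthogonal complement, so the next projection is
  \<open>conv n f p\<close>; each step costs a factor of at most A / 2 ^ j.\<close>

lemma conv_power_high_part:
  fixes f :: "(nat \<Rightarrow> nat) \<Rightarrow> real"
  assumes n: "4 * j < n"
  defines "A \<equiv> sqnorm (Al n) f"
  shows "\<exists>p\<in>high n (4 * j). (\<forall>v\<in>high n (4 * j). ip (Al n) (\<lambda>x. (conv n f ^^ m) f x - p x) v = 0) \<and>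
    (2 ^ j) ^ m * ip (Al n) p p \<le> A ^ Suc m"
proof (induction m)
  case 0
  obtain p where p: "p \<in> high n (4 * j)" "\<And>v. v \<in> high n (4 * j) \<Longrightarrow> ip (Al n) (\<lambda>x. f x - p x) v = 0"
    using orthogonal_projection_exists[OF finite_Al Al_nonempty fsubspace_high, where g = f] by metis
  have "ip (Al n) f p = ip (Al n) p p" using p(2)[OF p(1)] by (simp add: ip_diff)
  then have "ip (Al n) f f = ip (Al n) p p + ip (Al n) (\<lambda>x. f x - p x) (\<lambda>x. f x - p x)"
    by (simp add: ip_diff ip_diff_right ip_commute[of _ p f])
  then have "ip (Al n) p p \<le> A"
    using ip_nonneg[of "Al n" "\<lambda>x. f x - p x"] by (simp add: A_def flip: ip_self)
  then show ?case using p by (intro bexI[OF _ p(1)]) auto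
next
  case (Suc m)
  then obtain p where p: "p \<in> high n (4 * j)" "\<And>v. v \<in> high n (4 * j) \<Longrightarrow> ip (Al n) (\<lambda>x. (conv n f ^^ m) f x - p x) v = 0"
     "(2 ^ j) ^ m * ip (Al n) p p \<le> A ^ Suc m" by blast
  have A0: "0 \<le> A" unfolding A_def by (intro avg_nonneg) auto
  show ?case
  proof (intro bexI[OF _ high_conv[OF p(1)]] conjI ballI)
    fix v assume v: "v \<in> high n (4 * j)"
    have "ip (Al n) (\<lambda>x. (conv n f ^^ Suc m) f x - conv n f p x) v
        = avg (Al n) (\<lambda>\<sigma>. conv n f (\<lambda>x. (conv n f ^^ m) f x - p x) \<sigma> * v \<sigma>)"
      by (simp add: ip_def conv_diff)
    also have "\<dots> = avg (Al n) (\<lambda>\<tau>. f \<tau> * ip (Al n) (\<lambda>x. (conv n f ^^ m) f x - p x) (\<lambda>\<sigma>. v (\<tau> \<circ> \<sigma>)))"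
      unfolding avg_conv_mult ip_def ..
    also have "\<dots> = avg (Al n) (\<lambda>\<tau>. 0)"
      using p(2)[OF high_left_translate[OF v]] by (intro avg_cong) simp
    finally show "ip (Al n) (\<lambda>x. (conv n f ^^ Suc m) f x - conv n f p x) v = 0" by (simp add: avg_const)
  next
    have "(2 ^ j) ^ Suc m * ip (Al n) (conv n f p) (conv n f p) = (2 ^ j) ^ m * (2 ^ j * ip (Al n) (conv n f p) (conv n f p))"
      by simp
    also have "\<dots> \<le> (2 ^ j) ^ m * (A * ip (Al n) p p)"
      using conv_high_norm_le[OF p(1) n, of f] unfolding ip_self A_def by (intro mult_left_mono) auto
    also have "\<dots> = A * ((2 ^ j) ^ m * ip (Al n) p p)" by simp
    also have "\<dots> \<le> A * A ^ Suc m" using p(3) A0 by (rule mult_left_mono)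
    finally show "(2 ^ j) ^ Suc m * ip (Al n) (conv n f p) (conv n f p) \<le> A ^ Suc (Suc m)" by simp
  qed
qed

lemma avg_conv: "avg (Al n) (conv n f g) = avg (Al n) f * avg (Al n) g"
  using avg_conv_mult[of n f g "\<lambda>_. 1"] by (simp add: avg_cmult_right)

lemma avg_conv_power: "avg (Al n) f = 1 \<Longrightarrow> avg (Al n) ((conv n f ^^ m) f) = 1"
  by (induction m) (simp_all add: avg_conv)

lemma avg_pure_eq_0:
  assumes u: "pure n d u" and d: "d \<in> {1..n}"
  shows "avg (Sy n) u = 0"
proof -
  have "0 = avg (Sy n) (\<lambda>\<rho>. u \<rho> + (\<Sum>i\<in>{d+1..n}. u (\<rho> \<circ> tp 1 i)))"
    using u d by (subst avg_cong[of _ _ "\<lambda>_. 0"]) (auto simp: pure_def avg_const)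
  also have "\<dots> = avg (Sy n) u + (\<Sum>i\<in>{d+1..n}. avg (Sy n) (\<lambda>\<rho>. u (\<rho> \<circ> tp 1 i)))"
    by (simp only: avg_add avg_sum)
  also have "(\<Sum>i\<in>{d+1..n}. avg (Sy n) (\<lambda>\<rho>. u (\<rho> \<circ> tp 1 i))) = (\<Sum>i\<in>{d+1..n}. avg (Sy n) u)"
    using d by (intro sum.cong refl avg_Sy_right transpose_in_Sy) auto
  also have "avg (Sy n) u + \<dots> = (1 + real (n - d)) * avg (Sy n) u" by (simp add: algebra_simps)
  finally show ?thesis by (auto simp: add_pos_nonneg)
qed

text \<open>The least admissible k in \<open>level_weight_bound\<close> has k * d \<le> L + 1 + d.
  With N = n div 2 and the binomial coefficient at least (N / d) ^ d, the constant is 4 * 16 * 3 * 3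
  = 576, from 4 \<le> 4 ^ d, exp 1 \<le> 3 and N \<ge> n / 3.\<close>

lemma level_weight_le:
  fixes L r :: real
  assumes f: "\<And>\<sigma>. \<sigma> \<in> Al n \<Longrightarrow> 0 \<le> f \<sigma>" "avg (Al n) f = 1" "sqnorm (Al n) f \<le> exp (2 * L)"
    and glob: "global_at n (2 * d) r f" and L: "0 \<le> L"
    and n: "2 * d + 2 \<le> n" "6 * d \<le> n" "0 < d"
    and e: "orthonormal (Sy n) K e" "\<And>i. i < K \<Longrightarrow> pure n d (e i)"
  shows "(\<Sum>i<K. sqnorm (Sy n) (Kop n f (e i))) \<le> (600 * r\<^sup>2 * (L + 1 + real d) / real n) ^ d"
proof -
  define N where "N = n div 2"
  have N: "2 * N \<le> n" "d \<le> N" "real n / 3 \<le> real N" "0 < N" using n by (auto simp: N_def)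
  define k where "k = nat \<lceil>(L + 1) / real d\<rceil>"
  have kd: "(L + 1) / real d \<le> real k" unfolding k_def by (rule real_nat_ceiling_ge)
  have "0 < (L + 1) / real d" using L n by simp
  then have k0: "0 < k" using kd by (auto intro: gr0I)
  have k1: "L + 1 \<le> real k * real d" using kd n by (simp add: pos_divide_le_eq)
  have "real k \<le> (L + 1) / real d + 1"
    unfolding k_def using L by (simp add: of_nat_nat)
  then have k2: "real k * real d \<le> L + 1 + real d" using n by (simp add: field_simps)
  have e3: "exp (1::real) \<le> 3" by (rule exp_le)
  have "(\<Sum>i<K. sqnorm (Sy n) (Kop n f (e i)))
     \<le> 4 * ((4 * exp 1 * real k) ^ d * r ^ (2 * d) * 4 ^ d) / real (N choose d)"
    by (rule level_weight_bound[OF f glob n(1) N(1,2) n(2) k0 k1 e])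
  also have "\<dots> \<le> 4 * ((4 * exp 1 * real k) ^ d * r ^ (2 * d) * 4 ^ d) / (real N / real d) ^ d"
    using N n binomial_ge_n_over_k_pow_k[OF N(2), where 'a = real]
    by (intro divide_left_mono) (auto intro!: mult_nonneg_nonneg mult_pos_pos zero_le_power2 simp: power_mult)
  also have "\<dots> = 4 * (16 * exp 1 * r\<^sup>2 * (real k * real d) / real N) ^ d"
  proof -
    have "4 * ((4 * exp 1 * real k) ^ d * r ^ (2 * d) * 4 ^ d) / (real N / real d) ^ d
        = 4 * ((4 * exp 1 * real k) * r\<^sup>2 * 4 / (real N / real d)) ^ d"
      by (simp only: power_mult_distrib power_divide power_mult times_divide_eq_right)
    also have "(4 * exp 1 * real k) * r\<^sup>2 * 4 / (real N / real d) = 16 * exp 1 * r\<^sup>2 * (real k * real d) / real N"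
      by simp
    finally show ?thesis .
  qed
  also have "\<dots> \<le> 4 ^ d * (16 * 3 * r\<^sup>2 * (L + 1 + real d) / (real n / 3)) ^ d"
  proof (rule mult_mono)
    show "(4::real) \<le> 4 ^ d" using power_increasing[of 1 d "4::real"] n by simp
    show "(16 * exp 1 * r\<^sup>2 * (real k * real d) / real N) ^ d \<le> (16 * 3 * r\<^sup>2 * (L + 1 + real d) / (real n / 3)) ^ d"
    proof (intro power_mono frac_le)
      show "16 * exp 1 * r\<^sup>2 * (real k * real d) \<le> 16 * 3 * r\<^sup>2 * (L + 1 + real d)"
        using k2 L e3 by (intro mult_mono) auto
    qed (use N L n in auto)
  qed auto
  also have "\<dots> = (576 * r\<^sup>2 * (L + 1 + real d) / real n) ^ d"
    unfolding power_mult_distrib[symmetric] by (intro arg_cong[where f = "\<lambda>x. x ^ d"]) (simp add: field_simps)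
  also have "\<dots> \<le> (600 * r\<^sup>2 * (L + 1 + real d) / real n) ^ d"
    using L by (intro power_mono divide_right_mono mult_right_mono) auto
  finally show ?thesis .
qed

section \<open>Norms and contraction under convolution with a density\<close>

lemma Lp_norm_2: "Lp_norm 2 S f = sqrt (avg S (\<lambda>x. (f x)\<^sup>2))"
proof -
  have "avg S (\<lambda>x. \<bar>f x\<bar> powr 2) = avg S (\<lambda>x. (f x)\<^sup>2)"
    by (intro avg_cong) (simp add: powr_numeral)
  moreover have "0 \<le> avg S (\<lambda>x. (f x)\<^sup>2)" by (intro avg_nonneg) auto
  ultimately show ?thesis by (simp add: Lp_norm_def powr_half_sqrt)
qed

lemma Lp_norm_1_nonneg:
  assumes "\<And>x. x \<in> S \<Longrightarrow> 0 \<le> f x"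
  shows "Lp_norm 1 S f = avg S f"
proof -
  have "avg S (\<lambda>x. \<bar>f x\<bar> powr 1) = avg S f" using assms by (intro avg_cong) auto
  moreover have "0 \<le> avg S f" using assms by (intro avg_nonneg) auto
  ultimately show ?thesis by (simp add: Lp_norm_def)
qed

lemma conv_norm_le:
  assumes f: "\<And>\<sigma>. \<sigma> \<in> Al n \<Longrightarrow> 0 \<le> f \<sigma>" "avg (Al n) f = 1"
  shows "sqnorm (Al n) (conv n f g) \<le> sqnorm (Al n) g"
proof -
  have "sqnorm (Al n) (conv n f g) \<le> avg (Al n) (conv n f (\<lambda>\<sigma>. (g \<sigma>)\<^sup>2))"
  proof (rule avg_mono)
    fix \<sigma> assume \<sigma>: "\<sigma> \<in> Al n"
    let ?g = "\<lambda>\<tau>. g (inv' \<tau> \<circ> \<sigma>)"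
    have "conv n f g \<sigma> = avg (Al n) (\<lambda>\<tau>. sqrt (f \<tau>) * (sqrt (f \<tau>) * ?g \<tau>))"
      unfolding conv_eq[OF \<sigma>] using f(1) by (intro avg_cong) (simp add: mult.assoc[symmetric])
    then have "(conv n f g \<sigma>)\<^sup>2 \<le> avg (Al n) (\<lambda>\<tau>. (sqrt (f \<tau>))\<^sup>2) * avg (Al n) (\<lambda>\<tau>. (sqrt (f \<tau>) * ?g \<tau>)\<^sup>2)"
      using avg_Cauchy_Schwarz[of "Al n" "\<lambda>\<tau>. sqrt (f \<tau>)" "\<lambda>\<tau>. sqrt (f \<tau>) * ?g \<tau>"] by simp
    also have "avg (Al n) (\<lambda>\<tau>. (sqrt (f \<tau>))\<^sup>2) = avg (Al n) f" using f(1) by (intro avg_cong) simp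
    also have "avg (Al n) (\<lambda>\<tau>. (sqrt (f \<tau>) * ?g \<tau>)\<^sup>2) = conv n f (\<lambda>\<sigma>. (g \<sigma>)\<^sup>2) \<sigma>"
      unfolding conv_eq[OF \<sigma>] using f(1) by (intro avg_cong) (simp add: power_mult_distrib)
    finally show "(conv n f g \<sigma>)\<^sup>2 \<le> conv n f (\<lambda>\<sigma>. (g \<sigma>)\<^sup>2) \<sigma>" using f(2) by simp
  qed
  then show ?thesis by (simp add: avg_conv f)
qed

lemma conv_power_contraction:
  assumes f: "\<And>\<sigma>. \<sigma> \<in> Al n \<Longrightarrow> 0 \<le> f \<sigma>" "avg (Al n) f = 1"
  shows "avg (Al n) (\<lambda>\<sigma>. ((conv n f ^^ m) f \<sigma> - 1)\<^sup>2) \<le> avg (Al n) (\<lambda>\<sigma>. (f \<sigma> - 1)\<^sup>2)"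
proof (induction m)
  case (Suc m)
  have "conv n f (\<lambda>_. 1) \<sigma> = 1" for \<sigma>
    using f(2) by (simp add: conv_def)
  then have "avg (Al n) (\<lambda>\<sigma>. ((conv n f ^^ Suc m) f \<sigma> - 1)\<^sup>2) = avg (Al n) (\<lambda>\<sigma>. (conv n f (\<lambda>x. (conv n f ^^ m) f x - 1) \<sigma>)\<^sup>2)"
    by (simp add: conv_diff)
  also have "\<dots> \<le> avg (Al n) (\<lambda>\<sigma>. ((conv n f ^^ m) f \<sigma> - 1)\<^sup>2)"
    by (rule conv_norm_le[OF f])
  also note Suc
  finally show ?case .
qed simp

lemma avg_square_deviation:
  assumes "avg (Al n) f = 1"
  shows "avg (Al n) (\<lambda>\<sigma>. (f \<sigma> - 1)\<^sup>2) = avg (Al n) (\<lambda>\<sigma>. (f \<sigma>)\<^sup>2) - 1"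
proof -
  have "(\<lambda>\<sigma>. (f \<sigma> - 1)\<^sup>2) = (\<lambda>\<sigma>. ((f \<sigma>)\<^sup>2 - 2 * f \<sigma>) + 1)"
    by (auto simp: power2_eq_square algebra_simps)
  then show ?thesis using assms by (simp add: avg_add avg_diff avg_cmult avg_const)
qed

text \<open>The power is 1 plus its projection p to \<open>high\<close> plus a rest g, which has
  mean zero and is orthogonal to \<open>high\<close>. The level weights of g are those of the power,
  since both p and 1 are annihilated by the pairings with pure functions of these levels. Level d
  contributes at most n ^ d * (q ^ d) ^ (m + 1) \<le> \<delta> ^ d, a geometric series. The
  condition on n contains 6 * d \<le> n for the top level d = 4 * j.\<close>

lemma conv_power_deviation_le:
  fixes L r q :: real
  assumes f: "\<And>\<sigma>. \<sigma> \<in> Al n \<Longrightarrow> 0 \<le> f \<sigma>" "avg (Al n) f = 1" "sqnorm (Al n) f = exp (2 * L)"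
    and glob: "\<And>t. t \<le> n \<Longrightarrow> global_at n t r f" and L: "0 \<le> L"
    and n: "24 * j + 2 \<le> n"
    and q: "600 * r\<^sup>2 * (L + 1 + 4 * real j) / real n \<le> q" "real n * q ^ Suc m \<le> \<delta>" "0 \<le> \<delta>" "\<delta> \<le> 1/2"
  shows "avg (Al n) (\<lambda>\<sigma>. ((conv n f ^^ m) f \<sigma> - 1)\<^sup>2) \<le> 2 * \<delta> + exp (2 * L) ^ Suc m / (2 ^ j) ^ m"
proof -
  let ?D = "4 * j" and ?F = "(conv n f ^^ m) f"
  have "\<exists>K e. orthonormal (Sy n) K e \<and> (\<forall>i<K. pure n d (e i)) \<and>
      (\<forall>v x. pure n d v \<longrightarrow> x \<in> Sy n \<longrightarrow> v x = (\<Sum>i<K. ip (Sy n) v (e i) * e i x))" for d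
  proof -
    obtain K e where "orthonormal (Sy n) K e" "\<And>i. i < K \<Longrightarrow> e i \<in> {u. pure n d u}"
      "\<And>v x. v \<in> {u. pure n d u} \<Longrightarrow> x \<in> Sy n \<Longrightarrow> v x = (\<Sum>i<K. ip (Sy n) v (e i) * e i x)"
      using orthonormal_basis_exists[OF finite_Sy Sy_nonempty fsubspace_pure] by blast
    then show ?thesis by (intro exI[of _ K] exI[of _ e]) simp
  qed
  then obtain K e where e: "\<And>d. orthonormal (Sy n) (K d) (e d)" "\<And>d i. i < K d \<Longrightarrow> pure n d (e d i)"
    "\<And>d v x. pure n d v \<Longrightarrow> x \<in> Sy n \<Longrightarrow> v x = (\<Sum>i<K d. ip (Sy n) v (e d i) * e d i x)"
    by metis
  obtain p where p: "p \<in> high n ?D" "\<And>v. v \<in> high n ?D \<Longrightarrow> ip (Al n) (\<lambda>x. ?F x - p x) v = 0"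
    "(2 ^ j) ^ m * ip (Al n) p p \<le> exp (2 * L) ^ Suc m"
    using conv_power_high_part[where j = j and n = n and f = f and m = m] n f(3) by auto
  define g where "g = (\<lambda>x. ?F x - p x - 1)"
  have one_high: "avg (Al n) h = 0" if "h \<in> high n ?D" for h
    using highD[OF that id_in_Sy, of "\<lambda>_. 1"] by (simp add: depends_on_def)
  have g_high: "ip (Al n) g h = 0" if h: "h \<in> high n ?D" for h
    using p(2)[OF h] one_high[OF h] unfolding g_def ip_diff[of _ "\<lambda>x. ?F x - p x"] by (simp add: ip_def)
  have g0: "avg (Al n) g = 0"
    unfolding g_def avg_diff using avg_conv_power[OF f(2)] one_high[OF p(1)] by (simp add: avg_const)
  have Kg: "Kop n g (e d i) \<iota> = Kop n ?F (e d i) \<iota>" if d: "d \<in> {1..?D}" "i < K d" and \<iota>: "\<iota> \<in> Sy n" for d i \<iota>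
  proof -
    have dep: "depends_on {1..d} (e d i)" using e(2)[OF d(2)] by (simp add: pure_def)
    have "Kop n p (e d i) \<iota> = 0"
      unfolding Kop_def using d by (intro highD[OF p(1) \<iota>] depends_on_mono[OF dep]) auto
    moreover have "avg (Al n) (\<lambda>\<tau>. e d i (\<tau> \<circ> \<iota>)) = 0"
    proof -
      have "avg (Al n) (\<lambda>\<tau>. e d i (\<tau> \<circ> \<iota>)) = avg (Sy n) (e d i)"
        using d n by (intro avg_Al_comp_eq_avg_Sy[OF dep _ _ \<iota>]) auto
      also have "\<dots> = 0" using d n by (intro avg_pure_eq_0[OF e(2)]) auto
      finally show ?thesis .
    qed
    ultimately show ?thesis by (simp add: Kop_def g_def left_diff_distrib avg_diff)
  qed
  let ?H = "\<lambda>d. \<Sum>i<K d. sqnorm (Sy n) (Kop n f (e d i))"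
  have "ip (Al n) g g \<le> (\<Sum>d\<in>{1..?D}. fact n / fact (n - d) * (\<Sum>i<K d. sqnorm (Sy n) (Kop n g (e d i))))"
    using n by (intro low_norm_le e g_high g0) auto
  also have "\<dots> \<le> (\<Sum>d\<in>{1..?D}. \<delta> ^ d)"
  proof (rule sum_mono)
    fix d assume d: "d \<in> {1..?D}"
    have q0: "0 \<le> q" using L by (intro order_trans[OF _ q(1)]) simp
    have "(\<Sum>i<K d. sqnorm (Sy n) (Kop n g (e d i))) = (\<Sum>i<K d. sqnorm (Sy n) (Kop n ?F (e d i)))"
      using Kg[OF d] by (intro sum.cong refl avg_cong) auto
    also have "\<dots> \<le> ?H d ^ Suc m" by (rule level_weight_conv_power[OF e(1) e(2) e(3)])
    also have "\<dots> \<le> (q ^ d) ^ Suc m"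
    proof (rule power_mono)
      have "?H d \<le> (600 * r\<^sup>2 * (L + 1 + real d) / real n) ^ d"
        using d n by (intro level_weight_le[OF f(1,2) _ glob L _ _ _ e(1,2)]) (auto simp: f(3))
      also have "\<dots> \<le> q ^ d"
      proof (rule power_mono)
        have "600 * r\<^sup>2 * (L + 1 + real d) / real n \<le> 600 * r\<^sup>2 * (L + 1 + 4 * real j) / real n"
          using d by (intro divide_right_mono mult_left_mono) auto
        then show "600 * r\<^sup>2 * (L + 1 + real d) / real n \<le> q" using q(1) by linarith
      qed (use L in simp)
      finally show "?H d \<le> q ^ d" .
      show "0 \<le> ?H d" by (intro sum_nonneg avg_nonneg) auto
    qed
    finally have 1: "(\<Sum>i<K d. sqnorm (Sy n) (Kop n g (e d i))) \<le> (q ^ Suc m) ^ d"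
      by (simp only: power_mult[symmetric] mult.commute)
    have "fact n / fact (n - d) \<le> real n ^ d"
    proof -
      have "fact n / fact (n - d) = real (n choose d) * fact d"
        using d n by (simp add: binomial_fact)
      also have "\<dots> \<le> real n ^ d"
        using binomial_fact_pow[of n d] by (metis of_nat_fact of_nat_le_iff of_nat_mult of_nat_power)
      finally show ?thesis .
    qed
    then have "fact n / fact (n - d) * (\<Sum>i<K d. sqnorm (Sy n) (Kop n g (e d i))) \<le> real n ^ d * (q ^ Suc m) ^ d"
      using 1 by (intro mult_mono) (auto intro!: sum_nonneg avg_nonneg)
    also have "\<dots> = (real n * q ^ Suc m) ^ d" by (rule power_mult_distrib[symmetric])
    also have "\<dots> \<le> \<delta> ^ d" using q(2) q0 by (intro power_mono) auto
    finally show "fact n / fact (n - d) * (\<Sum>i<K d. sqnorm (Sy n) (Kop n g (e d i))) \<le> \<delta> ^ d" .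
  qed
  also have "\<dots> \<le> 2 * \<delta>"
  proof -
    have "(\<Sum>d\<in>{1..D}. \<delta> ^ d) \<le> 2 * \<delta> * (1 - (1/2) ^ D)" for D
    proof (induction D)
      case (Suc D)
      have "\<delta> ^ Suc D \<le> \<delta> * (1/2) ^ D" using q(3,4) by (simp add: mult_left_mono power_mono)
      then show ?case using Suc by (simp add: algebra_simps)
    qed simp
    from this[of ?D] have "(\<Sum>d\<in>{1..?D}. \<delta> ^ d) \<le> 2 * \<delta> * (1 - (1/2) ^ ?D)" .
    also have "\<dots> \<le> 2 * \<delta> * 1" using q(3) by (intro mult_left_mono) auto
    finally show ?thesis by simp
  qed
  finally have low: "ip (Al n) g g \<le> 2 * \<delta>" .
  have "avg (Al n) (\<lambda>\<sigma>. (?F \<sigma> - 1)\<^sup>2) = avg (Al n) (\<lambda>\<sigma>. (g \<sigma>)\<^sup>2 + 2 * (g \<sigma> * p \<sigma>) + (p \<sigma>)\<^sup>2)"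
    unfolding g_def by (intro avg_cong) (simp add: power2_eq_square algebra_simps)
  also have "\<dots> = ip (Al n) g g + 2 * ip (Al n) g p + ip (Al n) p p"
    by (simp only: avg_add avg_cmult ip_self) (simp add: ip_def)
  also have "\<dots> = ip (Al n) g g + ip (Al n) p p" using g_high[OF p(1)] by simp
  also have "ip (Al n) p p \<le> exp (2 * L) ^ Suc m / (2 ^ j) ^ m"
    using p(3) by (simp add: pos_le_divide_eq mult.commute)
  finally show ?thesis using low by simp
qed

theorem theorem1p11:
  fixes \<epsilon> :: real
  assumes "\<epsilon> > 0"
  shows "\<exists>c::real. c > 0 \<and>
    (\<forall>(n::nat) (M::nat) (r::real) (f :: (nat \<Rightarrow> nat) \<Rightarrow> real).
       M \<ge> 1 \<longrightarrow> real M < ln (real n) \<longrightarrow> r > 0 \<longrightarrow>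
       (\<forall>\<sigma>\<in>carrier (alt_group n). f \<sigma> \<ge> 0) \<longrightarrow>
       biglobal n r f \<longrightarrow>
       Lp_norm 1 (carrier (alt_group n)) f = 1 \<longrightarrow>
       Lp_norm 2 (carrier (alt_group n)) f
         \<le> exp (c * (r powr -2) * real n powr (1 - 1 / real M)) \<longrightarrow>
       Lp_norm 2 (carrier (alt_group n)) (\<lambda>\<sigma>. conv_power n f M \<sigma> - 1) < \<epsilon>)"
proof -
  \<comment> \<open>The threshold for L: at or below it, the squared distance exp (2 * L) - 1 of f
    from 1 is already less than \<open>\<epsilon>\<^sup>2\<close>.\<close>
  define \<eta> where "\<eta> = ln (1 + \<epsilon>\<^sup>2) / 4"
  \<comment> \<open>The low levels will cost 2 * \<delta> and the high part s, together at most
    three quarters of \<open>\<epsilon>\<^sup>2\<close>.\<close>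
  define \<delta> where "\<delta> = min (1/2) (\<epsilon>\<^sup>2 / 8)"
  define s where "s = min 1 (\<epsilon>\<^sup>2 / 2)"
  \<comment> \<open>As ln 2 \<ge> 2/3, taking j \<ge> 6 * L + b ensures 2 ^ j \<ge> exp (4 * L) /
    s.\<close>
  define b where "b = (3/2) * ln (1 / s)"
  \<comment> \<open>For L > \<eta> it absorbs the additive constants: L + 1 + 4 * j \<le> 25 * L +
    (4 * b + 5) \<le> C * L.\<close>
  define C where "C = 25 + (4 * b + 5) / \<eta>"
  define c where "c = min \<eta> (\<delta> / (600 * C))"
  have \<epsilon>2: "\<epsilon>\<^sup>2 > 0" using assms by simp
  have "0 < ln (1 + \<epsilon>\<^sup>2)" using \<epsilon>2 by (intro ln_gt_zero) linarith
  then have \<eta>: "\<eta> > 0" by (simp add: \<eta>_def)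
  have \<delta>: "0 < \<delta>" "\<delta> \<le> 1/2" "2 * \<delta> \<le> \<epsilon>\<^sup>2 / 4" using \<epsilon>2 by (auto simp: \<delta>_def)
  have s: "0 < s" "s \<le> 1" "s \<le> \<epsilon>\<^sup>2 / 2" using \<epsilon>2 by (auto simp: s_def)
  have b: "0 \<le> b" using s by (simp add: b_def)
  have C: "C > 0" using b \<eta> by (simp add: C_def add_pos_nonneg)
  have c: "0 < c" "c \<le> \<eta>" "600 * C * c \<le> \<delta>"
  proof -
    show "0 < c" "c \<le> \<eta>" using \<eta> \<delta> C by (auto simp: c_def)
    have "c \<le> \<delta> / (600 * C)" by (simp add: c_def)
    then show "600 * C * c \<le> \<delta>" using C by (simp add: pos_le_divide_eq mult.commute)
  qed
  have main: "Lp_norm 2 (Al n) (\<lambda>\<sigma>. conv_power n f M \<sigma> - 1) < \<epsilon>"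
    if M: "1 \<le> M" "real M < ln (real n)" and r: "r > 0" and f: "\<forall>\<sigma>\<in>Al n. 0 \<le> f \<sigma>" and big: "biglobal n r f"
      and norm1: "Lp_norm 1 (Al n) f = 1"
      and norm2: "Lp_norm 2 (Al n) f \<le> exp (c * (r powr -2) * real n powr (1 - 1 / real M))"
    for n M r and f :: "(nat \<Rightarrow> nat) \<Rightarrow> real"
  proof -
    have f0: "0 \<le> f \<sigma>" if "\<sigma> \<in> Al n" for \<sigma> using f that by blast
    have f1: "avg (Al n) f = 1" using norm1 Lp_norm_1_nonneg[of "Al n" f] f0 by simp
    have n0: "0 < n" using M by (cases n) auto
    have n3: "3 \<le> n"
    proof (rule ccontr)
      assume "\<not> 3 \<le> n"
      then have "ln (real n) \<le> ln 2" using n0 by simp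
      then show False using M ln_2_less_1 by linarith
    qed
    have glob: "global_at n t r f" if "t \<le> n" for t
      by (rule biglobal_imp_global_at[OF big f0 norm1 that])
    \<comment> \<open>Testing globalness at one point against the constant 1 compares the mean 1 of
      f with r.\<close>
    have r1: "1 \<le> r"
    proof -
      have "avg (Al n) (\<lambda>x. f x * 1) \<le> r ^ 1 * avg (Al n) (\<lambda>_. 1)"
        by (rule global_atD[of n 1 r f "{1}" "\<lambda>_. 1"]) (use glob n3 in \<open>auto simp: depends_on_def\<close>)
      then show ?thesis by (simp add: f1 avg_const)
    qed
    define L where "L = ln (Lp_norm 2 (Al n) f)"
    let ?A = "sqnorm (Al n) f"
    have A1: "1 \<le> ?A" using avg_square_le[OF finite_Al Al_nonempty, of n f] f1 by simp
    then have Lp1: "1 \<le> Lp_norm 2 (Al n) f" by (simp add: Lp_norm_2)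
    have L0: "0 \<le> L" using Lp1 by (simp add: L_def)
    have eL: "?A = exp (2 * L)"
    proof -
      have "exp L = sqrt ?A" using Lp1 by (simp add: L_def Lp_norm_2)
      moreover have "exp (2 * L) = (exp L)\<^sup>2" by (simp add: exp_double)
      ultimately show ?thesis using A1 by simp
    qed
    define Y where "Y = real n powr (1 - 1 / real M)"
    have rp: "r powr -2 = 1 / r\<^sup>2" using r by (simp add: powr_minus divide_inverse powr_numeral)
    have LY: "r\<^sup>2 * L \<le> c * Y"
    proof -
      have "L \<le> c * (r powr -2) * Y"
      proof -
        have "Lp_norm 2 (Al n) f \<noteq> 0" using Lp1 by simp
        then have "exp L = Lp_norm 2 (Al n) f" using Lp1 by (simp add: L_def)
        then have "exp L \<le> exp (c * (r powr -2) * Y)" using norm2 by (simp only: Y_def)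
        then show ?thesis by (simp only: exp_le_cancel_iff)
      qed
      then have "L \<le> c * Y / r\<^sup>2" by (simp add: rp)
      then show ?thesis using r by (simp add: pos_le_divide_eq mult.commute)
    qed
    define m where "m = M - 1"
    have Mm: "M = Suc m" using M by (simp add: m_def)
    have Fm: "conv_power n f M = (conv n f ^^ m) f" by (simp add: conv_power_def m_def)
    have r2: "1 \<le> r\<^sup>2" using r1 by (simp add: one_le_power)
    have sq: "avg (Al n) (\<lambda>\<sigma>. ((conv n f ^^ m) f \<sigma> - 1)\<^sup>2) < \<epsilon>\<^sup>2"
    proof (cases "L \<le> \<eta>")
      case True
      have "avg (Al n) (\<lambda>\<sigma>. ((conv n f ^^ m) f \<sigma> - 1)\<^sup>2) \<le> exp (2 * L) - 1"
        using conv_power_contraction[OF f0 f1, of m] avg_square_deviation[OF f1] eL by simp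
      also have "exp (2 * L) \<le> exp (2 * \<eta>)" using True by simp
      also have "\<dots> < exp (4 * \<eta>)" using \<eta> by simp
      also have "4 * \<eta> = ln (1 + \<epsilon>\<^sup>2)" by (simp add: \<eta>_def)
      also have "exp (ln (1 + \<epsilon>\<^sup>2)) = 1 + \<epsilon>\<^sup>2" using \<epsilon>2 by (intro exp_ln) linarith
      finally show ?thesis by simp
    next
      case False
      \<comment> \<open>For M = 1 the norm hypothesis gives \<open>r\<^sup>2 * L\<close> \<le> c
        \<le> \<eta>, the case already settled. From now on there is at least one convolution to
        contract the high part.\<close>
      have m1: "1 \<le> m"
      proof (rule ccontr)
        assume "\<not> 1 \<le> m"
        then have "M = 1" using Mm by simp
        then have "Y = 1" using n0 by (simp add: Y_def)
        then have "r\<^sup>2 * L \<le> \<eta>" using LY c by simp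
        moreover have "1 * L \<le> r\<^sup>2 * L" using r2 L0 by (intro mult_right_mono) auto
        ultimately show False using False by simp
      qed
      define j where "j = nat \<lceil>6 * L + b\<rceil>"
      have j: "6 * L + b \<le> real j" "real j \<le> 6 * L + b + 1"
      proof -
        show "6 * L + b \<le> real j" unfolding j_def by (rule real_nat_ceiling_ge)
        show "real j \<le> 6 * L + b + 1" unfolding j_def using L0 b by (simp add: of_nat_nat)
      qed
      have R: "r\<^sup>2 * (L + 1 + 4 * real j) \<le> C * c * Y"
      proof -
        have "L + 1 + 4 * real j \<le> 25 * L + (4 * b + 5)" using j by simp
        also have "4 * b + 5 \<le> (4 * b + 5) / \<eta> * L"
        proof -
          have "1 \<le> L / \<eta>" using False \<eta> by simp
          then have "(4 * b + 5) * 1 \<le> (4 * b + 5) * (L / \<eta>)" using b by (intro mult_left_mono) auto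
          then show ?thesis by simp
        qed
        also have "25 * L + (4 * b + 5) / \<eta> * L = C * L" by (simp add: C_def algebra_simps)
        finally have "r\<^sup>2 * (L + 1 + 4 * real j) \<le> r\<^sup>2 * (C * L)" by (intro mult_left_mono) auto
        also have "\<dots> = C * (r\<^sup>2 * L)" by simp
        also have "\<dots> \<le> C * (c * Y)" using LY C by (intro mult_left_mono) auto
        finally show ?thesis by simp
      qed
      have R': "600 * r\<^sup>2 * (L + 1 + 4 * real j) \<le> \<delta> * Y"
      proof -
        have "600 * r\<^sup>2 * (L + 1 + 4 * real j) \<le> 600 * (C * c * Y)" using R by simp
        also have "\<dots> = (600 * C * c) * Y" by simp
        also have "\<dots> \<le> \<delta> * Y" using c(3) by (intro mult_right_mono) (auto simp: Y_def)
        finally show ?thesis .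
      qed
      have Yn: "Y \<le> real n"
      proof -
        have "real n powr (1 - 1 / real M) \<le> real n powr 1" using n0 M by (intro powr_mono) auto
        then show ?thesis using n0 by (simp add: Y_def)
      qed
      have jn: "24 * j + 2 \<le> n"
      proof -
        have "1 * (600 * (L + 1 + 4 * real j)) \<le> r\<^sup>2 * (600 * (L + 1 + 4 * real j))"
          using r2 L0 by (intro mult_right_mono) auto
        also have "\<dots> = 600 * r\<^sup>2 * (L + 1 + 4 * real j)" by (simp only: mult_ac)
        also note R'
        also have "\<delta> * Y \<le> (1/2) * real n" using \<delta> Yn by (intro mult_mono) (auto simp: Y_def)
        finally have "real (24 * j + 2) \<le> real n" using L0 by simp
        then show ?thesis by linarith
      qed
      have Yn_eq: "Y / real n = real n powr (- 1 / real M)"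
      proof -
        have "Y / real n = real n powr (1 - 1 / real M - 1)"
          unfolding Y_def powr_diff[of _ "1 - 1 / real M" 1] using n0 by simp
        then show ?thesis by simp
      qed
      have "avg (Al n) (\<lambda>\<sigma>. ((conv n f ^^ m) f \<sigma> - 1)\<^sup>2) \<le> 2 * \<delta> + exp (2 * L) ^ Suc m / (2 ^ j) ^ m"
      proof (rule conv_power_deviation_le[OF f0 f1 eL glob L0 jn, where q = "\<delta> * real n powr (- 1 / real M)"])
        show "600 * r\<^sup>2 * (L + 1 + 4 * real j) / real n \<le> \<delta> * real n powr (- 1 / real M)"
          using divide_right_mono[OF R', of "real n"] unfolding Yn_eq[symmetric] by simp
        \<comment> \<open>The exponent 1 - 1 / M is tuned for this: Y / n = n powr (- 1 / M), and
          its M-th power cancels the factor n.\<close>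
        have "(real n powr (- 1 / real M)) ^ Suc m = real n powr (- 1)"
          using n0 M unfolding Mm[symmetric] by (simp add: powr_power)
        then have "real n * (\<delta> * real n powr (- 1 / real M)) ^ Suc m = \<delta> ^ Suc m"
          using n0 by (simp only: power_mult_distrib) (simp add: powr_minus)
        also have "\<dots> \<le> \<delta>" using \<delta> by (simp add: mult_left_le power_le_one)
        finally show "real n * (\<delta> * real n powr (- 1 / real M)) ^ Suc m \<le> \<delta>" .
      qed (use \<delta> in auto)
      also have "exp (2 * L) ^ Suc m / (2 ^ j) ^ m \<le> s"
      proof -
        have E: "exp (4 * L) / 2 ^ j \<le> s"
        proof -
          have "4 * L + ln (1 / s) = (6 * L + b) * (2/3)" by (simp add: b_def)
          also have "\<dots> \<le> real j * ln 2"
            using j L0 b ln2_ge_two_thirds by (intro mult_mono) auto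
          finally have "exp (4 * L + ln (1 / s)) \<le> exp (real j * ln 2)" by simp
          also have "\<dots> = 2 ^ j" by (simp add: exp_of_nat_mult)
          also have "exp (4 * L + ln (1 / s)) = exp (4 * L) / s" using s by (simp add: exp_add)
          finally show ?thesis using s by (simp add: field_simps)
        qed
        \<comment> \<open>The squared norm enters m + 1 times against m contractions; m + 1 \<le> 2
          * m turns this into exp (4 * L) per contraction.\<close>
        have "exp (2 * L) ^ Suc m \<le> exp (2 * L) ^ (2 * m)"
          using L0 m1 by (intro power_increasing) auto
        also have "\<dots> = exp (4 * L) ^ m"
          by (simp add: exp_of_nat_mult[symmetric] mult_ac)
        finally have "exp (2 * L) ^ Suc m / (2 ^ j) ^ m \<le> (exp (4 * L) / 2 ^ j) ^ m"
          by (simp add: power_divide divide_right_mono)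
        also have "\<dots> \<le> s ^ m" using E by (intro power_mono) auto
        also have "\<dots> \<le> s ^ 1" using s m1 by (intro power_decreasing) auto
        finally show ?thesis by simp
      qed
      also have "2 * \<delta> + s < \<epsilon>\<^sup>2" using \<delta> s \<epsilon>2 by linarith
      finally show ?thesis by simp
    qed
    have "Lp_norm 2 (Al n) (\<lambda>\<sigma>. conv_power n f M \<sigma> - 1) < sqrt (\<epsilon>\<^sup>2)"
      unfolding Lp_norm_2 Fm using sq by (rule real_sqrt_less_mono)
    then show ?thesis using assms by simp
  qed
  show ?thesis by (intro exI[of _ c] conjI c(1) allI impI main)
qed

end
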